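(* Let $\mathcal{D}$ be a dense linear subspace of a complex Hilbert space $\mathscr{H}$ and $A$ a commutative $^*$-subalgebra of $\mathcal{L}^*(\mathcal{D})$. Assume that every element of $\mathbb{1}+A_{\mathrm{h}}^+$ is essentially selfadjoint (as a densely defined operator on $\mathscr{H}$). Then $A_{\mathrm{h}}$ with the operator order is a localizable archimedean partially ordered commutative ring, and the extended Gelfand transformation $\widehat{\cdot}\colon A_{\mathrm{h}}\to\mathscr{C}_{\mathrm{a.e.}}(\mathcal{K}(A_{\mathrm{h}}))$ is a positive ring morphism and an order embedding.
   Context: $\mathcal{L}^*(\mathcal{D})$ is the set of maps $a\colon\mathcal{D}\to\mathcal{D}$ for which there is $a^*\colon\mathcal{D}\to\mathcal{D}$ with $\langle\phi,a\psi\rangle=\langle a^*\phi,\psi\rangle$ for all $\phi,\psi\in\mathcal{D}$ (inner product antilinear in the first argument); it is a unital $^*$-algebra under pointwise linear operations, composition and $a\mapsto a^*$, with unit $\mathbb{1}=\mathrm{id}_{\mathcal{D}}$. A $^*$-subalgebra contains $\mathbb{1}$ and is closed under $^*$. $A_{\mathrm{h}}=\{a\in A:a^*=a\}$, a commutative ring, with the operator order $a\le b$ iff $\langle\phi,a\phi\rangle\le\langle\phi,b\phi\rangle$ for all $\phi\in\mathcal{D}$; $A_{\mathrm{h}}^+=\{a:0\le a\}$. All rings are commutative with unit; ring morphisms are unital. A partially ordered commutative ring is a commutative ring $R$ with a partial order $\le$ with $r\le s\Rightarrow r+t\le s+t$, and $R^+$ closed under multiplication and containing all squares. A ring morphism is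 positive if it maps positive elements to positive elements, an order embedding if moreover elements with positive image are positive. $\mathbb{N}=\{1,2,\dots\}$, $\mathbb{N}_0=\mathbb{N}\cup\{0\}$. $R$ is archimedean if $kg+h\in R^+$ for all $k\in\mathbb{N}$ implies $g\in R^+$. $\mathrm{Loc}(R)$ is the set of $s\in1+R^+$ with: $rs\in R^+\Rightarrow r\in R^+$ for all $r$; $R$ is localizable if each $r$ satisfies $-s\le r\le s$ for some $s\in\mathrm{Loc}(R)$. For a topological space $X$: $\mathscr{C}_{\mathrm{a.e.}}(X)$ is the set of continuous real functions defined on dense open subsets of $X$ modulo agreement on a dense open subset of the common domain, with pointwise operations on the intersection of domains and order $[f]\le[g]$ iff $f\le g$ on some dense open subset of $\operatorname{dom}f\cap\operatorname{dom}g$. $R_{\mathrm{loc}}$: fractions $r/s$ ($r\in R$, $s\in\mathrm{Loc}(R)$), $r/s=r'/s'$ iff $rs'=r's$, ordered by $p/q\le r/s$ iff $ps\le rq$. $R^{\mathrm{bd}}_{\mathrm{loc}}=\{a:\exists n\in\mathbb{N}_0,\ -n\le a\le n\}$. $\mathcal{K}(R)$: ring morphisms $\varphi\colon R^{\mathrm{bd}}_{\mathrm{loc}}\to\mathbb{R}$ with $\varphi(a)\ge0$ for $a\ge0$, weak-$*$ topology. $\mathrm{O}_{s<\infty}=\{\varphi:\varphi(1/s)>0\}$; for archimedean localizable $R$ these are dense open in $\mathcal{K}(R)$. The extended Gelfand transformation sends $r$ to the class $\widehat r\in\mathscr{C}_{\mathrm{a.e.}}(\mathcal{K}(R))$ of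 $r_s\colon\mathrm{O}_{s<\infty}\to\mathbb{R}$, $\varphi\mapsto\varphi(1/s)^{-1}\varphi(r/s)$, for any $s\in\mathrm{Loc}(R)$ with $r/s\in R^{\mathrm{bd}}_{\mathrm{loc}}$. *)

theory Defs
  imports "HOL-Analysis.Analysis" "HOL-Algebra.Ring"
begin

text \<open>The library has no class of complex vector spaces.  A complex Banach space is
  modelled as a real Banach space 'h together with a real-linear complex structure J
  (multiplication by i, J (J x) = -x); complex scalar multiplication is cscale J.\<close>
definition cscale :: "('h::real_vector \<Rightarrow> 'h) \<Rightarrow> complex \<Rightarrow> 'h \<Rightarrow> 'h" where
  "cscale J c x = Re c *\<^sub>R x + Im c *\<^sub>R J x"

definition hilbert_ip :: "('h::banach \<Rightarrow> 'h) \<Rightarrow> ('h \<Rightarrow> 'h \<Rightarrow> complex) \<Rightarrow> bool" where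
  "hilbert_ip J ip \<longleftrightarrow> linear J \<and> (\<forall>x. J (J x) = - x) \<and>
     (\<forall>x y z. ip x (y + z) = ip x y + ip x z) \<and>
     (\<forall>x y c. ip x (cscale J c y) = c * ip x y) \<and>
     (\<forall>x y. ip y x = cnj (ip x y)) \<and>
     (\<forall>x. ip x x = complex_of_real ((norm x)\<^sup>2))"

definition dense_subspace :: "('h::real_normed_vector \<Rightarrow> 'h) \<Rightarrow> 'h set \<Rightarrow> bool" where
  "dense_subspace J D \<longleftrightarrow> 0 \<in> D \<and> (\<forall>x\<in>D. \<forall>y\<in>D. x + y \<in> D) \<and>
     (\<forall>c. \<forall>x\<in>D. cscale J c x \<in> D) \<and> closure D = UNIV"

text \<open>Maps D \<rightarrow> D are represented by functions 'h \<Rightarrow> 'h that vanish outside D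
  (so that each map D \<rightarrow> D has exactly one representative).\<close>
definition on_D :: "'h::real_vector set \<Rightarrow> ('h \<Rightarrow> 'h) \<Rightarrow> bool" where
  "on_D D a \<longleftrightarrow> a ` D \<subseteq> D \<and> (\<forall>x. x \<notin> D \<longrightarrow> a x = 0)"

definition is_adjoint_on :: "'h::real_vector set \<Rightarrow> ('h \<Rightarrow> 'h \<Rightarrow> complex) \<Rightarrow> ('h \<Rightarrow> 'h) \<Rightarrow> ('h \<Rightarrow> 'h) \<Rightarrow> bool" where
  "is_adjoint_on D ip a b \<longleftrightarrow> on_D D b \<and> (\<forall>\<phi>\<in>D. \<forall>\<psi>\<in>D. ip \<phi> (a \<psi>) = ip (b \<phi>) \<psi>)"

definition Lstar :: "'h::real_vector set \<Rightarrow> ('h \<Rightarrow> 'h \<Rightarrow> complex) \<Rightarrow> ('h \<Rightarrow> 'h) set" where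
  "Lstar D ip = {a. on_D D a \<and> (\<exists>b. is_adjoint_on D ip a b)}"

definition ladj :: "'h::real_vector set \<Rightarrow> ('h \<Rightarrow> 'h \<Rightarrow> complex) \<Rightarrow> ('h \<Rightarrow> 'h) \<Rightarrow> ('h \<Rightarrow> 'h)" where
  "ladj D ip a = (THE b. is_adjoint_on D ip a b)"

definition lunit :: "'h::real_vector set \<Rightarrow> 'h \<Rightarrow> 'h" where
  "lunit D = (\<lambda>x. if x \<in> D then x else 0)"

definition lcomp :: "'h::real_vector set \<Rightarrow> ('h \<Rightarrow> 'h) \<Rightarrow> ('h \<Rightarrow> 'h) \<Rightarrow> 'h \<Rightarrow> 'h" where
  "lcomp D a b = (\<lambda>x. if x \<in> D then a (b x) else 0)"

definition ladd :: "('h::real_vector \<Rightarrow> 'h) \<Rightarrow> ('h \<Rightarrow> 'h) \<Rightarrow> 'h \<Rightarrow> 'h" where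
  "ladd a b = (\<lambda>x. a x + b x)"

definition lscale :: "('h::real_vector \<Rightarrow> 'h) \<Rightarrow> complex \<Rightarrow> ('h \<Rightarrow> 'h) \<Rightarrow> 'h \<Rightarrow> 'h" where
  "lscale J c a = (\<lambda>x. cscale J c (a x))"

definition comm_star_subalg :: "('h::real_vector \<Rightarrow> 'h) \<Rightarrow> 'h set \<Rightarrow> ('h \<Rightarrow> 'h \<Rightarrow> complex) \<Rightarrow> ('h \<Rightarrow> 'h) set \<Rightarrow> bool" where
  "comm_star_subalg J D ip A \<longleftrightarrow> A \<subseteq> Lstar D ip \<and> lunit D \<in> A \<and>
     (\<forall>a\<in>A. \<forall>b\<in>A. ladd a b \<in> A) \<and> (\<forall>c. \<forall>a\<in>A. lscale J c a \<in> A) \<and>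
     (\<forall>a\<in>A. \<forall>b\<in>A. lcomp D a b \<in> A) \<and> (\<forall>a\<in>A. ladj D ip a \<in> A) \<and>
     (\<forall>a\<in>A. \<forall>b\<in>A. lcomp D a b = lcomp D b a)"

definition herm_ring :: "'h::real_vector set \<Rightarrow> ('h \<Rightarrow> 'h \<Rightarrow> complex) \<Rightarrow> ('h \<Rightarrow> 'h) set \<Rightarrow> ('h \<Rightarrow> 'h) ring" where
  "herm_ring D ip A = \<lparr>carrier = {a \<in> A. ladj D ip a = a}, mult = lcomp D, one = lunit D,
      zero = (\<lambda>x. 0), add = ladd\<rparr>"

definition op_le :: "'h::real_vector set \<Rightarrow> ('h \<Rightarrow> 'h \<Rightarrow> complex) \<Rightarrow> ('h \<Rightarrow> 'h) \<Rightarrow> ('h \<Rightarrow> 'h) \<Rightarrow> bool" where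
  "op_le D ip a b \<longleftrightarrow> (\<forall>\<phi>\<in>D. Re (ip \<phi> (a \<phi>)) \<le> Re (ip \<phi> (b \<phi>)))"

definition op_graph :: "'h set \<Rightarrow> ('h \<Rightarrow> 'h) \<Rightarrow> ('h \<times> 'h) set" where
  "op_graph D a = {(x, a x) | x. x \<in> D}"

definition graph_adjoint :: "('h \<Rightarrow> 'h \<Rightarrow> complex) \<Rightarrow> ('h \<times> 'h) set \<Rightarrow> ('h \<times> 'h) set" where
  "graph_adjoint ip G = {(\<psi>, \<eta>). \<forall>(\<phi>, y) \<in> G. ip \<psi> y = ip \<eta> \<phi>}"

definition is_graph :: "('h \<times> 'h) set \<Rightarrow> bool" where
  "is_graph G \<longleftrightarrow> (\<forall>x y y'. (x, y) \<in> G \<longrightarrow> (x, y') \<in> G \<longrightarrow> y = y')"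

definition selfadjoint_graph :: "('h \<Rightarrow> 'h \<Rightarrow> complex) \<Rightarrow> ('h \<times> 'h) set \<Rightarrow> bool" where
  "selfadjoint_graph ip G \<longleftrightarrow> is_graph G \<and> graph_adjoint ip G = G"

definition ess_selfadjoint :: "('h::real_normed_vector \<Rightarrow> 'h \<Rightarrow> complex) \<Rightarrow> 'h set \<Rightarrow> ('h \<Rightarrow> 'h) \<Rightarrow> bool" where
  "ess_selfadjoint ip D a \<longleftrightarrow> selfadjoint_graph ip (closure (op_graph D a))"

definition po_cring :: "('a, 'm) ring_scheme \<Rightarrow> ('a \<Rightarrow> 'a \<Rightarrow> bool) \<Rightarrow> bool" where
  "po_cring R leq \<longleftrightarrow> cring R \<and>
     (\<forall>r\<in>carrier R. leq r r) \<and>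
     (\<forall>r\<in>carrier R. \<forall>s\<in>carrier R. leq r s \<longrightarrow> leq s r \<longrightarrow> r = s) \<and>
     (\<forall>r\<in>carrier R. \<forall>s\<in>carrier R. \<forall>t\<in>carrier R. leq r s \<longrightarrow> leq s t \<longrightarrow> leq r t) \<and>
     (\<forall>r\<in>carrier R. \<forall>s\<in>carrier R. \<forall>t\<in>carrier R. leq r s \<longrightarrow> leq (r \<oplus>\<^bsub>R\<^esub> t) (s \<oplus>\<^bsub>R\<^esub> t)) \<and>
     (\<forall>r\<in>carrier R. \<forall>s\<in>carrier R. leq \<zero>\<^bsub>R\<^esub> r \<longrightarrow> leq \<zero>\<^bsub>R\<^esub> s \<longrightarrow> leq \<zero>\<^bsub>R\<^esub> (r \<otimes>\<^bsub>R\<^esub> s)) \<and>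
     (\<forall>r\<in>carrier R. leq \<zero>\<^bsub>R\<^esub> (r \<otimes>\<^bsub>R\<^esub> r))"

definition archimedean_ring :: "('a, 'm) ring_scheme \<Rightarrow> ('a \<Rightarrow> 'a \<Rightarrow> bool) \<Rightarrow> bool" where
  "archimedean_ring R leq \<longleftrightarrow> (\<forall>g\<in>carrier R. \<forall>h\<in>carrier R.
     (\<forall>k::nat. k \<ge> 1 \<longrightarrow> leq \<zero>\<^bsub>R\<^esub> (add_pow R k g \<oplus>\<^bsub>R\<^esub> h)) \<longrightarrow> leq \<zero>\<^bsub>R\<^esub> g)"

definition Loc :: "('a, 'm) ring_scheme \<Rightarrow> ('a \<Rightarrow> 'a \<Rightarrow> bool) \<Rightarrow> 'a set" where
  "Loc R leq = {s \<in> carrier R. (\<exists>p\<in>carrier R. leq \<zero>\<^bsub>R\<^esub> p \<and> s = \<one>\<^bsub>R\<^esub> \<oplus>\<^bsub>R\<^esub> p) \<and>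
      (\<forall>r\<in>carrier R. leq \<zero>\<^bsub>R\<^esub> (r \<otimes>\<^bsub>R\<^esub> s) \<longrightarrow> leq \<zero>\<^bsub>R\<^esub> r)}"

definition localizable :: "('a, 'm) ring_scheme \<Rightarrow> ('a \<Rightarrow> 'a \<Rightarrow> bool) \<Rightarrow> bool" where
  "localizable R leq \<longleftrightarrow> (\<forall>r\<in>carrier R. \<exists>s\<in>Loc R leq. leq (\<ominus>\<^bsub>R\<^esub> s) r \<and> leq r s)"

text \<open>A fraction r/s is represented by the pair (r, s) with r \<in> R, s \<in> Loc(R).\<close>
definition frac_eq :: "('a, 'm) ring_scheme \<Rightarrow> 'a \<times> 'a \<Rightarrow> 'a \<times> 'a \<Rightarrow> bool" where
  "frac_eq R x y \<longleftrightarrow> fst x \<otimes>\<^bsub>R\<^esub> snd y = fst y \<otimes>\<^bsub>R\<^esub> snd x"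

definition frac_le :: "('a, 'm) ring_scheme \<Rightarrow> ('a \<Rightarrow> 'a \<Rightarrow> bool) \<Rightarrow> 'a \<times> 'a \<Rightarrow> 'a \<times> 'a \<Rightarrow> bool" where
  "frac_le R leq x y \<longleftrightarrow> leq (fst x \<otimes>\<^bsub>R\<^esub> snd y) (fst y \<otimes>\<^bsub>R\<^esub> snd x)"

definition frac_add :: "('a, 'm) ring_scheme \<Rightarrow> 'a \<times> 'a \<Rightarrow> 'a \<times> 'a \<Rightarrow> 'a \<times> 'a" where
  "frac_add R x y = (fst x \<otimes>\<^bsub>R\<^esub> snd y \<oplus>\<^bsub>R\<^esub> fst y \<otimes>\<^bsub>R\<^esub> snd x, snd x \<otimes>\<^bsub>R\<^esub> snd y)"

definition frac_mul :: "('a, 'm) ring_scheme \<Rightarrow> 'a \<times> 'a \<Rightarrow> 'a \<times> 'a \<Rightarrow> 'a \<times> 'a" where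
  "frac_mul R x y = (fst x \<otimes>\<^bsub>R\<^esub> fst y, snd x \<otimes>\<^bsub>R\<^esub> snd y)"

definition frac_nat :: "('a, 'm) ring_scheme \<Rightarrow> nat \<Rightarrow> 'a \<times> 'a" where
  "frac_nat R n = (add_pow R n \<one>\<^bsub>R\<^esub>, \<one>\<^bsub>R\<^esub>)"

definition Fracs :: "('a, 'm) ring_scheme \<Rightarrow> ('a \<Rightarrow> 'a \<Rightarrow> bool) \<Rightarrow> ('a \<times> 'a) set" where
  "Fracs R leq = carrier R \<times> Loc R leq"

definition BdFracs :: "('a, 'm) ring_scheme \<Rightarrow> ('a \<Rightarrow> 'a \<Rightarrow> bool) \<Rightarrow> ('a \<times> 'a) set" where
  "BdFracs R leq = {x \<in> Fracs R leq. \<exists>n::nat.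
      frac_le R leq (\<ominus>\<^bsub>R\<^esub> (add_pow R n \<one>\<^bsub>R\<^esub>), \<one>\<^bsub>R\<^esub>) x \<and> frac_le R leq x (frac_nat R n)}"

text \<open>K(R): positive unital ring morphisms R_loc^bd \<rightarrow> \<real>, represented as functions on
  representing pairs that respect equality of fractions (canonically 0 off R_loc^bd).\<close>
definition Kchar :: "('a, 'm) ring_scheme \<Rightarrow> ('a \<Rightarrow> 'a \<Rightarrow> bool) \<Rightarrow> ('a \<times> 'a \<Rightarrow> real) set" where
  "Kchar R leq = {\<phi>. (\<forall>x. x \<notin> BdFracs R leq \<longrightarrow> \<phi> x = 0) \<and>
      (\<forall>x\<in>BdFracs R leq. \<forall>y\<in>BdFracs R leq. frac_eq R x y \<longrightarrow> \<phi> x = \<phi> y) \<and>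
      (\<forall>x\<in>BdFracs R leq. \<forall>y\<in>BdFracs R leq. \<phi> (frac_add R x y) = \<phi> x + \<phi> y) \<and>
      (\<forall>x\<in>BdFracs R leq. \<forall>y\<in>BdFracs R leq. \<phi> (frac_mul R x y) = \<phi> x * \<phi> y) \<and>
      \<phi> (\<one>\<^bsub>R\<^esub>, \<one>\<^bsub>R\<^esub>) = 1 \<and>
      (\<forall>x\<in>BdFracs R leq. frac_le R leq (\<zero>\<^bsub>R\<^esub>, \<one>\<^bsub>R\<^esub>) x \<longrightarrow> \<phi> x \<ge> 0)}"

text \<open>Weak-* topology: pointwise convergence on all (representatives of) elements of R_loc^bd.\<close>
definition Ktop :: "('a, 'm) ring_scheme \<Rightarrow> ('a \<Rightarrow> 'a \<Rightarrow> bool) \<Rightarrow> ('a \<times> 'a \<Rightarrow> real) topology" where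
  "Ktop R leq = subtopology (powertop_real UNIV) (Kchar R leq)"

definition Ofin :: "('a, 'm) ring_scheme \<Rightarrow> ('a \<Rightarrow> 'a \<Rightarrow> bool) \<Rightarrow> 'a \<Rightarrow> ('a \<times> 'a \<Rightarrow> real) set" where
  "Ofin R leq s = {\<phi> \<in> Kchar R leq. \<phi> (\<one>\<^bsub>R\<^esub>, s) > 0}"

text \<open>Representatives: pairs (U, f), U dense open, f continuous on U (values off U irrelevant).\<close>
definition dense_open :: "'b topology \<Rightarrow> 'b set \<Rightarrow> bool" where
  "dense_open X U \<longleftrightarrow> openin X U \<and> X closure_of U = topspace X"

definition cae_rep :: "'b topology \<Rightarrow> 'b set \<times> ('b \<Rightarrow> real) \<Rightarrow> bool" where
  "cae_rep X u \<longleftrightarrow> dense_open X (fst u) \<and> continuous_map (subtopology X (fst u)) euclideanreal (snd u)"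

definition cae_eq :: "'b topology \<Rightarrow> 'b set \<times> ('b \<Rightarrow> real) \<Rightarrow> 'b set \<times> ('b \<Rightarrow> real) \<Rightarrow> bool" where
  "cae_eq X u v \<longleftrightarrow> (\<exists>W. dense_open X W \<and> W \<subseteq> fst u \<inter> fst v \<and> (\<forall>x\<in>W. snd u x = snd v x))"

definition cae_le :: "'b topology \<Rightarrow> 'b set \<times> ('b \<Rightarrow> real) \<Rightarrow> 'b set \<times> ('b \<Rightarrow> real) \<Rightarrow> bool" where
  "cae_le X u v \<longleftrightarrow> (\<exists>W. dense_open X W \<and> W \<subseteq> fst u \<inter> fst v \<and> (\<forall>x\<in>W. snd u x \<le> snd v x))"

definition cae_add :: "'b set \<times> ('b \<Rightarrow> real) \<Rightarrow> 'b set \<times> ('b \<Rightarrow> real) \<Rightarrow> 'b set \<times> ('b \<Rightarrow> real)" where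
  "cae_add u v = (fst u \<inter> fst v, \<lambda>x. snd u x + snd v x)"

definition cae_mul :: "'b set \<times> ('b \<Rightarrow> real) \<Rightarrow> 'b set \<times> ('b \<Rightarrow> real) \<Rightarrow> 'b set \<times> ('b \<Rightarrow> real)" where
  "cae_mul u v = (fst u \<inter> fst v, \<lambda>x. snd u x * snd v x)"

definition cae_const :: "'b topology \<Rightarrow> real \<Rightarrow> 'b set \<times> ('b \<Rightarrow> real)" where
  "cae_const X c = (topspace X, \<lambda>x. c)"

definition gelfand_rep :: "('a, 'm) ring_scheme \<Rightarrow> ('a \<Rightarrow> 'a \<Rightarrow> bool) \<Rightarrow> 'a \<Rightarrow> 'a \<Rightarrow> ('a \<times> 'a \<Rightarrow> real) set \<times> (('a \<times> 'a \<Rightarrow> real) \<Rightarrow> real)" where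
  "gelfand_rep R leq r s = (Ofin R leq s, \<lambda>\<phi>. inverse (\<phi> (\<one>\<^bsub>R\<^esub>, s)) * \<phi> (r, s))"

definition gelfand :: "('a, 'm) ring_scheme \<Rightarrow> ('a \<Rightarrow> 'a \<Rightarrow> bool) \<Rightarrow> 'a \<Rightarrow> ('a \<times> 'a \<Rightarrow> real) set \<times> (('a \<times> 'a \<Rightarrow> real) \<Rightarrow> real)" where
  "gelfand R leq r = gelfand_rep R leq r (SOME s. s \<in> Loc R leq \<and> (r, s) \<in> BdFracs R leq)"

end

theory Submission
  imports Defs
begin

text \<open>
  Every \<open>s \<in> 1 + A\<^sub>h\<^sup>+\<close> is bounded below by \<open>1\<close> and essentially selfadjoint, so \<open>s D\<close> is dense.
  As \<open>(1 + r\<^sup>2) s\<close> again lies in \<open>1 + A\<^sub>h\<^sup>+\<close>, the range \<open>s D\<close> is even a core for every \<open>r\<close>, hence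
  \<open>s r s \<ge> 0\<close> implies \<open>r \<ge> 0\<close>. If \<open>b \<ge> 0\<close>, the fractions \<open>b/(1 + b\<^sup>2)\<^sup>2\<close> and \<open>1/s\<close> extend to
  commuting positive bounded operators, whose product is positive; cancelling squares gives
  \<open>s b \<ge> 0\<close>. It follows that products of positive elements are positive and that
  \<open>Loc = 1 + A\<^sub>h\<^sup>+\<close>.

  A fraction \<open>r/s\<close> is bounded iff \<open>\<parallel>r \<phi>\<parallel> \<le> C \<parallel>s \<phi>\<parallel>\<close> on \<open>D\<close>, so bounded fractions form a commutative
  algebra of bounded operators. Its non-positive elements are detected by characters, by Zorn's
  lemma for modules over the cone of positive elements. Separation of points by characters yields
  both the density of the sets \<open>1/s > 0\<close> and the order embedding.
\<close>

section \<open>Densely defined quotients of operators\<close>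

text \<open>Essential selfadjointness enters through a single consequence, the density of ranges in
  \<open>S_dense_range\<close>; the rest is done with dense ranges and the real form
  \<open>rip\<close>. The obstacle is that commutation on \<open>D\<close> alone does not make the
  product of two positive operators positive, although the order axioms and the fractions rely on
  this. Before \<open>pos_mult_S\<close> the only products under control are congruences: for
  hermitian r, the form of r s r at \<phi> is the form of s at r \<phi>. This fixes the order of the
  results: (1 + r^2) s dominates 1 by a congruence, cancellation is first proved for s r s, and the
  one-sided cancellation in the definition of \<open>Loc\<close> follows only after products with
  \<open>S\<close> are known to be positive. On the algebraic side, characters are read off from the
  order: a maximal proper module over the cone is total, so each element has a cut against the
  multiples of the unit, and this cut is its value.\<close>

definition lin_on :: "'a::real_vector set \<Rightarrow> ('a \<Rightarrow> 'b::real_vector) \<Rightarrow> bool" where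
  "lin_on D f \<longleftrightarrow> (\<forall>x\<in>D. \<forall>y\<in>D. f (x + y) = f x + f y) \<and> (\<forall>c. \<forall>x\<in>D. f (c *\<^sub>R x) = c *\<^sub>R f x)"

lemma lin_on_diff:
  assumes "subspace D" "lin_on D f" "x \<in> D" "y \<in> D"
  shows "f (x - y) = f x - f y"
proof -
  have "f (x + (-1) *\<^sub>R y) = f x + (-1) *\<^sub>R f y"
    using assms subspace_scale[OF assms(1), of y "-1"] unfolding lin_on_def by metis
  then show ?thesis by simp
qed

lemma lin_on_zero: "subspace D \<Longrightarrow> lin_on D f \<Longrightarrow> f 0 = 0"
  unfolding lin_on_def using subspace_0 by (metis scale_zero_left)

lemma subspace_lin_on_image:
  assumes "subspace D" "lin_on D f"
  shows "subspace (f ` D)"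
proof (rule subspaceI)
  show "0 \<in> f ` D" using lin_on_zero[OF assms] subspace_0[OF assms(1)] by (metis imageI)
  show "x + y \<in> f ` D" if "x \<in> f ` D" "y \<in> f ` D" for x y
    using that assms subspace_add[OF assms(1)] unfolding lin_on_def by (smt (verit) imageE imageI)
  show "c *\<^sub>R x \<in> f ` D" if "x \<in> f ` D" for c x
    using that assms subspace_scale[OF assms(1)] unfolding lin_on_def by (smt (verit) imageE imageI)
qed

text \<open>The bound applied to differences shows that s x determines u x and that s x \<mapsto> u
  x is Lipschitz on the range of \<open>s\<close>. A Lipschitz map into a complete space extends to
  the closure, and linearity passes to limits. Linearity is stated on \<open>D\<close> only, because
  elements of the algebra are extended by 0 outside \<open>D\<close>.\<close>

lemma blinfun_quotient_exists:
  fixes s :: "'a::real_vector \<Rightarrow> 'b::real_normed_vector" and u :: "'a \<Rightarrow> 'c::banach"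
  assumes D: "subspace D" and s: "lin_on D s" and u: "lin_on D u"
    and dense: "closure (s ` D) = UNIV"
    and bound: "\<And>x. x \<in> D \<Longrightarrow> norm (u x) \<le> C * norm (s x)"
  shows "\<exists>F :: 'b \<Rightarrow>\<^sub>L 'c. \<forall>x\<in>D. blinfun_apply F (s x) = u x"
proof -
  \<comment> \<open>\<open>lipschitz_on\<close> includes nonnegativity of the constant, and
    \<open>C\<close> carries no sign.\<close>
  have bound': "norm (u x) \<le> \<bar>C\<bar> * norm (s x)" if "x \<in> D" for x
    using bound[OF that] by (smt (verit) mult_right_mono norm_ge_zero)
  define g where "g y = u (SOME x. x \<in> D \<and> s x = y)" for y
  have diff: "norm (u x - u x') \<le> \<bar>C\<bar> * norm (s x - s x')" if "x \<in> D" "x' \<in> D" for x x'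
    using bound'[OF subspace_diff[OF D that]] lin_on_diff[OF D s that] lin_on_diff[OF D u that] by simp
  have g: "g (s x) = u x" if "x \<in> D" for x
  proof -
    have "(SOME x'. x' \<in> D \<and> s x' = s x) \<in> D \<and> s (SOME x'. x' \<in> D \<and> s x' = s x) = s x"
      by (rule someI) (use that in auto)
    then have "norm (g (s x) - u x) \<le> \<bar>C\<bar> * norm (s x - s x)"
      unfolding g_def using diff that by metis
    then show ?thesis by simp
  qed
  have "\<bar>C\<bar>-lipschitz_on (s ` D) g"
    by (rule lipschitz_onI) (auto simp: g dist_norm diff)
  from lipschitz_extend_closure[OF this] obtain F where
    lip: "\<bar>C\<bar>-lipschitz_on (closure (s ` D)) F" and Fg: "\<And>y. y \<in> s ` D \<Longrightarrow> F y = g y" by blast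
  have cont: "continuous_on UNIV F"
    using lipschitz_on_continuous_on[OF lip] dense by simp
  have Fs: "F (s x) = u x" if "x \<in> D" for x using Fg g that by auto
  \<comment> \<open>Additivity is extended one argument at a time: here the second summand still
    lies in the range of \<open>s\<close>, in \<open>add\<close> it is arbitrary.\<close>
  have add1: "F (y + s x') = F y + u x'" if x': "x' \<in> D" for y x'
  proof -
    have "(\<lambda>y. F (y + s x') - F y - u x') y = 0"
    proof (rule continuous_constant_on_closure[where S="s ` D" and f="\<lambda>y. F (y + s x') - F y - u x'"])
      show "continuous_on (closure (s ` D)) (\<lambda>y. F (y + s x') - F y - u x')"
        unfolding dense by (intro continuous_intros continuous_on_compose2[OF cont] cont) auto
      show "F (y + s x') - F y - u x' = 0" if "y \<in> s ` D" for y
      proof -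
        from that obtain x where x: "x \<in> D" "y = s x" by auto
        have "y + s x' = s (x + x')" using s x x' unfolding lin_on_def by simp
        moreover have "u (x + x') = u x + u x'" using u x x' unfolding lin_on_def by simp
        ultimately show ?thesis using Fs x x' subspace_add[OF D x(1) x'] by simp
      qed
      show "y \<in> closure (s ` D)" using dense by simp
    qed
    then show ?thesis by (simp add: algebra_simps)
  qed
  have add: "F (y + z) = F y + F z" for y z
  proof -
    have "(\<lambda>z. F (y + z) - F y - F z) z = 0"
    proof (rule continuous_constant_on_closure[where S="s ` D" and f="\<lambda>z. F (y + z) - F y - F z"])
      show "continuous_on (closure (s ` D)) (\<lambda>z. F (y + z) - F y - F z)"
        unfolding dense by (intro continuous_intros continuous_on_compose2[OF cont] cont) auto
      show "F (y + z) - F y - F z = 0" if "z \<in> s ` D" for z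
        using that add1 Fs by auto
      show "z \<in> closure (s ` D)" using dense by simp
    qed
    then show ?thesis by (simp add: algebra_simps)
  qed
  have scale: "F (c *\<^sub>R y) = c *\<^sub>R F y" for c y
  proof -
    have "(\<lambda>y. F (c *\<^sub>R y) - c *\<^sub>R F y) y = 0"
    proof (rule continuous_constant_on_closure[where S="s ` D" and f="\<lambda>y. F (c *\<^sub>R y) - c *\<^sub>R F y"])
      show "continuous_on (closure (s ` D)) (\<lambda>y. F (c *\<^sub>R y) - c *\<^sub>R F y)"
        unfolding dense by (intro continuous_intros continuous_on_compose2[OF cont] cont) auto
      show "F (c *\<^sub>R y) - c *\<^sub>R F y = 0" if "y \<in> s ` D" for y
      proof -
        from that obtain x where x: "x \<in> D" "y = s x" by auto
        have "c *\<^sub>R y = s (c *\<^sub>R x)" "u (c *\<^sub>R x) = c *\<^sub>R u x" using s u x unfolding lin_on_def by simp_all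
        then show ?thesis using Fs x subspace_scale[OF D x(1)] by simp
      qed
      show "y \<in> closure (s ` D)" using dense by simp
    qed
    then show ?thesis by simp
  qed
  have F0: "F 0 = 0" using scale[of 0 0] by simp
  have "norm (F y) \<le> norm y * \<bar>C\<bar>" for y
    using lipschitz_onD[OF lip, of y 0] dense F0 by (simp add: dist_norm mult.commute)
  then have "bounded_linear F"
    by (intro bounded_linear_intro[where K="\<bar>C\<bar>"] add scale) auto
  then show ?thesis using Fs by (metis bounded_linear_Blinfun_apply)
qed

section \<open>Real Hilbert spaces\<close>

text \<open>Instantiated below with the real part of the complex inner product: symmetry, positivity
  of forms and density can be tested on it, and the type class \<open>banach\<close> contributes
  completeness.\<close>

locale real_hilbert =
  fixes rip :: "'h::banach \<Rightarrow> 'h \<Rightarrow> real"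
  assumes rip_add_left: "rip (x + y) z = rip x z + rip y z"
    and rip_scale_left: "rip (c *\<^sub>R x) z = c * rip x z"
    and rip_sym: "rip x y = rip y x"
    and rip_self: "rip x x = (norm x)\<^sup>2"
begin

lemma rip_add_right: "rip x (y + z) = rip x y + rip x z"
  by (metis rip_add_left rip_sym)

lemma rip_scale_right: "rip x (c *\<^sub>R y) = c * rip x y"
  by (metis rip_scale_left rip_sym)

lemma rip_uminus_left: "rip (- x) z = - rip x z"
  using rip_scale_left[of "-1"] by simp

lemma rip_diff_left: "rip (x - y) z = rip x z - rip y z"
  using rip_add_left[of x "- y"] by (simp add: rip_uminus_left)

lemma rip_diff_right: "rip x (y - z) = rip x y - rip x z"
  by (metis rip_diff_left rip_sym)

lemma rip_zero_left: "rip 0 z = 0"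
  using rip_scale_left[of 0] by simp

lemma rip_zero_right: "rip x 0 = 0"
  by (metis rip_zero_left rip_sym)

lemmas rip_simps = rip_add_left rip_add_right rip_scale_left rip_scale_right
  rip_diff_left rip_diff_right rip_zero_left rip_zero_right

lemma norm_add_sq: "(norm (x + y))\<^sup>2 = (norm x)\<^sup>2 + 2 * rip x y + (norm y)\<^sup>2"
  by (simp flip: rip_self add: rip_simps rip_sym[of y x])

lemma norm_diff_sq: "(norm (x - y))\<^sup>2 = (norm x)\<^sup>2 - 2 * rip x y + (norm y)\<^sup>2"
  by (simp flip: rip_self add: rip_simps rip_sym[of y x])

lemma rip_le_norm: "rip x y \<le> norm x * norm y"
proof -
  have "(norm (x + y))\<^sup>2 \<le> (norm x + norm y)\<^sup>2"
    by (intro power_mono norm_triangle_ineq) simp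
  then show ?thesis by (simp add: norm_add_sq power2_sum)
qed

lemma abs_rip_le_norm: "\<bar>rip x y\<bar> \<le> norm x * norm y"
  using rip_le_norm[of x y] rip_le_norm[of "- x" y] by (simp add: rip_uminus_left)

lemma bounded_bilinear_rip: "bounded_bilinear rip"
  by standard (auto simp: rip_simps abs_rip_le_norm intro!: exI[of _ 1])

lemma tendsto_rip:
  "(f \<longlongrightarrow> a) F \<Longrightarrow> (g \<longlongrightarrow> b) F \<Longrightarrow> ((\<lambda>n. rip (f n) (g n)) \<longlongrightarrow> rip a b) F"
  by (rule bounded_bilinear.tendsto[OF bounded_bilinear_rip])

text \<open>The projection theorem: a sequence in \<open>V\<close> minimising the distance to a point outside
  \<open>closure V\<close> is Cauchy by the parallelogram law.\<close>

lemma dense_if_orthogonal_zero: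
  assumes V: "subspace V" and orth: "\<And>\<eta>. (\<And>v. v \<in> V \<Longrightarrow> rip \<eta> v = 0) \<Longrightarrow> \<eta> = 0"
  shows "closure V = UNIV"
proof (rule ccontr)
  assume "closure V \<noteq> UNIV"
  then obtain x where x: "x \<notin> closure V" by auto
  have ne: "V \<noteq> {}" using subspace_0[OF V] by auto
  define d where "d = infdist x V"
  have d0: "0 \<le> d" unfolding d_def by (rule infdist_nonneg)
  have dle: "d \<le> norm (x - v)" if "v \<in> V" for v
    using infdist_le[OF that, of x] by (simp add: d_def dist_norm)
  have "\<exists>v\<in>V. (norm (x - v))\<^sup>2 < d\<^sup>2 + 1 / Suc n" for n
  proof -
    have "infdist x V < sqrt (d\<^sup>2 + 1 / Suc n)"
      by (rule real_less_rsqrt) (simp add: d_def)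
    then obtain v where "v \<in> V" and v: "dist x v < sqrt (d\<^sup>2 + 1 / Suc n)"
      unfolding infdist_notempty[OF ne] using cInf_lessD[of "dist x ` V"] ne by auto
    have "(norm (x - v))\<^sup>2 < (sqrt (d\<^sup>2 + 1 / Suc n))\<^sup>2"
      using v by (intro power_strict_mono) (auto simp: dist_norm)
    then show ?thesis using \<open>v \<in> V\<close> by (auto simp: add_nonneg_nonneg)
  qed
  then obtain v where vV: "\<And>n. v n \<in> V" and vn: "\<And>n. (norm (x - v n))\<^sup>2 < d\<^sup>2 + 1 / Suc n"
    by metis
  have mid: "(norm (v m - v n))\<^sup>2 \<le> 2 / Suc m + 2 / Suc n" for m n
  proof -
    have "(1/2) *\<^sub>R (v m + v n) \<in> V" using V vV by (simp add: subspace_add subspace_scale)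
    then have "d\<^sup>2 \<le> (norm (x - (1/2) *\<^sub>R (v m + v n)))\<^sup>2"
      using dle d0 by (simp add: power_mono)
    moreover have "(norm (v m - v n))\<^sup>2 + 4 * (norm (x - (1/2) *\<^sub>R (v m + v n)))\<^sup>2
        = 2 * (norm (x - v m))\<^sup>2 + 2 * (norm (x - v n))\<^sup>2"
    proof -
      have "v m - v n = (x - v n) - (x - v m)" by simp
      moreover have "x - (1/2) *\<^sub>R (v m + v n) = (1/2) *\<^sub>R ((x - v n) + (x - v m))"
        by (simp add: algebra_simps flip: scaleR_add_left)
      ultimately show ?thesis
        by (simp only: norm_diff_sq norm_scaleR power_mult_distrib norm_add_sq) (simp add: field_simps)
    qed
    moreover have "2 / real (Suc m) = 2 * (1 / real (Suc m))" "2 / real (Suc n) = 2 * (1 / real (Suc n))"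
      by simp_all
    ultimately show ?thesis using vn[of m] vn[of n] by linarith
  qed
  have "Cauchy v"
  proof (rule metric_CauchyI)
    fix e :: real assume "e > 0"
    then obtain M :: nat where M: "4 / e\<^sup>2 < M" using reals_Archimedean2 by blast
    have "dist (v m) (v n) < e" if "m \<ge> M" "n \<ge> M" for m n
    proof -
      have M0: "real M > 0" by (rule le_less_trans[OF _ M]) simp
      have "2 / Suc m \<le> 2 / M" "2 / Suc n \<le> 2 / M"
        using that M0 by (auto intro!: divide_left_mono)
      then have "(norm (v m - v n))\<^sup>2 \<le> 4 / M" using mid[of m n] by simp
      also have "4 / M < e\<^sup>2" using M M0 \<open>e > 0\<close> by (simp add: field_simps)
      finally show ?thesis using \<open>e > 0\<close> by (simp add: dist_norm power2_less_imp_less)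
    qed
    then show "\<exists>M. \<forall>m\<ge>M. \<forall>n\<ge>M. dist (v m) (v n) < e" by blast
  qed
  then obtain w where w: "v \<longlonglongrightarrow> w" using Cauchy_convergent convergent_def by blast
  have "(\<lambda>n. (norm (x - v n))\<^sup>2) \<longlonglongrightarrow> (norm (x - w))\<^sup>2"
    by (intro tendsto_intros w)
  moreover have "(\<lambda>n. d\<^sup>2 + 1 / Suc n) \<longlonglongrightarrow> d\<^sup>2 + 0"
    by (intro tendsto_intros) (use LIMSEQ_inverse_real_of_nat in \<open>simp add: inverse_eq_divide\<close>)
  ultimately have "(norm (x - w))\<^sup>2 \<le> d\<^sup>2 + 0"
    by (rule LIMSEQ_le) (intro exI[of _ 0] allI impI less_imp_le[OF vn])
  then have dw: "(norm (x - w))\<^sup>2 \<le> d\<^sup>2" by simp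
  have "rip (x - w) y = 0" if y: "y \<in> V" for y
  proof -
    \<comment> \<open>Moving the limit \<open>w\<close> by a multiple of \<open>y\<close> cannot
      bring it closer to \<open>x\<close> than \<open>d\<close>, and \<open>w\<close> itself is at
      distance at most \<open>d\<close>.\<close>
    have ineq: "0 \<le> t\<^sup>2 * (norm y)\<^sup>2 - 2 * t * rip (x - w) y" for t
    proof -
      have "(\<lambda>n. norm (x - (v n + t *\<^sub>R y))) \<longlonglongrightarrow> norm (x - (w + t *\<^sub>R y))"
        by (intro tendsto_intros w)
      moreover have "d \<le> norm (x - (v n + t *\<^sub>R y))" for n
        using dle V vV y by (simp add: subspace_add subspace_scale)
      ultimately have "d \<le> norm (x - (w + t *\<^sub>R y))"
        by (meson LIMSEQ_le_const)
      then have "d\<^sup>2 \<le> (norm ((x - w) - t *\<^sub>R y))\<^sup>2"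
        using d0 by (simp add: power_mono algebra_simps)
      then show ?thesis using dw by (simp add: norm_diff_sq rip_simps power_mult_distrib)
    qed
    show ?thesis
    proof (cases "y = 0")
      case True then show ?thesis by (simp add: rip_zero_right)
    next
      case False
      \<comment> \<open>This value of \<open>t\<close> minimises the quadratic polynomial in
        \<open>ineq\<close>.\<close>
      have "0 \<le> - (rip (x - w) y)\<^sup>2 / (norm y)\<^sup>2"
        using ineq[of "rip (x - w) y / (norm y)\<^sup>2"] False by (simp add: field_simps power2_eq_square)
      then show ?thesis using False by (simp add: field_simps)
    qed
  qed
  then have "x = w" using orth[of "x - w"] by simp
  then have "x \<in> closure V" using w vV closure_sequential by blast
  then show False using x by simp
qed

section \<open>Passing from dense sets to all vectors, and products of bounded positive
  operators\<close>

lemma nonneg_form_on_dense: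
  fixes X Y :: "'h \<Rightarrow>\<^sub>L 'h"
  assumes dense: "closure V = UNIV" and V: "\<And>x. x \<in> V \<Longrightarrow> 0 \<le> rip (X x) (Y x)"
  shows "0 \<le> rip (X x) (Y x)"
proof -
  have "x \<in> closure V" using dense by simp
  then obtain f where f: "\<And>n. f n \<in> V" "f \<longlonglongrightarrow> x" unfolding closure_sequential by blast
  have "(\<lambda>n. rip (X (f n)) (Y (f n))) \<longlonglongrightarrow> rip (X x) (Y x)"
    by (intro tendsto_rip tendsto_intros f)
  then show ?thesis by (rule LIMSEQ_le_const) (use V f in auto)
qed

lemma eq_on_dense:
  fixes X Y :: "'h \<Rightarrow>\<^sub>L 'h"
  assumes dense: "closure V = UNIV" and V: "\<And>x. x \<in> V \<Longrightarrow> X x = Y x"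
  shows "X = Y"
proof (rule blinfun_eqI)
  fix x
  have "x \<in> closure V" using dense by simp
  then obtain f where f: "\<And>n. f n \<in> V" "f \<longlonglongrightarrow> x" unfolding closure_sequential by blast
  have "(\<lambda>n. X (f n)) \<longlonglongrightarrow> X x" "(\<lambda>n. Y (f n)) \<longlonglongrightarrow> Y x"
    by (intro tendsto_intros f)+
  moreover have "(\<lambda>n. X (f n)) = (\<lambda>n. Y (f n))" using V f by auto
  ultimately show "X x = Y x" by (metis LIMSEQ_unique)
qed

lemma symmetric_on_dense:
  fixes X :: "'h \<Rightarrow>\<^sub>L 'h"
  assumes dense: "closure V = UNIV" and V: "\<And>x y. x \<in> V \<Longrightarrow> y \<in> V \<Longrightarrow> rip (X x) y = rip x (X y)"
  shows "rip (X x) y = rip x (X y)"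
proof -
  have "x \<in> closure V" "y \<in> closure V" using dense by simp_all
  then obtain f g where f: "\<And>n. f n \<in> V" "f \<longlonglongrightarrow> x" and g: "\<And>n. g n \<in> V" "g \<longlonglongrightarrow> y"
    unfolding closure_sequential by metis
  have "(\<lambda>n. rip (X (f n)) (g n)) \<longlonglongrightarrow> rip (X x) y" "(\<lambda>n. rip (f n) (X (g n))) \<longlonglongrightarrow> rip x (X y)"
    by (intro tendsto_rip tendsto_intros f g)+
  moreover have "(\<lambda>n. rip (X (f n)) (g n)) = (\<lambda>n. rip (f n) (X (g n)))" using V f g by auto
  ultimately show ?thesis by (metis LIMSEQ_unique)
qed

text \<open>Riesz' square-root-free argument: for \<open>Y\<^sub>0 = Y\<close> and \<open>Y\<^sub>k\<^sub>+\<^sub>1 = Y\<^sub>k - Y\<^sub>k\<^sup>2\<close> one has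
  \<open>Y = \<Sum>k<n. Y\<^sub>k\<^sup>2 + Y\<^sub>n\<close> with \<open>Y\<^sub>n \<rightarrow> 0\<close> strongly, and each \<open>B Y\<^sub>k\<^sup>2\<close> is positive.\<close>

lemma nonneg_form_compose:
  fixes B Y :: "'h \<Rightarrow>\<^sub>L 'h"
  assumes B: "\<And>x. 0 \<le> rip x (B x)" and Y0: "\<And>x. 0 \<le> rip x (Y x)"
    and Y1: "\<And>x. rip x (Y x) \<le> (norm x)\<^sup>2"
    and sym: "\<And>x y. rip (Y x) y = rip x (Y y)" and comm: "\<And>x. B (Y x) = Y (B x)"
  shows "0 \<le> rip x (B (Y x))"
proof -
  define y where "y = rec_nat Y (\<lambda>_ Z. Z - (Z o\<^sub>L Z))"
  have y0: "y 0 = Y" and ySuc: "\<And>n. y (Suc n) = y n - (y n o\<^sub>L y n)" by (simp_all add: y_def)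
  have yS: "y (Suc n) z = y n z - y n (y n z)" for n z
    by (simp only: ySuc blinfun.diff_left blinfun_apply_blinfun_compose comp_apply)
  have ysym: "rip (y n u) v = rip u (y n v)" for n u v
  proof (induction n arbitrary: u v)
    case 0 show ?case by (simp add: y0 sym)
  next
    case (Suc n) show ?case by (simp add: yS rip_simps Suc)
  qed
  have ycomm: "B (y n u) = y n (B u)" for n u
  proof (induction n arbitrary: u)
    case 0 show ?case by (simp add: y0 comm)
  next
    case (Suc n) show ?case by (simp add: yS blinfun.diff_right Suc)
  qed
  have ybd: "0 \<le> rip u (y n u) \<and> rip u (y n u) \<le> (norm u)\<^sup>2" for n u
  proof (induction n arbitrary: u)
    case 0 show ?case by (simp add: y0 Y0 Y1)
  next
    case (Suc n)
    \<comment> \<open>As operators, Y - Y^2 = Y (1 - Y) Y + (1 - Y) Y (1 - Y), a sum of two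
      congruences of positive operators. The upper bound holds because Y^2 is positive.\<close>
    have "rip u (y (Suc n) u) = ((norm (y n u))\<^sup>2 - rip (y n u) (y n (y n u)))
        + rip (u - y n u) (y n (u - y n u))"
      by (simp flip: rip_self add: yS rip_simps blinfun.diff_right ysym)
    moreover have "rip u (y (Suc n) u) = rip u (y n u) - (norm (y n u))\<^sup>2"
      by (simp flip: rip_self add: yS rip_simps ysym)
    ultimately show ?case using Suc[of u] Suc[of "y n u"] Suc[of "u - y n u"] by (smt (verit) zero_le_power2)
  qed
  \<comment> \<open>Telescoping bounds the sums of squared norms by the form of \<open>Y\<close> at
    \<open>x\<close>; hence the terms tend to 0, which gives the strong convergence of
    \<open>y n\<close> to 0.\<close>
  have "(\<Sum>k<n. (norm (y k x))\<^sup>2) = rip x (Y x) - rip x (y n x)" for n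
  proof (induction n)
    case 0 show ?case by (simp add: y0)
  next
    case (Suc n) then show ?case by (simp flip: rip_self add: yS rip_simps ysym)
  qed
  then have "(\<Sum>k<n. (norm (y k x))\<^sup>2) \<le> rip x (Y x)" for n using ybd[of x n] by simp
  then have "summable (\<lambda>k. (norm (y k x))\<^sup>2)" 
    by (intro bounded_imp_summable[of _ "rip x (Y x)"]) (simp_all only: lessThan_Suc_atMost[symmetric] zero_le_power2)
  then have "(\<lambda>k. sqrt ((norm (y k x))\<^sup>2)) \<longlonglongrightarrow> sqrt 0" by (intro tendsto_real_sqrt summable_LIMSEQ_zero)
  then have ylim: "(\<lambda>k. y k x) \<longlonglongrightarrow> 0" by (simp add: tendsto_norm_zero_iff)
  have decr: "rip x (B (y n x)) \<le> rip x (B (Y x))" for n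
  proof (induction n)
    case 0 show ?case by (simp add: y0)
  next
    case (Suc n)
    have "rip x (B (y n (y n x))) = rip (y n x) (B (y n x))" by (simp add: ycomm ysym)
    then show ?case using Suc B[of "y n x"] by (simp add: yS blinfun.diff_right rip_simps)
  qed
  have "(\<lambda>n. rip x (B (y n x))) \<longlonglongrightarrow> rip x (B 0)"
    by (intro tendsto_rip tendsto_intros ylim)
  then have "(\<lambda>n. rip x (B (y n x))) \<longlonglongrightarrow> 0" by (simp add: rip_simps)
  then show ?thesis by (rule LIMSEQ_le_const2) (use decr in auto)
qed

end

section \<open>Characters of archimedean ordered algebras\<close>

text \<open>The carrier \<open>B\<close> is explicit because the instance is the image of the
  bounded fractions inside all bounded operators. \<open>P_bound\<close> makes \<open>e\<close> an
  order unit, and \<open>P_arch\<close> is closedness of \<open>P\<close> in the direction of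
  \<open>e\<close>.\<close>

locale ordered_unital_algebra =
  fixes m :: "'a::real_vector \<Rightarrow> 'a \<Rightarrow> 'a" and e :: 'a and B P :: "'a set"
  assumes B: "subspace B" and eB: "e \<in> B"
    and m_closed: "x \<in> B \<Longrightarrow> y \<in> B \<Longrightarrow> m x y \<in> B"
    and m_comm: "x \<in> B \<Longrightarrow> y \<in> B \<Longrightarrow> m x y = m y x"
    and m_assoc: "x \<in> B \<Longrightarrow> y \<in> B \<Longrightarrow> z \<in> B \<Longrightarrow> m (m x y) z = m x (m y z)"
    and m_add: "x \<in> B \<Longrightarrow> y \<in> B \<Longrightarrow> z \<in> B \<Longrightarrow> m x (y + z) = m x y + m x z"
    and m_scale: "x \<in> B \<Longrightarrow> y \<in> B \<Longrightarrow> m x (c *\<^sub>R y) = c *\<^sub>R m x y"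
    and m_unit: "x \<in> B \<Longrightarrow> m x e = x"
    and PB: "P \<subseteq> B" and P_add: "p \<in> P \<Longrightarrow> q \<in> P \<Longrightarrow> p + q \<in> P"
    and P_mult: "p \<in> P \<Longrightarrow> q \<in> P \<Longrightarrow> m p q \<in> P"
    and P_scale: "p \<in> P \<Longrightarrow> 0 \<le> c \<Longrightarrow> c *\<^sub>R p \<in> P"
    and eP: "e \<in> P"
    and P_bound: "x \<in> B \<Longrightarrow> \<exists>n. n *\<^sub>R e - x \<in> P"
    and P_arch: "x \<in> B \<Longrightarrow> (\<And>\<epsilon>. \<epsilon> > 0 \<Longrightarrow> x + \<epsilon> *\<^sub>R e \<in> P) \<Longrightarrow> x \<in> P"
begin

lemmas B_closed = subspace_add[OF B] subspace_diff[OF B] subspace_neg[OF B] subspace_scale[OF B] eB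
  m_closed

lemma m_diff: "x \<in> B \<Longrightarrow> y \<in> B \<Longrightarrow> z \<in> B \<Longrightarrow> m x (y - z) = m x y - m x z"
  using m_add[of x y "(-1) *\<^sub>R z"] m_scale[of x z "-1"] by (simp add: B_closed)

lemma m_uminus: "x \<in> B \<Longrightarrow> y \<in> B \<Longrightarrow> m x (- y) = - m x y"
  using m_scale[of x y "-1"] by simp

lemma m_add_left: "x \<in> B \<Longrightarrow> y \<in> B \<Longrightarrow> z \<in> B \<Longrightarrow> m (x + y) z = m x z + m y z"
  using m_add[of z x y] by (simp add: m_comm B_closed)

lemma m_diff_left: "x \<in> B \<Longrightarrow> y \<in> B \<Longrightarrow> z \<in> B \<Longrightarrow> m (x - y) z = m x z - m y z"
  using m_diff[of z x y] by (simp add: m_comm B_closed)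

lemma m_scale_left: "x \<in> B \<Longrightarrow> y \<in> B \<Longrightarrow> m (c *\<^sub>R x) y = c *\<^sub>R m x y"
  using m_scale[of y x c] by (simp add: m_comm B_closed)

lemma m_unit_left: "x \<in> B \<Longrightarrow> m e x = x"
  using m_unit m_comm eB by metis

lemma PinB: "p \<in> P \<Longrightarrow> p \<in> B"
  using PB by auto

lemma zeroP: "0 \<in> P"
  using P_scale[OF eP, of 0] by simp

lemma P_bound_pos:
  assumes "x \<in> B" obtains n where "n > 0" "n *\<^sub>R e - x \<in> P"
proof -
  from P_bound[OF assms] obtain k where "k *\<^sub>R e - x \<in> P" ..
  then have "(k *\<^sub>R e - x) + (\<bar>k\<bar> + 1 - k) *\<^sub>R e \<in> P"
    by (intro P_add P_scale eP) auto
  then have "(\<bar>k\<bar> + 1) *\<^sub>R e - x \<in> P" by (simp add: algebra_simps)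
  then show ?thesis using that[of "\<bar>k\<bar> + 1"] by simp
qed

text \<open>The analogue of a quadratic module, with the semiring \<open>P\<close> in place of the
  sums of squares. A module is proper when it omits \<open>- e\<close>.\<close>

definition pmodule :: "'a set \<Rightarrow> bool" where
  "pmodule Q \<longleftrightarrow> P \<subseteq> Q \<and> Q \<subseteq> B \<and> (\<forall>x\<in>Q. \<forall>y\<in>Q. x + y \<in> Q) \<and> (\<forall>p\<in>P. \<forall>x\<in>Q. m p x \<in> Q)"

text \<open>The set is the module generated by \<open>Q\<close> and \<open>x\<close>; it absorbs
  \<open>P\<close> because \<open>P\<close> is closed under products.\<close>

lemma pmodule_adjoin:
  assumes Q: "pmodule Q" and x: "x \<in> B"
  shows "pmodule {q + m p x | q p. q \<in> Q \<and> p \<in> P}"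
    and "Q \<subseteq> {q + m p x | q p. q \<in> Q \<and> p \<in> P}"
    and "x \<in> {q + m p x | q p. q \<in> Q \<and> p \<in> P}"
proof -
  let ?S = "{q + m p x | q p. q \<in> Q \<and> p \<in> P}"
  have QB: "\<And>q. q \<in> Q \<Longrightarrow> q \<in> B" and PQ: "\<And>q. q \<in> P \<Longrightarrow> q \<in> Q"
    and Qadd: "\<And>a b. a \<in> Q \<Longrightarrow> b \<in> Q \<Longrightarrow> a + b \<in> Q"
    and Qm: "\<And>p a. p \<in> P \<Longrightarrow> a \<in> Q \<Longrightarrow> m p a \<in> Q"
    using Q unfolding pmodule_def by auto
  have "m 0 x = 0" using m_scale_left[OF x x, of 0] by simp
  then show QS: "Q \<subseteq> ?S" using zeroP by force
  have "x = 0 + m e x" using x by (simp add: m_unit_left)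
  then show "x \<in> ?S" using PQ[OF zeroP] eP by blast
  have SB: "?S \<subseteq> B" using QB PinB x by (auto simp: B_closed)
  have Sadd: "y + z \<in> ?S" if y: "y \<in> ?S" and z: "z \<in> ?S" for y z
  proof -
    from y obtain q p where qp: "q \<in> Q" "p \<in> P" "y = q + m p x" by blast
    from z obtain q' p' where qp': "q' \<in> Q" "p' \<in> P" "z = q' + m p' x" by blast
    have "y + z = (q + q') + m (p + p') x"
      using qp qp' x PinB by (simp add: m_add_left)
    then show ?thesis using Qadd P_add qp qp' by blast
  qed
  have Sm: "m r y \<in> ?S" if r: "r \<in> P" and y: "y \<in> ?S" for r y
  proof -
    from y obtain q p where qp: "q \<in> Q" "p \<in> P" "y = q + m p x" by blast
    have "m r y = m r q + m (m r p) x"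
      using qp r x PinB QB by (simp add: m_add m_assoc B_closed)
    then show ?thesis using Qm P_mult qp r by blast
  qed
  have PS: "P \<subseteq> ?S" by (rule subset_trans[OF _ QS]) (rule subsetI, rule PQ)
  show "pmodule ?S" unfolding pmodule_def by (intro conjI ballI PS SB Sadd Sm)
qed

lemma pmodule_P: "pmodule P"
  unfolding pmodule_def using PB P_add P_mult by auto

text \<open>The equation says q a = e + p. If a + k e is positive and q \<le> N e, then (N e - q)(a
  + k e) + p + k q = N a + (N k - 1) e is positive, so the lower bound of a improves by the fixed
  amount 1/N; finitely many repetitions reach 0. In contraposition, adjoining - a for a non-positive
  a leaves the module proper.\<close>

lemma positive_if_minus_unit_adjoined:
  assumes a: "a \<in> B" and p: "p \<in> P" and q: "q \<in> P" and eq: "- e = p + m q (- a)"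
  shows "a \<in> P"
proof -
  from P_bound_pos[OF PinB[OF q]] obtain N where N: "N > 0" "N *\<^sub>R e - q \<in> P" .
  note BB = a PinB[OF p] PinB[OF q] B_closed
  have qa: "m q a = e + p" using eq m_uminus[of q a] BB by (simp add: algebra_simps)
  have step: "a + (k - 1/N) *\<^sub>R e \<in> P" if k: "k \<ge> 0" "a + k *\<^sub>R e \<in> P" for k
  proof -
    have "m (N *\<^sub>R e - q) (a + k *\<^sub>R e) + (p + k *\<^sub>R q) \<in> P"
      using N k p q by (intro P_add[OF P_mult P_add[OF _ P_scale]]) auto
    also have "m (N *\<^sub>R e - q) (a + k *\<^sub>R e) = N *\<^sub>R a + (N * k) *\<^sub>R e - m q a - k *\<^sub>R q"
      using BB by (simp add: m_diff_left m_scale_left m_unit_left m_add m_scale m_unit algebra_simps)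
    finally have "N *\<^sub>R a + (N * k) *\<^sub>R e - e \<in> P" by (simp add: qa algebra_simps)
    then have "(1/N) *\<^sub>R (N *\<^sub>R a + (N * k) *\<^sub>R e - e) \<in> P" using N by (intro P_scale) auto
    then show ?thesis using N by (simp add: algebra_simps)
  qed
  obtain k where k: "k > 0" "k *\<^sub>R e - (- a) \<in> P" using P_bound_pos[of "- a"] a by (auto simp: B_closed)
  \<comment> \<open>Truncation at 0 keeps the shift nonnegative, as \<open>step\<close>
    requires.\<close>
  have it: "a + max 0 (k - n / N) *\<^sub>R e \<in> P" for n :: nat
  proof (induction n)
    case 0 show ?case using k by (simp add: add.commute)
  next
    case (Suc n)
    let ?j = "max 0 (k - n / N)" and ?l = "max 0 (k - Suc n / N)"
    have "real (Suc n) / N = n / N + 1 / N" "1 / N > 0" using N by (simp_all add: add_divide_distrib)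
    then have "?l \<ge> ?j - 1/N" by linarith
    then have "(a + (?j - 1/N) *\<^sub>R e) + (?l - (?j - 1/N)) *\<^sub>R e \<in> P"
      by (intro P_add[OF step P_scale] Suc eP) auto
    moreover have "(a + (?j - 1/N) *\<^sub>R e) + (?l - (?j - 1/N)) *\<^sub>R e = a + ?l *\<^sub>R e"
      by (simp only: add.assoc flip: scaleR_add_left) simp
    ultimately show ?case by (simp only:)
  qed
  obtain n :: nat where "k * N < n" using reals_Archimedean2 by blast
  then have "max 0 (k - n / N) = 0" using N by (simp add: field_simps)
  then show ?thesis using it[of n] by simp
qed

lemma maximal_pmodule:
  assumes "pmodule Q0" "- e \<notin> Q0"
  obtains Q where "pmodule Q" "Q0 \<subseteq> Q" "- e \<notin> Q"
    "\<And>Q'. pmodule Q' \<Longrightarrow> Q \<subseteq> Q' \<Longrightarrow> - e \<notin> Q' \<Longrightarrow> Q' = Q"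
proof -
  let ?F = "{Q. pmodule Q \<and> Q0 \<subseteq> Q \<and> - e \<notin> Q}"
  have "\<exists>Q\<in>?F. \<forall>X\<in>?F. Q \<subseteq> X \<longrightarrow> X = Q"
  proof (rule subset_Zorn_nonempty)
    show "?F \<noteq> {}" using assms by blast
    fix C assume C: "C \<noteq> {}" "subset.chain ?F C"
    then have CF: "C \<subseteq> ?F" and tot: "\<And>X Y. X \<in> C \<Longrightarrow> Y \<in> C \<Longrightarrow> X \<subseteq> Y \<or> Y \<subseteq> X"
      unfolding subset.chain_def by auto
    have "pmodule (\<Union>C)"
      unfolding pmodule_def
    proof (intro conjI ballI)
      show "P \<subseteq> \<Union>C" using C(1) CF unfolding pmodule_def by blast
      show "\<Union>C \<subseteq> B" using CF unfolding pmodule_def by blast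
      show "x + y \<in> \<Union>C" if x: "x \<in> \<Union>C" and y: "y \<in> \<Union>C" for x y
      proof -
        obtain X Y where XY: "X \<in> C" "x \<in> X" "Y \<in> C" "y \<in> Y" using x y by blast
        then obtain Z where "Z \<in> C" "x \<in> Z" "y \<in> Z" using tot[of X Y] by blast
        then show ?thesis using CF unfolding pmodule_def by blast
      qed
      show "m p x \<in> \<Union>C" if "p \<in> P" "x \<in> \<Union>C" for p x
        using that CF unfolding pmodule_def by blast
    qed
    then show "\<Union>C \<in> ?F" using C(1) CF by blast
  qed
  then obtain Q where QF: "Q \<in> ?F" and max: "\<forall>X\<in>?F. Q \<subseteq> X \<longrightarrow> X = Q" by (elim bexE)
  show ?thesis
  proof (rule that[of Q])
    show "pmodule Q" "Q0 \<subseteq> Q" "- e \<notin> Q" using QF by simp_all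
    show "X = Q" if X: "pmodule X" "Q \<subseteq> X" "- e \<notin> X" for X
    proof -
      have "X \<in> ?F" using X QF by auto
      then show ?thesis using max X(2) by simp
    qed
  qed
qed

text \<open>If x and - x were both missing, maximality would put - e into each of the two enlarged
  modules; eliminating x between the two representations of - e brings - e back into
  \<open>Q\<close>.\<close>

lemma maximal_pmodule_total:
  assumes Q: "pmodule Q" and eQ: "- e \<notin> Q"
    and max: "\<And>Q'. pmodule Q' \<Longrightarrow> Q \<subseteq> Q' \<Longrightarrow> - e \<notin> Q' \<Longrightarrow> Q' = Q"
    and x: "x \<in> B"
  shows "x \<in> Q \<or> - x \<in> Q"
proof (rule ccontr)
  assume nx: "\<not> (x \<in> Q \<or> - x \<in> Q)"
  have QB: "\<And>q. q \<in> Q \<Longrightarrow> q \<in> B" and PQ: "\<And>q. q \<in> P \<Longrightarrow> q \<in> Q"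
    and Qadd: "\<And>a b. a \<in> Q \<Longrightarrow> b \<in> Q \<Longrightarrow> a + b \<in> Q"
    and Qm: "\<And>p a. p \<in> P \<Longrightarrow> a \<in> Q \<Longrightarrow> m p a \<in> Q"
    using Q unfolding pmodule_def by auto
  have adj: "\<exists>q\<in>Q. \<exists>p\<in>P. - e = q + m p y" if y: "y \<in> B" "y \<notin> Q" for y
  proof (rule ccontr)
    assume "\<not> ?thesis"
    then have "- e \<notin> {q + m p y | q p. q \<in> Q \<and> p \<in> P}" by blast
    then have "{q + m p y | q p. q \<in> Q \<and> p \<in> P} = Q"
      by (intro max pmodule_adjoin[OF Q y(1)]) auto
    then show False using pmodule_adjoin(3)[OF Q y(1)] y(2) by auto
  qed
  obtain q1 p1 where 1: "q1 \<in> Q" "p1 \<in> P" "- e = q1 + m p1 x" using adj[OF x] nx by auto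
  obtain q2 p2 where 2: "q2 \<in> Q" "p2 \<in> P" "- e = q2 + m p2 (- x)"
    using adj[of "- x"] x nx by (auto simp: B_closed)
  note BB = x QB[OF 1(1)] QB[OF 2(1)] PinB[OF 1(2)] PinB[OF 2(2)] B_closed
  \<comment> \<open>Multiplying the two representations by \<open>p2\<close> and \<open>p1\<close>
    and adding removes \<open>x\<close> and leaves - p1 - p2 in \<open>Q\<close>; adding p2 gives -
    p1 in \<open>Q\<close>.\<close>
  have "m p2 (- e) = m p2 q1 + m p2 (m p1 x)" using 1(3) BB by (simp add: m_add)
  then have a: "- p2 = m p2 q1 + m p2 (m p1 x)" using BB by (simp add: m_uminus m_unit)
  have "m p1 (- e) = m p1 q2 + m p1 (m p2 (- x))" using 2(3) BB by (simp add: m_add)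
  then have b: "- p1 = m p1 q2 - m p1 (m p2 x)" using BB by (simp add: m_uminus m_unit)
  have c: "m p1 (m p2 x) = m p2 (m p1 x)"
    using BB by (simp flip: m_assoc add: m_comm[of p1 p2])
  have "- p1 = p2 + (- p2 + - p1)" by simp
  also have "- p2 + - p1 = (m p2 q1 + m p2 (m p1 x)) + (m p1 q2 - m p1 (m p2 x))"
    by (rule arg_cong2[OF a b])
  also have "\<dots> = m p2 q1 + m p1 q2" by (simp add: c)
  also have "p2 + \<dots> \<in> Q" using 1 2 by (intro Qadd Qm PQ[OF 2(2)])
  finally have np1: "- p1 \<in> Q" .
  \<comment> \<open>Since x \<ge> - n e, the element p1 x + n p1 is in \<open>Q\<close>, and - n p1
    is too. So p1 x lies in \<open>Q\<close>, and the first representation of - e does the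
    rest.\<close>
  obtain n where n: "n > 0" "n *\<^sub>R e - (- x) \<in> P" using P_bound_pos[of "- x"] x by (auto simp: B_closed)
  have "n *\<^sub>R e \<in> P" using n by (intro P_scale eP) auto
  then have "m (n *\<^sub>R e) (- p1) \<in> Q" using np1 by (rule Qm)
  moreover have "m (n *\<^sub>R e) (- p1) = - (n *\<^sub>R p1)"
    using BB by (simp add: m_scale_left m_uminus m_unit_left)
  ultimately have np: "- (n *\<^sub>R p1) \<in> Q" by simp
  have "q1 + (m p1 (n *\<^sub>R e - (- x)) + - (n *\<^sub>R p1)) \<in> Q"
    using n by (intro Qadd[OF 1(1) Qadd[OF PQ[OF P_mult[OF 1(2)]] np]])
  moreover have "m p1 (n *\<^sub>R e - (- x)) = n *\<^sub>R p1 + m p1 x"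
    using BB by (simp add: m_add m_scale m_unit)
  ultimately have "- e \<in> Q" using 1(3) by simp
  then show False using eQ by simp
qed

text \<open>A form of the Kadison-Dubois representation theorem for the semiring
  \<open>P\<close>.\<close>

theorem character_exists:
  assumes a: "a \<in> B" "a \<notin> P"
  shows "\<exists>ch :: 'a \<Rightarrow> real. (\<forall>x\<in>B. \<forall>y\<in>B. ch (x + y) = ch x + ch y \<and> ch (m x y) = ch x * ch y) \<and>
    ch e = 1 \<and> (\<forall>x\<in>P. 0 \<le> ch x) \<and> ch a < 0"
proof -
  \<comment> \<open>The module will contain - a', which only yields ch a' \<le> 0; the margin
    \<epsilon> turns this into ch a < 0.\<close>
  obtain \<epsilon> where \<epsilon>: "\<epsilon> > 0" "a + \<epsilon> *\<^sub>R e \<notin> P" using P_arch[OF a(1)] a(2) by blast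
  define a' where "a' = a + \<epsilon> *\<^sub>R e"
  have a'B: "a' \<in> B" using a by (simp add: a'_def B_closed)
  let ?Q0 = "{p + m q (- a') | p q. p \<in> P \<and> q \<in> P}"
  have Q0: "pmodule ?Q0" and a'Q0: "- a' \<in> ?Q0"
    using pmodule_adjoin(1,3)[OF pmodule_P, of "- a'"] a'B by (simp_all add: B_closed)
  have eQ0: "- e \<notin> ?Q0" using positive_if_minus_unit_adjoined[OF a'B] \<epsilon>(2) by (auto simp: a'_def)
  obtain Q where Q: "pmodule Q" "?Q0 \<subseteq> Q" "- e \<notin> Q"
    "\<And>Q'. pmodule Q' \<Longrightarrow> Q \<subseteq> Q' \<Longrightarrow> - e \<notin> Q' \<Longrightarrow> Q' = Q" by (rule maximal_pmodule[OF Q0 eQ0]) (rule that; assumption)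
  have tot: "x \<in> Q \<or> - x \<in> Q" if "x \<in> B" for x
    using maximal_pmodule_total[OF Q(1,3,4) that] by blast
  have QB: "\<And>q. q \<in> Q \<Longrightarrow> q \<in> B" and PQ: "\<And>q. q \<in> P \<Longrightarrow> q \<in> Q"
    and Qadd: "\<And>a b. a \<in> Q \<Longrightarrow> b \<in> Q \<Longrightarrow> a + b \<in> Q"
    and Qm: "\<And>p a. p \<in> P \<Longrightarrow> a \<in> Q \<Longrightarrow> m p a \<in> Q"
    using Q(1) unfolding pmodule_def by auto
  have Qscale: "c *\<^sub>R q \<in> Q" if "0 \<le> c" "q \<in> Q" for c q
    using Qm[OF P_scale[OF eP that(1)] that(2)] QB[OF that(2)] eB by (simp add: m_scale_left m_unit_left)
  have Qe: "0 \<le> c" if "c *\<^sub>R e \<in> Q" for c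
  proof (rule ccontr)
    assume "\<not> 0 \<le> c"
    then have "(1 / - c) *\<^sub>R (c *\<^sub>R e) \<in> Q" using that by (intro Qscale[OF _ that]) (auto simp: field_simps)
    then show False using Q(3) \<open>\<not> 0 \<le> c\<close> by simp
  qed
  \<comment> \<open>Totality of \<open>Q\<close> makes this a cut: \<open>below\<close> and
    \<open>above\<close> locate x strictly on either side of \<open>ch x\<close>. At the cut itself
    nothing is known, so equalities go through \<open>eqI\<close> with a margin \<delta>.\<close>
  define ch where "ch x = Sup {t. x - t *\<^sub>R e \<in> Q}" for x
  have ub: "t \<le> u" if "x - t *\<^sub>R e \<in> Q" "u *\<^sub>R e - x \<in> Q" for x t u
    using Qe[of "u - t"] Qadd[OF that] by (simp add: algebra_simps)
  have ne: "{t. x - t *\<^sub>R e \<in> Q} \<noteq> {}" if x: "x \<in> B" for x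
  proof -
    obtain n where "n *\<^sub>R e - (- x) \<in> P" using P_bound[of "- x"] x by (auto simp: B_closed)
    then have "x - (- n) *\<^sub>R e \<in> Q" using PQ by (simp add: algebra_simps)
    then show ?thesis by blast
  qed
  have bdd: "bdd_above {t. x - t *\<^sub>R e \<in> Q}" if x: "x \<in> B" for x
  proof -
    obtain n where "n *\<^sub>R e - x \<in> P" using P_bound[OF x] by auto
    then show ?thesis using ub[of x _ n] PQ by (auto intro!: bdd_aboveI[of _ n])
  qed
  have lower: "t \<le> ch x" if "x \<in> B" "x - t *\<^sub>R e \<in> Q" for x t
    unfolding ch_def using that bdd by (intro cSup_upper) auto
  have upper: "ch x \<le> t" if "x \<in> B" "t *\<^sub>R e - x \<in> Q" for x t
    unfolding ch_def using that ne ub by (intro cSup_least) auto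
  have below: "x - t *\<^sub>R e \<in> Q" if x: "x \<in> B" "t < ch x" for x t
  proof -
    obtain u where "x - u *\<^sub>R e \<in> Q" "t < u"
      using x ne less_cSup_iff[OF ne[OF x(1)] bdd[OF x(1)], of t] unfolding ch_def by auto
    then have "(x - u *\<^sub>R e) + (u - t) *\<^sub>R e \<in> Q" by (intro Qadd[OF _ PQ[OF P_scale[OF eP]]]) auto
    then show ?thesis by (simp add: algebra_simps)
  qed
  have above: "t *\<^sub>R e - x \<in> Q" if x: "x \<in> B" "ch x < t" for x t
    using tot[of "x - t *\<^sub>R e"] lower[of x t] x by (auto simp: B_closed)
  have eqI: "ch x = c" if x: "x \<in> B"
    and le: "\<And>\<delta>. \<delta> > 0 \<Longrightarrow> x - (c - \<delta>) *\<^sub>R e \<in> Q" "\<And>\<delta>. \<delta> > 0 \<Longrightarrow> (c + \<delta>) *\<^sub>R e - x \<in> Q" for x c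
  proof (rule antisym)
    show "ch x \<le> c" by (rule field_le_epsilon) (rule upper[OF x le(2)])
    show "c \<le> ch x"
    proof (rule field_le_epsilon)
      show "c \<le> ch x + \<delta>" if "\<delta> > 0" for \<delta> using lower[OF x le(1)[OF that]] by linarith
    qed
  qed
  have add: "ch (x + y) = ch x + ch y" if x: "x \<in> B" and y: "y \<in> B" for x y
  proof (rule eqI)
    show "x + y \<in> B" using x y by (simp add: B_closed)
    fix \<delta> :: real assume \<delta>: "\<delta> > 0"
    have h: "(\<delta>/2) *\<^sub>R e + (\<delta>/2) *\<^sub>R e = \<delta> *\<^sub>R e" by (simp flip: scaleR_add_left)
    have "(x - (ch x - \<delta>/2) *\<^sub>R e) + (y - (ch y - \<delta>/2) *\<^sub>R e) \<in> Q"
      using \<delta> by (intro Qadd below x y) auto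
    moreover have "(x - (ch x - \<delta>/2) *\<^sub>R e) + (y - (ch y - \<delta>/2) *\<^sub>R e) = x + y - (ch x + ch y - \<delta>) *\<^sub>R e"
      unfolding scaleR_diff_left scaleR_add_left h[symmetric] by (simp add: algebra_simps)
    ultimately show "x + y - (ch x + ch y - \<delta>) *\<^sub>R e \<in> Q" by (simp only:)
    have "((ch x + \<delta>/2) *\<^sub>R e - x) + ((ch y + \<delta>/2) *\<^sub>R e - y) \<in> Q"
      using \<delta> by (intro Qadd above x y) auto
    moreover have "((ch x + \<delta>/2) *\<^sub>R e - x) + ((ch y + \<delta>/2) *\<^sub>R e - y) = (ch x + ch y + \<delta>) *\<^sub>R e - (x + y)"
      unfolding scaleR_add_left h[symmetric] by (simp add: algebra_simps)
    ultimately show "(ch x + ch y + \<delta>) *\<^sub>R e - (x + y) \<in> Q" by (simp only:)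
  qed
  have pos: "0 \<le> ch x" if "x \<in> Q" for x using lower[of x 0] QB that by simp
  have chi0: "ch 0 = 0" using add[of 0 0] subspace_0[OF B] by simp
  have chi_minus: "ch (- x) = - ch x" if "x \<in> B" for x
    using add[OF that subspace_neg[OF B that]] chi0 by simp
  have chie: "ch (c *\<^sub>R e) = c" for c
  proof (rule eqI)
    show "c *\<^sub>R e \<in> B" by (simp add: B_closed)
    fix \<delta> :: real assume "\<delta> > 0"
    then have "\<delta> *\<^sub>R e \<in> Q" by (intro PQ P_scale eP) auto
    then show "c *\<^sub>R e - (c - \<delta>) *\<^sub>R e \<in> Q" "(c + \<delta>) *\<^sub>R e - c *\<^sub>R e \<in> Q" by (simp_all add: algebra_simps)
  qed
  have scale_pos: "ch (c *\<^sub>R x) = c * ch x" if x: "x \<in> B" and c: "c > 0" for c x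
  proof (rule eqI)
    show "c *\<^sub>R x \<in> B" using x by (simp add: B_closed)
    fix \<delta> :: real assume \<delta>: "\<delta> > 0"
    have "c *\<^sub>R (x - (ch x - \<delta>/c) *\<^sub>R e) \<in> Q" using \<delta> c by (intro Qscale below x) auto
    then show "c *\<^sub>R x - (c * ch x - \<delta>) *\<^sub>R e \<in> Q" using c by (simp add: algebra_simps)
    have "c *\<^sub>R ((ch x + \<delta>/c) *\<^sub>R e - x) \<in> Q" using \<delta> c by (intro Qscale above x) auto
    then show "(c * ch x + \<delta>) *\<^sub>R e - c *\<^sub>R x \<in> Q" using c by (simp add: algebra_simps)
  qed
  have scale: "ch (c *\<^sub>R x) = c * ch x" if x: "x \<in> B" for c x
    using scale_pos[OF x, of c] scale_pos[OF x, of "- c"] chi0 chi_minus[of "c *\<^sub>R x"] x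
    by (cases c "0 :: real" rule: linorder_cases) (auto simp: B_closed)
  \<comment> \<open>\<open>Q\<close> can be multiplied by elements of \<open>P\<close> only. So the
    kernel is first shown to absorb \<open>P\<close>, then \<open>B\<close>, by writing x as an
    element of \<open>P\<close> minus a multiple of \<open>e\<close>. Multiplicativity follows
    because y - ch y e is in the kernel.\<close>
  have null_pos: "ch (m p y) = 0" if p: "p \<in> P" and y: "y \<in> B" "ch y = 0" for p y
  proof (rule eqI)
    note BB = PinB[OF p] y(1) B_closed
    show "m p y \<in> B" using BB by simp
    fix \<delta> :: real assume \<delta>: "\<delta> > 0"
    obtain n where n: "n > 0" "n *\<^sub>R e - p \<in> P" using P_bound_pos[OF PinB[OF p]] .
    \<comment> \<open>The summand (\<delta>/n)(n e - p) exchanges the error (\<delta>/n) p for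
      \<delta> e.\<close>
    have "m p (y - (- \<delta>/n) *\<^sub>R e) + (\<delta>/n) *\<^sub>R (n *\<^sub>R e - p) \<in> Q"
      using \<delta> n p y by (intro Qadd[OF Qm Qscale[OF _ PQ]] below) (auto simp: field_simps)
    then show "m p y - (0 - \<delta>) *\<^sub>R e \<in> Q"
      using BB n by (simp add: m_add m_scale m_unit algebra_simps)
    have "m p ((\<delta>/n) *\<^sub>R e - y) + (\<delta>/n) *\<^sub>R (n *\<^sub>R e - p) \<in> Q"
      using \<delta> n p y by (intro Qadd[OF Qm Qscale[OF _ PQ]] above) (auto simp: field_simps)
    then show "(0 + \<delta>) *\<^sub>R e - m p y \<in> Q"
      using BB n by (simp add: m_diff m_scale m_unit algebra_simps)
  qed
  have null: "ch (m x y) = 0" if x: "x \<in> B" and y: "y \<in> B" "ch y = 0" for x y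
  proof -
    obtain n where n: "n *\<^sub>R e - (- x) \<in> P" using P_bound[of "- x"] x by (auto simp: B_closed)
    note BB = x y(1) PinB[OF n] B_closed
    have "m (n *\<^sub>R e - (- x)) y = m x y + n *\<^sub>R y"
      using BB by (simp add: m_add_left m_scale_left m_unit_left)
    then have "ch (m x y + n *\<^sub>R y) = 0" using null_pos[OF n y] by simp
    then show ?thesis using BB by (simp add: add scale y(2))
  qed
  have mult: "ch (m x y) = ch x * ch y" if x: "x \<in> B" and y: "y \<in> B" for x y
  proof -
    note BB = x y B_closed
    define y' where "y' = y - ch y *\<^sub>R e"
    have y': "y' \<in> B" using BB by (simp add: y'_def)
    have "y = y' + ch y *\<^sub>R e" by (simp add: y'_def)
    then have "ch y = ch y' + ch y" using add[OF y', of "ch y *\<^sub>R e"] chie BB by metis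
    then have "ch (m x y') = 0" using null[OF x y'] by simp
    moreover have "m x y = m x y' + ch y *\<^sub>R x"
      using BB by (simp add: y'_def m_diff m_scale m_unit)
    ultimately show ?thesis using BB y' by (simp add: add scale)
  qed
  have "- a' \<in> Q" using Q(2) a'Q0 by blast
  then have "ch a' \<le> 0" using pos[of "- a'"] chi_minus a'B by simp
  moreover have "ch a' = ch a + \<epsilon>" using add[OF a(1), of "\<epsilon> *\<^sub>R e"] chie by (simp add: a'_def B_closed)
  ultimately have "ch a < 0" using \<epsilon>(1) by simp
  moreover have "ch e = 1" using chie[of 1] by simp
  ultimately show ?thesis using add mult pos PQ by (intro exI[of _ ch]) auto
qed

end

section \<open>Essentially selfadjoint operators and products of positive elements\<close>

locale herm_alg =
  fixes J :: "'h::banach \<Rightarrow> 'h" and ip :: "'h \<Rightarrow> 'h \<Rightarrow> complex"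
    and D :: "'h set" and A :: "('h \<Rightarrow> 'h) set"
  assumes hil: "hilbert_ip J ip" and dd: "dense_subspace J D" and alg: "comm_star_subalg J D ip A"
    and esa: "\<forall>a\<in>carrier (herm_ring D ip A). op_le D ip \<zero>\<^bsub>herm_ring D ip A\<^esub> a \<longrightarrow>
      ess_selfadjoint ip D (\<one>\<^bsub>herm_ring D ip A\<^esub> \<oplus>\<^bsub>herm_ring D ip A\<^esub> a)"
begin

definition rip :: "'h \<Rightarrow> 'h \<Rightarrow> real" where "rip x y = Re (ip x y)"

lemma cscale_of_real: "cscale J (complex_of_real c) x = c *\<^sub>R x"
  by (simp add: cscale_def)

lemma ip_add: "ip x (y + z) = ip x y + ip x z"
  and ip_cscale: "ip x (cscale J c y) = c * ip x y"
  and ip_cnj: "ip y x = cnj (ip x y)"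
  and ip_self: "ip x x = complex_of_real ((norm x)\<^sup>2)"
  using hil unfolding hilbert_ip_def by blast+

lemma ip_scaleR: "ip x (c *\<^sub>R y) = c * ip x y"
  using ip_cscale[of x "complex_of_real c" y] by (simp add: cscale_of_real)

sublocale real_hilbert rip
proof
  fix x y z and c :: real
  show s: "rip x y = rip y x" for x y unfolding rip_def by (subst ip_cnj) simp
  show "rip (x + y) z = rip x z + rip y z" unfolding s[of _ z] by (simp add: rip_def ip_add)
  show "rip (c *\<^sub>R x) z = c * rip x z" unfolding s[of _ z] by (simp add: rip_def ip_scaleR)
  show "rip x x = (norm x)\<^sup>2" by (simp add: rip_def ip_self)
qed

lemma subspace_D: "subspace D"
  using dd unfolding dense_subspace_def by (auto simp: subspace_def simp flip: cscale_of_real)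

lemma dense_D: "closure D = UNIV" and cscale_D: "x \<in> D \<Longrightarrow> cscale J c x \<in> D"
  using dd unfolding dense_subspace_def by auto

lemmas D_closed = subspace_0[OF subspace_D] subspace_add[OF subspace_D] subspace_diff[OF subspace_D]
  subspace_scale[OF subspace_D]

lemma eq_by_D_rip:
  assumes "\<And>\<phi>. \<phi> \<in> D \<Longrightarrow> rip \<phi> x = rip \<phi> y"
  shows "x = y"
proof -
  have "x - y \<in> closure D" using dense_D by simp
  then obtain f where f: "\<And>n. f n \<in> D" "f \<longlonglongrightarrow> x - y" unfolding closure_sequential by blast
  have "(\<lambda>n. rip (f n) (x - y)) \<longlonglongrightarrow> rip (x - y) (x - y)" by (intro tendsto_rip tendsto_intros f)
  moreover have "rip (f n) (x - y) = 0" for n using assms[OF f(1)] by (simp add: rip_simps)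
  ultimately have "rip (x - y) (x - y) = 0" by (simp add: LIMSEQ_const_iff)
  then show ?thesis by (simp add: rip_self)
qed

lemma eq_by_D: "(\<And>\<phi>. \<phi> \<in> D \<Longrightarrow> ip \<phi> x = ip \<phi> y) \<Longrightarrow> x = y"
  by (rule eq_by_D_rip) (simp add: rip_def)

lemma adjoint_unique:
  assumes "is_adjoint_on D ip a b" "is_adjoint_on D ip a b'"
  shows "b = b'"
proof
  fix x
  show "b x = b' x"
  proof (cases "x \<in> D")
    case True
    show ?thesis
    proof (rule eq_by_D)
      fix \<phi> assume "\<phi> \<in> D"
      then have "ip (b x) \<phi> = ip (b' x) \<phi>" using assms True unfolding is_adjoint_on_def by metis
      then show "ip \<phi> (b x) = ip \<phi> (b' x)" by (metis ip_cnj)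
    qed
  next
    case False then show ?thesis using assms unfolding is_adjoint_on_def on_D_def by simp
  qed
qed

lemma ladj_eq: "is_adjoint_on D ip a b \<Longrightarrow> ladj D ip a = b"
  unfolding ladj_def by (rule the_equality) (auto intro: adjoint_unique)

section \<open>Hermitian elements of the algebra\<close>

definition H :: "('h \<Rightarrow> 'h) set" where "H = carrier (herm_ring D ip A)"

lemma A_on_D: "a \<in> A \<Longrightarrow> on_D D a"
  using alg unfolding comm_star_subalg_def Lstar_def by blast

lemma H_iff: "a \<in> H \<longleftrightarrow> a \<in> A \<and> (\<forall>\<phi>\<in>D. \<forall>\<psi>\<in>D. ip \<phi> (a \<psi>) = ip (a \<phi>) \<psi>)"
proof
  assume "a \<in> H"
  then have a: "a \<in> A" "ladj D ip a = a" by (simp_all add: H_def herm_ring_def)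
  then obtain b where b: "is_adjoint_on D ip a b" using alg unfolding comm_star_subalg_def Lstar_def by blast
  then have "b = a" using ladj_eq a by simp
  then show "a \<in> A \<and> (\<forall>\<phi>\<in>D. \<forall>\<psi>\<in>D. ip \<phi> (a \<psi>) = ip (a \<phi>) \<psi>)"
    using a b unfolding is_adjoint_on_def by blast
next
  assume r: "a \<in> A \<and> (\<forall>\<phi>\<in>D. \<forall>\<psi>\<in>D. ip \<phi> (a \<psi>) = ip (a \<phi>) \<psi>)"
  then have "is_adjoint_on D ip a a" unfolding is_adjoint_on_def using A_on_D by blast
  then show "a \<in> H" using ladj_eq r by (simp add: H_def herm_ring_def)
qed

lemma H_A: "a \<in> H \<Longrightarrow> a \<in> A" by (simp add: H_iff)

lemma H_in_D: "a \<in> H \<Longrightarrow> \<phi> \<in> D \<Longrightarrow> a \<phi> \<in> D"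
  using A_on_D[OF H_A] unfolding on_D_def by blast

lemma H_off_D: "a \<in> H \<Longrightarrow> x \<notin> D \<Longrightarrow> a x = 0"
  using A_on_D[OF H_A] unfolding on_D_def by blast

lemma H_ip: "a \<in> H \<Longrightarrow> \<phi> \<in> D \<Longrightarrow> \<psi> \<in> D \<Longrightarrow> ip (a \<phi>) \<psi> = ip \<phi> (a \<psi>)"
  by (simp add: H_iff)

lemma H_sym: "a \<in> H \<Longrightarrow> \<phi> \<in> D \<Longrightarrow> \<psi> \<in> D \<Longrightarrow> rip (a \<phi>) \<psi> = rip \<phi> (a \<psi>)"
  by (simp add: H_ip rip_def)

lemma H_comm:
  assumes "a \<in> H" "b \<in> H" "\<phi> \<in> D"
  shows "a (b \<phi>) = b (a \<phi>)"
proof -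
  have "lcomp D a b = lcomp D b a" using alg assms H_A unfolding comm_star_subalg_def by blast
  then have "lcomp D a b \<phi> = lcomp D b a \<phi>" by simp
  then show ?thesis using assms(3) by (simp add: lcomp_def)
qed

text \<open>Elements of \<open>Lstar\<close> are arbitrary maps that have an adjoint. Linearity,
  here and in \<open>H_lin\<close>, is a consequence: move the operator to the other argument and
  test against the dense set \<open>D\<close>.\<close>

lemma H_cscale:
  assumes "a \<in> H" "x \<in> D"
  shows "a (cscale J c x) = cscale J c (a x)"
  by (rule eq_by_D) (use assms in \<open>simp add: H_ip[symmetric] ip_cscale cscale_D H_in_D\<close>)

lemma H_lin: assumes "a \<in> H" shows "lin_on D a"
  unfolding lin_on_def
proof (intro conjI ballI allI)
  show "a (x + y) = a x + a y" if "x \<in> D" "y \<in> D" for x y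
    by (rule eq_by_D) (use assms that in \<open>simp add: H_ip[symmetric] ip_add D_closed H_in_D\<close>)
  show "a (c *\<^sub>R x) = c *\<^sub>R a x" if "x \<in> D" for c x
    by (rule eq_by_D) (use assms that in \<open>simp add: H_ip[symmetric] ip_scaleR D_closed H_in_D\<close>)
qed

lemma H_add: "a \<in> H \<Longrightarrow> x \<in> D \<Longrightarrow> y \<in> D \<Longrightarrow> a (x + y) = a x + a y"
  using H_lin unfolding lin_on_def by blast

lemma H_diff: "a \<in> H \<Longrightarrow> x \<in> D \<Longrightarrow> y \<in> D \<Longrightarrow> a (x - y) = a x - a y"
  by (rule lin_on_diff[OF subspace_D H_lin])

lemma lunit_apply [simp]: "\<phi> \<in> D \<Longrightarrow> lunit D \<phi> = \<phi>"
  and lcomp_apply [simp]: "\<phi> \<in> D \<Longrightarrow> lcomp D a b \<phi> = a (b \<phi>)"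
  and ladd_apply [simp]: "ladd a b \<phi> = a \<phi> + b \<phi>"
  by (simp_all add: lunit_def lcomp_def ladd_def)

lemma H_eqI: "a \<in> H \<Longrightarrow> b \<in> H \<Longrightarrow> (\<And>\<phi>. \<phi> \<in> D \<Longrightarrow> a \<phi> = b \<phi>) \<Longrightarrow> a = b"
  by (rule ext) (metis H_off_D)

lemma lunit_H [simp]: "lunit D \<in> H"
  using alg unfolding comm_star_subalg_def by (simp add: H_iff)

lemma ip_add_left: "ip (x + y) z = ip x z + ip y z"
proof -
  have "ip (x + y) z = cnj (ip z (x + y))" by (rule ip_cnj)
  also have "\<dots> = cnj (ip z x) + cnj (ip z y)" by (simp add: ip_add)
  also have "\<dots> = ip x z + ip y z" by (simp only: ip_cnj[symmetric])
  finally show ?thesis .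
qed

lemma ladd_H [simp]:
  assumes "a \<in> H" "b \<in> H" shows "ladd a b \<in> H"
proof -
  have "ladd a b \<in> A" using alg assms H_A unfolding comm_star_subalg_def by blast
  then show ?thesis using assms by (simp add: H_iff ip_add ip_add_left)
qed

lemma lcomp_H [simp]:
  assumes "a \<in> H" "b \<in> H" shows "lcomp D a b \<in> H"
proof -
  have "lcomp D a b \<in> A" using alg assms H_A unfolding comm_star_subalg_def by blast
  moreover have "ip \<phi> (lcomp D a b \<psi>) = ip (lcomp D a b \<phi>) \<psi>" if "\<phi> \<in> D" "\<psi> \<in> D" for \<phi> \<psi>
    using assms that H_comm[OF assms] by (simp add: H_ip[symmetric] H_in_D)
  ultimately show ?thesis by (simp add: H_iff)
qed

definition sc :: "real \<Rightarrow> ('h \<Rightarrow> 'h) \<Rightarrow> 'h \<Rightarrow> 'h" where "sc c a = (\<lambda>x. c *\<^sub>R a x)"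

lemma sc_apply [simp]: "sc c a \<phi> = c *\<^sub>R a \<phi>" by (simp add: sc_def)

lemma sc_H [simp]:
  assumes "a \<in> H" shows "sc c a \<in> H"
proof -
  have "lscale J (complex_of_real c) a \<in> A" using alg assms H_A unfolding comm_star_subalg_def by blast
  then have "sc c a \<in> A" by (simp add: lscale_def sc_def cscale_of_real)
  moreover have "ip \<phi> (sc c a \<psi>) = ip (sc c a \<phi>) \<psi>" if "\<phi> \<in> D" "\<psi> \<in> D" for \<phi> \<psi>
  proof -
    have "ip (c *\<^sub>R a \<phi>) \<psi> = cnj (ip \<psi> (c *\<^sub>R a \<phi>))" by (rule ip_cnj)
    also have "\<dots> = c * ip (a \<phi>) \<psi>" by (subst (2) ip_cnj) (simp add: ip_scaleR)
    finally show ?thesis using assms that by (simp add: ip_scaleR H_ip)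
  qed
  ultimately show ?thesis by (simp add: H_iff)
qed

lemma zero_H [simp]: "(\<lambda>x. 0) \<in> H"
  using sc_H[OF lunit_H, of 0] by (simp add: sc_def)

section \<open>Positive elements and elements above the unit\<close>

definition pos :: "('h \<Rightarrow> 'h) \<Rightarrow> bool" where "pos a \<longleftrightarrow> (\<forall>\<phi>\<in>D. 0 \<le> rip \<phi> (a \<phi>))"

text \<open>The set of all 1 + a with a \<ge> 0, expressed through forms; \<open>Loc_eq\<close>
  identifies it with \<open>Loc R leq\<close>.\<close>

definition S :: "('h \<Rightarrow> 'h) set" where "S = {s \<in> H. \<forall>\<phi>\<in>D. (norm \<phi>)\<^sup>2 \<le> rip \<phi> (s \<phi>)}"

lemma S_H [simp]: "s \<in> S \<Longrightarrow> s \<in> H" unfolding S_def by blast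

lemma S_rip: "s \<in> S \<Longrightarrow> \<phi> \<in> D \<Longrightarrow> (norm \<phi>)\<^sup>2 \<le> rip \<phi> (s \<phi>)" unfolding S_def by blast

lemma SI: "s \<in> H \<Longrightarrow> (\<And>\<phi>. \<phi> \<in> D \<Longrightarrow> (norm \<phi>)\<^sup>2 \<le> rip \<phi> (s \<phi>)) \<Longrightarrow> s \<in> S"
  unfolding S_def by blast

lemma posD: "pos a \<Longrightarrow> \<phi> \<in> D \<Longrightarrow> 0 \<le> rip \<phi> (a \<phi>)" by (simp add: pos_def)

lemma S_pos: "s \<in> S \<Longrightarrow> pos s"
  unfolding S_def pos_def by (force intro: order_trans[OF zero_le_power2])

lemma S_norm:
  assumes "s \<in> S" "\<phi> \<in> D" shows "norm \<phi> \<le> norm (s \<phi>)"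
proof -
  have "norm \<phi> * norm \<phi> \<le> norm \<phi> * norm (s \<phi>)"
    using S_rip[OF assms] rip_le_norm[of \<phi> "s \<phi>"] by (simp add: power2_eq_square)
  then show ?thesis by (cases "\<phi> = 0") auto
qed

lemma S_ess_selfadjoint:
  assumes "s \<in> S" shows "ess_selfadjoint ip D s"
proof -
  let ?p = "ladd s (sc (-1) (lunit D))"
  have p: "?p \<in> H" using assms by simp
  have "op_le D ip (\<lambda>x. 0) ?p"
    unfolding op_le_def
    using S_rip[OF assms] by (simp add: rip_def[symmetric] rip_simps rip_self flip: scaleR_minus_left)
  moreover have "ladd (lunit D) ?p = s" by (auto simp: ladd_def sc_def)
  moreover have "\<one>\<^bsub>herm_ring D ip A\<^esub> = lunit D" "\<zero>\<^bsub>herm_ring D ip A\<^esub> = (\<lambda>x. 0)"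
    "(\<oplus>\<^bsub>herm_ring D ip A\<^esub>) = ladd"
    by (simp_all add: herm_ring_def)
  ultimately show ?thesis using bspec[OF esa p[unfolded H_def]] by simp
qed

text \<open>A vector orthogonal to \<open>s D\<close> lies in the kernel of the adjoint of \<open>s\<close>, that is of its
  closure, which is injective because \<open>s\<close> is bounded below.\<close>

lemma S_dense_range:
  assumes "s \<in> S" shows "closure (s ` D) = UNIV"
proof (rule dense_if_orthogonal_zero)
  have sH: "s \<in> H" using assms by simp
  show "subspace (s ` D)" by (rule subspace_lin_on_image[OF subspace_D H_lin[OF sH]])
  fix \<eta> assume orth: "\<And>v. v \<in> s ` D \<Longrightarrow> rip \<eta> v = 0"
  \<comment> \<open>The range is invariant under multiplication by i, so real orthogonality implies
    complex orthogonality.\<close>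
  have ipz: "ip \<eta> (s \<phi>) = 0" if "\<phi> \<in> D" for \<phi>
  proof -
    have "rip \<eta> (s \<phi>) = 0" using orth that by blast
    moreover have "rip \<eta> (s (cscale J \<i> \<phi>)) = 0" using orth cscale_D[OF that] by blast
    then have "Im (ip \<eta> (s \<phi>)) = 0" using H_cscale[OF sH that] by (simp add: rip_def ip_cscale)
    ultimately show ?thesis by (simp add: rip_def complex_eq_iff)
  qed
  let ?G = "closure (op_graph D s)"
  have ip0: "ip 0 x = 0" for x using ip_scaleR[of x 0 0] ip_cnj[of 0 x] by simp
  have "(\<eta>, 0) \<in> graph_adjoint ip ?G"
  proof -
    have "ip \<eta> (snd z) = 0" if "z \<in> ?G" for z
    proof -
      obtain f where f: "\<And>n. f n \<in> op_graph D s" "f \<longlonglongrightarrow> z" using \<open>z \<in> ?G\<close> unfolding closure_sequential by blast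
      have f0: "ip \<eta> (snd (f n)) = 0" for n using f(1)[of n] ipz unfolding op_graph_def by auto
      have g: "(\<lambda>n. snd (f n)) \<longlonglongrightarrow> snd z" by (intro tendsto_intros f)
      have "(\<lambda>n. rip \<eta> (snd (f n))) \<longlonglongrightarrow> rip \<eta> (snd z)" by (intro tendsto_rip tendsto_intros g)
      then have 1: "rip \<eta> (snd z) = 0" using f0 by (simp add: rip_def LIMSEQ_const_iff)
      \<comment> \<open>The imaginary part of \<open>ip \<eta>\<close> is the real inner product
        with \<open>J \<eta>\<close>, so continuity of \<open>rip\<close> handles both
        parts.\<close>
      have Jim: "rip (J \<eta>) x = Im (ip \<eta> x)" for x
      proof -
        have "ip x (cscale J \<i> \<eta>) = \<i> * ip x \<eta>" by (rule ip_cscale)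
        then have "rip x (J \<eta>) = - Im (ip x \<eta>)" by (simp add: rip_def cscale_def)
        then show ?thesis using ip_cnj[of \<eta> x] by (simp add: rip_sym[of "J \<eta>"])
      qed
      have "(\<lambda>n. rip (J \<eta>) (snd (f n))) \<longlonglongrightarrow> rip (J \<eta>) (snd z)" by (intro tendsto_rip tendsto_intros g)
      then have 2: "Im (ip \<eta> (snd z)) = 0" using f0 by (simp add: Jim LIMSEQ_const_iff)
      show ?thesis using 1 2 by (simp add: rip_def complex_eq_iff)
    qed
    then show ?thesis unfolding graph_adjoint_def by (force simp: ip0)
  qed
  then have "(\<eta>, 0) \<in> ?G" using S_ess_selfadjoint[OF assms] unfolding ess_selfadjoint_def selfadjoint_graph_def by simp
  then obtain f where f: "\<And>n. f n \<in> op_graph D s" "f \<longlonglongrightarrow> (\<eta>, 0)" unfolding closure_sequential by blast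
  have le: "norm (fst (f n)) \<le> norm (snd (f n))" for n
    using f(1)[of n] S_norm[OF assms] unfolding op_graph_def by auto
  have "(\<lambda>n. norm (fst (f n))) \<longlonglongrightarrow> norm (fst (\<eta>, 0 :: 'h))" "(\<lambda>n. norm (snd (f n))) \<longlonglongrightarrow> norm (snd (\<eta>, 0 :: 'h))"
    by (intro tendsto_intros f)+
  then have "norm (fst (\<eta>, 0 :: 'h)) \<le> norm (snd (\<eta>, 0 :: 'h))" by (rule LIMSEQ_le) (use le in auto)
  then show "\<eta> = 0" by simp
qed

abbreviation one_plus_sq :: "('h \<Rightarrow> 'h) \<Rightarrow> 'h \<Rightarrow> 'h" where
  "one_plus_sq r \<equiv> ladd (lunit D) (lcomp D r r)"

text \<open>The form of r^2 s at \<phi> is the form of s at r \<phi>, so r^2 s is positive by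
  congruence alone.\<close>

lemma S_one_plus_sq_mult:
  assumes "r \<in> H" "s \<in> S" shows "lcomp D (one_plus_sq r) s \<in> S"
proof -
  have "(norm \<phi>)\<^sup>2 \<le> rip \<phi> (lcomp D (one_plus_sq r) s \<phi>)" if "\<phi> \<in> D" for \<phi>
  proof -
    have "rip \<phi> (r (r (s \<phi>))) = rip (r \<phi>) (s (r \<phi>))"
      using assms that by (simp add: H_sym H_comm[of r s] H_in_D)
    also have "\<dots> \<ge> 0" using S_pos[OF assms(2)] assms that by (simp add: pos_def H_in_D)
    finally show ?thesis using S_rip[OF assms(2) that] assms that by (simp add: H_in_D rip_simps)
  qed
  then show ?thesis using assms by (intro SI) simp_all
qed

lemma lunit_S: "lunit D \<in> S"
  by (rule SI) (simp_all add: rip_self)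

lemma S_one_plus_sq: "r \<in> H \<Longrightarrow> one_plus_sq r \<in> S"
proof -
  assume r: "r \<in> H"
  have "lcomp D (one_plus_sq r) (lunit D) = one_plus_sq r"
    using r by (intro H_eqI) auto
  then show ?thesis using S_one_plus_sq_mult[OF r lunit_S] by simp
qed

text \<open>Expand the square of the right-hand side. Together with \<open>S_norm\<close>, this lets
  the norm of (1 + r^2) \<phi> control the graph norm of r at \<phi>.\<close>

lemma one_plus_sq_norm:
  assumes "r \<in> H" "\<phi> \<in> D" shows "norm (r \<phi>) \<le> norm (one_plus_sq r \<phi>)"
proof -
  have "(norm (one_plus_sq r \<phi>))\<^sup>2 = (norm \<phi>)\<^sup>2 + 2 * (norm (r \<phi>))\<^sup>2 + (norm (r (r \<phi>)))\<^sup>2"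
    using assms by (simp add: norm_add_sq H_in_D flip: rip_self[of "r \<phi>"] H_sym)
  then have "(norm (r \<phi>))\<^sup>2 \<le> (norm (one_plus_sq r \<phi>))\<^sup>2" by (smt (verit) zero_le_power2)
  then show ?thesis by (rule power2_le_imp_le) simp
qed

text \<open>The range \<open>s D\<close> is a core for \<open>r\<close>, since \<open>(1 + r\<^sup>2) s D\<close> is dense.\<close>

lemma pos_cancel_sq:
  assumes r: "r \<in> H" and s: "s \<in> S" and nn: "\<And>\<phi>. \<phi> \<in> D \<Longrightarrow> 0 \<le> rip (s \<phi>) (r (s \<phi>))"
  shows "pos r"
  unfolding pos_def
proof
  fix \<phi> assume \<phi>: "\<phi> \<in> D"
  let ?t = "one_plus_sq r"
  note t = S_one_plus_sq[OF r]
  have tH: "?t \<in> H" and sH: "s \<in> H" using r s by auto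
  have "?t \<phi> \<in> closure (lcomp D ?t s ` D)" using S_dense_range[OF S_one_plus_sq_mult[OF r s]] by simp
  then obtain g where g: "\<And>n. g n \<in> lcomp D ?t s ` D" and glim: "g \<longlonglongrightarrow> ?t \<phi>" unfolding closure_sequential by blast
  have "\<exists>x. x \<in> D \<and> g n = lcomp D ?t s x" for n using g[of n] by blast
  then obtain f where f: "\<And>n. f n \<in> D" and gf: "\<And>n. g n = lcomp D ?t s (f n)" by metis
  have sf: "s (f n) \<in> D" for n using f sH H_in_D by blast
  have gt: "g n - ?t \<phi> = ?t (s (f n) - \<phi>)" for n
    using f gf H_diff[OF tH sf \<phi>] by (simp del: ladd_apply)
  have g0: "(\<lambda>n. norm (g n - ?t \<phi>)) \<longlonglongrightarrow> 0" using glim by (simp add: LIM_zero_iff tendsto_norm_zero)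
  have "(\<lambda>n. s (f n) - \<phi>) \<longlonglongrightarrow> 0"
    by (rule Lim_null_comparison[OF _ g0]) (intro always_eventually allI, unfold gt, intro S_norm[OF t] D_closed sf \<phi>)
  then have l1: "(\<lambda>n. s (f n)) \<longlonglongrightarrow> \<phi>" by (simp add: LIM_zero_iff)
  have "(\<lambda>n. r (s (f n) - \<phi>)) \<longlonglongrightarrow> 0"
    by (rule Lim_null_comparison[OF _ g0]) (intro always_eventually allI, unfold gt, intro one_plus_sq_norm[OF r] D_closed sf \<phi>)
  then have l2: "(\<lambda>n. r (s (f n))) \<longlonglongrightarrow> r \<phi>" by (simp add: H_diff[OF r sf \<phi>] LIM_zero_iff)
  have "(\<lambda>n. rip (s (f n)) (r (s (f n)))) \<longlonglongrightarrow> rip \<phi> (r \<phi>)" by (rule tendsto_rip[OF l1 l2])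
  then show "0 \<le> rip \<phi> (r \<phi>)" by (rule LIMSEQ_le_const) (use nn f in auto)
qed

lemma quotient_exists:
  assumes "u \<in> H" "t \<in> S" "\<And>\<phi>. \<phi> \<in> D \<Longrightarrow> norm (u \<phi>) \<le> C * norm (t \<phi>)"
  shows "\<exists>F :: 'h \<Rightarrow>\<^sub>L 'h. \<forall>\<phi>\<in>D. F (t \<phi>) = u \<phi>"
  using assms by (intro blinfun_quotient_exists[OF subspace_D H_lin H_lin S_dense_range]) auto

text \<open>With t = 1 + b^2, the bounded operators B = b/t^2 and Y = 1/s commute and satisfy 0
  \<le> B and 0 \<le> Y \<le> 1, so \<open>nonneg_form_compose\<close> applies. The square on t
  makes the form of B Y at s t t \<phi> equal to the form of s b at t \<phi>; a single t would give
  positivity of t s b, from which t cannot yet be cancelled.\<close>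

lemma pos_mult_S:
  assumes b: "b \<in> H" "pos b" and s: "s \<in> S"
  shows "pos (lcomp D s b)"
proof -
  define t where "t = one_plus_sq b"
  have t: "t \<in> S" unfolding t_def by (rule S_one_plus_sq[OF b(1)])
  have tt: "lcomp D t t \<in> S" unfolding t_def by (rule S_one_plus_sq_mult[OF b(1) t[unfolded t_def]])
  have ts: "lcomp D t s \<in> S" unfolding t_def by (rule S_one_plus_sq_mult[OF b(1) s])
  have tts: "lcomp D t (lcomp D t s) \<in> S" using S_one_plus_sq_mult[OF b(1) ts] by (simp add: t_def)
  have sH: "s \<in> H" and tH: "t \<in> H" using s t by simp_all
  note D' = H_in_D[OF sH] H_in_D[OF tH] H_in_D[OF b(1)]
  have "\<exists>F :: 'h \<Rightarrow>\<^sub>L 'h. \<forall>\<phi>\<in>D. F (lcomp D t t \<phi>) = b \<phi>"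
  proof (rule quotient_exists[OF b(1) tt, where C=1])
    fix \<phi> assume "\<phi> \<in> D"
    then show "norm (b \<phi>) \<le> 1 * norm (lcomp D t t \<phi>)"
      using one_plus_sq_norm[OF b(1), of \<phi>] S_norm[OF t, of "t \<phi>"] D' by (simp add: t_def del: ladd_apply)
  qed
  then obtain B :: "'h \<Rightarrow>\<^sub>L 'h" where B: "\<And>\<phi>. \<phi> \<in> D \<Longrightarrow> B (t (t \<phi>)) = b \<phi>" by auto
  have "\<exists>F :: 'h \<Rightarrow>\<^sub>L 'h. \<forall>\<phi>\<in>D. F (s \<phi>) = lunit D \<phi>"
    by (rule quotient_exists[OF lunit_H s, where C=1]) (use S_norm[OF s] in simp)
  then obtain Y :: "'h \<Rightarrow>\<^sub>L 'h" where Y: "\<And>\<phi>. \<phi> \<in> D \<Longrightarrow> Y (s \<phi>) = \<phi>" by auto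
  note ds = S_dense_range[OF s]
  have B0: "0 \<le> rip x (B x)" for x
  proof -
    have "0 \<le> rip (id_blinfun x) (B x)"
    proof (rule nonneg_form_on_dense[OF S_dense_range[OF tt]])
      fix x assume "x \<in> lcomp D t t ` D"
      then obtain \<phi> where \<phi>: "\<phi> \<in> D" "x = t (t \<phi>)" by auto
      then have "rip x (B x) = rip (t \<phi>) (b (t \<phi>))"
        using B[OF \<phi>(1)] D' by (simp add: H_sym[OF tH] H_comm[OF tH b(1)])
      then show "0 \<le> rip (id_blinfun x) (B x)" using posD[OF b(2)] D' \<phi> by simp
    qed
    then show ?thesis by simp
  qed
  have Y0: "0 \<le> rip x (Y x)" for x
  proof -
    have "0 \<le> rip (id_blinfun x) (Y x)"
      by (rule nonneg_form_on_dense[OF ds]) (use Y posD[OF S_pos[OF s]] in \<open>auto simp: rip_sym[of "s _"]\<close>)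
    then show ?thesis by simp
  qed
  have Y1: "rip x (Y x) \<le> (norm x)\<^sup>2" for x
  proof -
    have "0 \<le> rip (id_blinfun x) ((id_blinfun - Y) x)"
    proof (rule nonneg_form_on_dense[OF ds])
      fix x assume "x \<in> s ` D"
      then obtain \<phi> where \<phi>: "\<phi> \<in> D" "x = s \<phi>" by auto
      have "rip x (Y x) \<le> norm x * norm \<phi>" using rip_le_norm Y \<phi> by simp
      also have "\<dots> \<le> norm x * norm x" using S_norm[OF s \<phi>(1)] \<phi> by (simp add: mult_left_mono)
      finally show "0 \<le> rip (id_blinfun x) ((id_blinfun - Y) x)"
        by (simp add: blinfun.diff_left rip_simps rip_self power2_eq_square)
    qed
    then show ?thesis by (simp add: blinfun.diff_left rip_simps rip_self)
  qed
  have Ysym: "rip (Y x) y = rip x (Y y)" for x y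
    by (rule symmetric_on_dense[OF ds]) (use Y H_sym[OF sH] in auto)
  \<comment> \<open>Both composites send t t s \<phi> to b \<phi>, and such vectors are
    dense.\<close>
  have "B o\<^sub>L Y = Y o\<^sub>L B"
  proof (rule eq_on_dense[OF S_dense_range[OF tts]])
    fix x assume "x \<in> lcomp D t (lcomp D t s) ` D"
    then obtain \<phi> where \<phi>: "\<phi> \<in> D" "x = t (t (s \<phi>))" by auto
    then have x: "x = s (t (t \<phi>))" using D' by (simp add: H_comm[OF tH sH])
    have "B (Y x) = b \<phi>" using x Y B \<phi> D' by simp
    moreover have "Y (B x) = b \<phi>" using \<phi> B[of "s \<phi>"] Y D' by (simp add: H_comm[OF b(1) sH])
    ultimately show "(B o\<^sub>L Y) x = (Y o\<^sub>L B) x" by simp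
  qed
  then have comm: "B (Y x) = Y (B x)" for x by (metis blinfun_apply_blinfun_compose)
  show ?thesis
  proof (rule pos_cancel_sq[OF _ t])
    show "lcomp D s b \<in> H" using sH b(1) by simp
    fix \<phi> assume \<phi>: "\<phi> \<in> D"
    let ?x = "s (t (t \<phi>))"
    have "0 \<le> rip ?x (B (Y ?x))" by (rule nonneg_form_compose[OF B0 Y0 Y1 Ysym comm])
    also have "rip ?x (B (Y ?x)) = rip (s (t (t \<phi>))) (b \<phi>)" using \<phi> D' Y B by simp
    also have "\<dots> = rip (t \<phi>) (lcomp D s b (t \<phi>))"
      using \<phi> D' by (simp add: H_sym[OF sH] H_sym[OF tH] H_comm[OF tH b(1)] H_comm[OF tH sH])
    finally show "0 \<le> rip (t \<phi>) (lcomp D s b (t \<phi>))" .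
  qed
qed

text \<open>\<open>pos_mult_S\<close> applies to 1 + k a for every k; since the form of b stays
  fixed while k grows, the form of a b cannot be negative.\<close>

lemma pos_mult:
  assumes a: "a \<in> H" "pos a" and b: "b \<in> H" "pos b"
  shows "pos (lcomp D a b)"
  unfolding pos_def
proof
  fix \<phi> assume \<phi>: "\<phi> \<in> D"
  let ?u = "rip \<phi> (b \<phi>)" and ?v = "rip \<phi> (a (b \<phi>))"
  have "0 \<le> ?u + real k * ?v" for k :: nat
  proof -
    have "ladd (lunit D) (sc k a) \<in> S" using a posD[OF a(2)] by (intro SI) (simp_all add: rip_simps rip_self)
    then have "pos (lcomp D (ladd (lunit D) (sc k a)) b)" by (rule pos_mult_S[OF b])
    then show ?thesis using posD[of _ \<phi>] \<phi> H_in_D[OF b(1) \<phi>] by (force simp: rip_simps)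
  qed
  note * = this
  have "0 \<le> ?v"
  proof (rule ccontr)
    assume "\<not> 0 \<le> ?v"
    obtain k :: nat where "?u / - ?v < k" using reals_Archimedean2 by blast
    then have "?u < - (k * ?v)" using \<open>\<not> 0 \<le> ?v\<close> by (simp add: field_simps)
    then show False using *[of k] by simp
  qed
  then show "0 \<le> rip \<phi> (lcomp D a b \<phi>)" using \<phi> by simp
qed

text \<open>Multiplying by s once more produces the symmetric product s r s of
  \<open>pos_cancel_sq\<close>.\<close>

lemma pos_cancel:
  assumes r: "r \<in> H" and s: "s \<in> S" and rs: "pos (lcomp D r s)"
  shows "pos r"
proof (rule pos_cancel_sq[OF r s])
  fix \<phi> assume \<phi>: "\<phi> \<in> D"
  have sH: "s \<in> H" using s by simp
  have "pos (lcomp D s (lcomp D r s))" using pos_mult_S[OF _ rs s] r sH by simp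
  then have "0 \<le> rip \<phi> (s (r (s \<phi>)))" using posD[OF _ \<phi>] \<phi> r sH by (force simp: H_in_D)
  then show "0 \<le> rip (s \<phi>) (r (s \<phi>))" using \<phi> r sH by (simp add: H_sym H_in_D)
qed

text \<open>The difference s s' - s = s (s' - 1) is positive, and s already dominates 1.\<close>

lemma S_mult:
  assumes "s \<in> S" "s' \<in> S" shows "lcomp D s s' \<in> S"
proof -
  let ?p = "ladd s' (sc (-1) (lunit D))"
  have "pos ?p" unfolding pos_def using S_rip[OF assms(2)] by (simp add: rip_simps rip_self flip: scaleR_minus_left)
  then have P: "pos (lcomp D s ?p)" using pos_mult_S[of ?p s] assms by simp
  have "(norm \<phi>)\<^sup>2 \<le> rip \<phi> (s (s' \<phi>))" if \<phi>: "\<phi> \<in> D" for \<phi>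
  proof -
    have "s (s' \<phi> - \<phi>) = s (s' \<phi>) - s \<phi>" using assms \<phi> by (simp add: H_diff H_in_D)
    then show ?thesis using posD[OF P \<phi>] S_rip[OF assms(1) \<phi>] \<phi> by (simp add: rip_simps)
  qed
  then show ?thesis using assms by (intro SI) simp_all
qed

end

section \<open>Bounded fractions as bounded operators\<close>

context herm_alg
begin

section \<open>The ordered ring of hermitian elements\<close>

abbreviation "R \<equiv> herm_ring D ip A"
abbreviation "leq \<equiv> op_le D ip"

lemma R_simps [simp]:
  "carrier R = H" "(\<otimes>\<^bsub>R\<^esub>) = lcomp D" "\<one>\<^bsub>R\<^esub> = lunit D" "\<zero>\<^bsub>R\<^esub> = (\<lambda>x. 0)" "(\<oplus>\<^bsub>R\<^esub>) = ladd"
  by (simp add: H_def) (simp_all add: herm_ring_def)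

lemma rip_uminus_right: "rip x (- y) = - rip x y"
  using rip_scale_right[of x "-1" y] by simp

lemma leq_iff: "leq a b \<longleftrightarrow> (\<forall>\<phi>\<in>D. rip \<phi> (a \<phi>) \<le> rip \<phi> (b \<phi>))"
  by (simp add: op_le_def rip_def)

lemma leq_zero_iff [simp]: "leq (\<lambda>x. 0) a \<longleftrightarrow> pos a"
  by (simp add: leq_iff pos_def rip_simps)

lemma lcomp_comm: "a \<in> H \<Longrightarrow> b \<in> H \<Longrightarrow> lcomp D a b = lcomp D b a"
  by (rule H_eqI) (simp_all add: H_comm)

lemma lcomp_assoc:
  "a \<in> H \<Longrightarrow> b \<in> H \<Longrightarrow> c \<in> H \<Longrightarrow> lcomp D (lcomp D a b) c = lcomp D a (lcomp D b c)"
  by (rule H_eqI) (simp_all add: H_in_D)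

lemma lcomp_unit [simp]: "a \<in> H \<Longrightarrow> lcomp D (lunit D) a = a" "a \<in> H \<Longrightarrow> lcomp D a (lunit D) = a"
  by (rule H_eqI; simp add: H_in_D)+

lemma lcomp_ladd_left:
  "a \<in> H \<Longrightarrow> b \<in> H \<Longrightarrow> c \<in> H \<Longrightarrow> lcomp D (ladd a b) c = ladd (lcomp D a c) (lcomp D b c)"
  by (rule H_eqI) simp_all

lemma lcomp_zero [simp]: "a \<in> H \<Longrightarrow> lcomp D (\<lambda>x. 0) a = (\<lambda>x. 0)"
  by (rule H_eqI) simp_all

lemma cring_R: "cring R"
proof (rule cringI)
  show "abelian_group R"
  proof (rule abelian_groupI)
    show "\<exists>y\<in>carrier R. y \<oplus>\<^bsub>R\<^esub> x = \<zero>\<^bsub>R\<^esub>" if "x \<in> carrier R" for x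
      using that by (intro bexI[of _ "sc (-1) x"]) (auto simp: fun_eq_iff)
  qed (auto simp: fun_eq_iff add.assoc add.commute)
  show "comm_monoid R"
  proof (rule comm_monoidI)
    show "x \<otimes>\<^bsub>R\<^esub> y \<otimes>\<^bsub>R\<^esub> z = x \<otimes>\<^bsub>R\<^esub> (y \<otimes>\<^bsub>R\<^esub> z)"
      if "x \<in> carrier R" "y \<in> carrier R" "z \<in> carrier R" for x y z
      using that by (simp add: lcomp_assoc)
    show "x \<otimes>\<^bsub>R\<^esub> y = y \<otimes>\<^bsub>R\<^esub> x" if "x \<in> carrier R" "y \<in> carrier R" for x y
      using that by (simp add: lcomp_comm)
  qed simp_all
  show "(x \<oplus>\<^bsub>R\<^esub> y) \<otimes>\<^bsub>R\<^esub> z = x \<otimes>\<^bsub>R\<^esub> z \<oplus>\<^bsub>R\<^esub> y \<otimes>\<^bsub>R\<^esub> z"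
    if "x \<in> carrier R" "y \<in> carrier R" "z \<in> carrier R" for x y z
    using that by (simp add: lcomp_ladd_left)
qed

lemma a_inv_R [simp]:
  assumes "a \<in> H" shows "\<ominus>\<^bsub>R\<^esub> a = sc (-1) a"
proof (rule abelian_group.minus_equality)
  show "abelian_group R" using cring_R by (simp add: cring.axioms(1) ring.is_abelian_group cring_def ring_def)
qed (use assms in \<open>auto simp: fun_eq_iff\<close>)

lemma add_pow_R [simp]: "add_pow R (n::nat) a = sc (real n) a"
proof (induction n)
  case 0 show ?case by (simp add: add_pow_def sc_def)
next
  case (Suc n) then show ?case by (simp add: add_pow_def sc_def ladd_def fun_eq_iff algebra_simps)
qed

text \<open>Polarisation: symmetry of \<open>c\<close> for \<open>rip\<close> makes the two mixed
  terms equal.\<close>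

lemma zero_if_quadratic_zero:
  assumes c: "c \<in> H" and q: "\<And>\<phi>. \<phi> \<in> D \<Longrightarrow> rip \<phi> (c \<phi>) = 0" and \<psi>: "\<psi> \<in> D"
  shows "c \<psi> = 0"
proof (rule eq_by_D_rip)
  fix \<phi> assume \<phi>: "\<phi> \<in> D"
  have "rip (\<phi> + \<psi>) (c (\<phi> + \<psi>)) = 0" by (rule q) (simp add: D_closed \<phi> \<psi>)
  moreover have "rip \<psi> (c \<phi>) = rip \<phi> (c \<psi>)" using H_sym[OF c \<phi> \<psi>] rip_sym by metis
  ultimately show "rip \<phi> (c \<psi>) = rip \<phi> 0"
    using q[OF \<phi>] q[OF \<psi>] by (simp add: H_add[OF c \<phi> \<psi>] rip_simps)
qed

lemma leq_antisym:
  assumes a: "a \<in> H" and b: "b \<in> H" and "leq a b" "leq b a"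
  shows "a = b"
proof (rule H_eqI[OF a b])
  fix \<phi> assume \<phi>: "\<phi> \<in> D"
  have "ladd a (sc (-1) b) \<phi> = 0"
  proof (rule zero_if_quadratic_zero[OF _ _ \<phi>])
    show "ladd a (sc (-1) b) \<in> H" using a b by simp
    show "rip \<psi> (ladd a (sc (-1) b) \<psi>) = 0" if "\<psi> \<in> D" for \<psi>
      using assms(3,4) that by (auto simp: leq_iff rip_simps intro: antisym simp flip: scaleR_minus_left)
  qed
  then show "a \<phi> = b \<phi>" by simp
qed

lemma pos_square: "a \<in> H \<Longrightarrow> pos (lcomp D a a)"
  unfolding pos_def by (simp add: H_sym[symmetric] H_in_D rip_self)

lemma po_cring_R: "po_cring R leq"
  unfolding po_cring_def
proof (intro conjI ballI impI)
  show "cring R" by (rule cring_R)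
qed (auto simp: leq_antisym pos_mult pos_square leq_iff[of "ladd _ _"] rip_simps, auto simp: leq_iff intro: order_trans)

lemma archimedean_R: "archimedean_ring R leq"
  unfolding archimedean_ring_def
proof (intro ballI impI)
  fix g h assume gh: "g \<in> carrier R" "h \<in> carrier R"
    and all: "\<forall>k::nat. 1 \<le> k \<longrightarrow> leq \<zero>\<^bsub>R\<^esub> (add_pow R k g \<oplus>\<^bsub>R\<^esub> h)"
  have "0 \<le> rip \<phi> (g \<phi>)" if \<phi>: "\<phi> \<in> D" for \<phi>
  proof (rule ccontr)
    assume neg: "\<not> 0 \<le> rip \<phi> (g \<phi>)"
    obtain k :: nat where k: "rip \<phi> (h \<phi>) / - rip \<phi> (g \<phi>) < k" using reals_Archimedean2 by blast
    then have "rip \<phi> (h \<phi>) < - (k * rip \<phi> (g \<phi>))" using neg by (simp add: field_simps)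
    \<comment> \<open>The hypothesis starts at 1, so the bound is transferred from k to
      \<open>Suc k\<close>; the form of g being negative, this only strengthens it.\<close>
    moreover have "- (k * rip \<phi> (g \<phi>)) \<le> - (Suc k * rip \<phi> (g \<phi>))" using neg by (simp add: algebra_simps)
    moreover have "0 \<le> Suc k * rip \<phi> (g \<phi>) + rip \<phi> (h \<phi>)"
      using all[rule_format, of "Suc k"] \<phi> by (simp add: pos_def rip_simps del: of_nat_Suc)
    ultimately show False by linarith
  qed
  then show "leq \<zero>\<^bsub>R\<^esub> g" by (simp add: pos_def)
qed

text \<open>On \<open>S\<close> the cancellation clause of \<open>Loc\<close> is
  \<open>pos_cancel\<close>, and the other clause is the decomposition s = 1 + (s - 1).\<close>

lemma Loc_eq: "Loc R leq = S"
proof (intro equalityI subsetI)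
  fix s assume "s \<in> Loc R leq"
  then obtain p where "s \<in> H" "p \<in> H" "pos p" "s = ladd (lunit D) p" unfolding Loc_def by auto
  then show "s \<in> S" by (intro SI) (auto simp: rip_simps rip_self posD)
next
  fix s assume s: "s \<in> S"
  let ?p = "ladd s (sc (-1) (lunit D))"
  have p: "?p \<in> H" "s = ladd (lunit D) ?p" using s by (simp_all add: fun_eq_iff)
  have "pos ?p" using S_rip[OF s] by (simp add: pos_def rip_simps rip_self)
  then have "\<exists>p\<in>carrier R. leq \<zero>\<^bsub>R\<^esub> p \<and> s = \<one>\<^bsub>R\<^esub> \<oplus>\<^bsub>R\<^esub> p"
    using p by (intro bexI[of _ ?p]) (simp_all only: R_simps leq_zero_iff)
  moreover have "\<forall>r\<in>carrier R. leq \<zero>\<^bsub>R\<^esub> (r \<otimes>\<^bsub>R\<^esub> s) \<longrightarrow> leq \<zero>\<^bsub>R\<^esub> r"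
    using pos_cancel[OF _ s] by simp
  ultimately show "s \<in> Loc R leq" unfolding Loc_def using s by simp
qed

text \<open>The denominator 1 + r^2 dominates r and - r, by the Cauchy-Schwarz inequality followed
  by 2 x y \<le> x^2 + y^2 for the norms of \<phi> and r \<phi>.\<close>

lemma localizable_R: "localizable R leq"
  unfolding localizable_def Loc_eq
proof
  fix r assume r: "r \<in> carrier R"
  have "\<bar>rip \<phi> (r \<phi>)\<bar> \<le> rip \<phi> (one_plus_sq r \<phi>)" if \<phi>: "\<phi> \<in> D" for \<phi>
  proof -
    have "rip \<phi> (one_plus_sq r \<phi>) = (norm \<phi>)\<^sup>2 + (norm (r \<phi>))\<^sup>2"
      using r \<phi> by (simp add: rip_simps rip_self[symmetric] H_sym[symmetric] H_in_D)
    moreover have "2 * (norm \<phi> * norm (r \<phi>)) \<le> (norm \<phi>)\<^sup>2 + (norm (r \<phi>))\<^sup>2"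
      using sum_squares_bound[of "norm \<phi>" "norm (r \<phi>)"] by simp
    moreover have "0 \<le> norm \<phi> * norm (r \<phi>)" by simp
    ultimately show ?thesis using abs_rip_le_norm[of \<phi> "r \<phi>"] by linarith
  qed
  note * = this
  have "leq r (one_plus_sq r)" unfolding leq_iff using * by (meson abs_le_D1)
  moreover have "leq (sc (-1) (one_plus_sq r)) r"
    unfolding leq_iff sc_apply rip_scale_right
  proof
    show "-1 * rip \<phi> (one_plus_sq r \<phi>) \<le> rip \<phi> (r \<phi>)" if "\<phi> \<in> D" for \<phi> using *[OF that] by linarith
  qed
  moreover have "\<ominus>\<^bsub>R\<^esub> one_plus_sq r = sc (-1) (one_plus_sq r)" using r by (intro a_inv_R) simp
  ultimately show "\<exists>s\<in>S. leq (\<ominus>\<^bsub>R\<^esub> s) r \<and> leq r s" using S_one_plus_sq r by force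
qed

text \<open>After multiplication by s, the form at \<phi> times 2 n equals the squared norm of (n s
  + r) \<phi> plus n^2 (norm (s \<phi>))^2 - (norm (r \<phi>))^2, and the hypothesis makes that
  difference nonnegative.\<close>

lemma pos_add_if_norm_le:
  assumes r: "r \<in> H" and s: "s \<in> S" and n: "n > 0"
    and bd: "\<And>\<phi>. \<phi> \<in> D \<Longrightarrow> norm (r \<phi>) \<le> n * norm (s \<phi>)"
  shows "pos (ladd (sc n s) r)"
proof (rule pos_cancel[OF _ s])
  have sH: "s \<in> H" using s by simp
  show "ladd (sc n s) r \<in> H" using r sH by simp
  show "pos (lcomp D (ladd (sc n s) r) s)"
    unfolding pos_def
  proof
    fix \<phi> assume \<phi>: "\<phi> \<in> D"
    have "(norm (r \<phi>))\<^sup>2 \<le> (n * norm (s \<phi>))\<^sup>2" using bd[OF \<phi>] by (intro power_mono) auto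
    then have le: "(norm (r \<phi>))\<^sup>2 \<le> n\<^sup>2 * (norm (s \<phi>))\<^sup>2" by (simp add: power_mult_distrib)
    have "rip \<phi> (lcomp D (ladd (sc n s) r) s \<phi>) = n * (norm (s \<phi>))\<^sup>2 + rip (s \<phi>) (r \<phi>)"
      using \<phi> r sH by (simp add: rip_simps rip_self[symmetric] H_sym H_in_D H_comm[of r s])
    moreover have "0 \<le> (norm (n *\<^sub>R s \<phi> + r \<phi>))\<^sup>2" by simp
    then have "0 \<le> n\<^sup>2 * (norm (s \<phi>))\<^sup>2 + 2 * n * rip (s \<phi>) (r \<phi>) + (norm (r \<phi>))\<^sup>2"
      by (simp add: norm_add_sq rip_simps power_mult_distrib)
    then have "0 \<le> 2 * n * (n * (norm (s \<phi>))\<^sup>2 + rip (s \<phi>) (r \<phi>))"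
      using le by (simp add: power2_eq_square algebra_simps)
    then have "0 \<le> n * (norm (s \<phi>))\<^sup>2 + rip (s \<phi>) (r \<phi>)" using n by (simp add: zero_le_mult_iff)
    ultimately show "0 \<le> rip \<phi> (lcomp D (ladd (sc n s) r) s \<phi>)" by simp
  qed
qed

text \<open>From order to norm: n s + r and n s - r are positive, hence so is their product n^2 s^2
  - r^2, and its form compares the norms. The converse is \<open>pos_add_if_norm_le\<close> for r
  and - r.\<close>

lemma BdFracs_iff:
  "(r, s) \<in> BdFracs R leq \<longleftrightarrow> r \<in> H \<and> s \<in> S \<and> (\<exists>C. \<forall>\<phi>\<in>D. norm (r \<phi>) \<le> C * norm (s \<phi>))"
proof -
  have fl: "frac_le R leq (\<ominus>\<^bsub>R\<^esub> (add_pow R n \<one>\<^bsub>R\<^esub>), \<one>\<^bsub>R\<^esub>) (r, s) \<and> frac_le R leq (r, s) (frac_nat R n)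
     \<longleftrightarrow> pos (ladd (sc (real n) s) r) \<and> pos (ladd (sc (real n) s) (sc (-1) r))"
    if "r \<in> H" "s \<in> S" for n :: nat
    using that by (auto simp: frac_le_def frac_nat_def leq_iff pos_def rip_simps rip_uminus_right H_in_D minus_le_iff
        le_diff_eq add.commute)
  show ?thesis
  proof (intro iffI conjI)
    assume L: "(r, s) \<in> BdFracs R leq"
    then show r: "r \<in> H" and s: "s \<in> S" by (auto simp: BdFracs_def Fracs_def Loc_eq)
    have sH: "s \<in> H" using s by simp
    from L obtain n :: nat where "frac_le R leq (\<ominus>\<^bsub>R\<^esub> (add_pow R n \<one>\<^bsub>R\<^esub>), \<one>\<^bsub>R\<^esub>) (r, s)"
      "frac_le R leq (r, s) (frac_nat R n)" unfolding BdFracs_def by blast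
    then have p: "pos (ladd (sc (real n) s) r)" "pos (ladd (sc (real n) s) (sc (-1) r))"
      using fl[OF r s] by blast+
    have "norm (r \<phi>) \<le> real n * norm (s \<phi>)" if \<phi>: "\<phi> \<in> D" for \<phi>
    proof -
      have "0 \<le> rip \<phi> (lcomp D (ladd (sc (real n) s) r) (ladd (sc (real n) s) (sc (-1) r)) \<phi>)"
        using posD[OF pos_mult[OF _ p(1) _ p(2)] \<phi>] r sH by (simp del: lcomp_apply ladd_apply)
      also have "\<dots> = rip (ladd (sc (real n) s) r \<phi>) (ladd (sc (real n) s) (sc (-1) r) \<phi>)"
        using \<phi> r sH H_sym[of "ladd (sc (real n) s) r" \<phi>] H_in_D[of "ladd (sc (real n) s) (sc (-1) r)" \<phi>]
        by (simp del: ladd_apply)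
      also have "\<dots> = real n * real n * (norm (s \<phi>))\<^sup>2 - (norm (r \<phi>))\<^sup>2"
        by (simp add: rip_simps rip_self rip_sym[of "r \<phi>" "s \<phi>"] algebra_simps)
      finally have "(norm (r \<phi>))\<^sup>2 \<le> (real n * norm (s \<phi>))\<^sup>2"
        by (simp add: power_mult_distrib power2_eq_square[of "real n"])
      then show ?thesis by (rule power2_le_imp_le) simp
    qed
    then show "\<exists>C. \<forall>\<phi>\<in>D. norm (r \<phi>) \<le> C * norm (s \<phi>)" by blast
  next
    assume "r \<in> H \<and> s \<in> S \<and> (\<exists>C. \<forall>\<phi>\<in>D. norm (r \<phi>) \<le> C * norm (s \<phi>))"
    then obtain C where r: "r \<in> H" and s: "s \<in> S" and C: "\<And>\<phi>. \<phi> \<in> D \<Longrightarrow> norm (r \<phi>) \<le> C * norm (s \<phi>)" by blast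
    obtain n :: nat where n: "max C 0 < real n" using reals_Archimedean2 by blast
    have bd: "norm (r \<phi>) \<le> real n * norm (s \<phi>)" if "\<phi> \<in> D" for \<phi>
      by (rule order_trans[OF C[OF that]]) (use n in \<open>auto intro: mult_right_mono\<close>)
    have "pos (ladd (sc (real n) s) r)" using n bd by (intro pos_add_if_norm_le r s) auto
    moreover have "pos (ladd (sc (real n) s) (sc (-1) r))"
      using n bd r by (intro pos_add_if_norm_le s) auto
    ultimately show "(r, s) \<in> BdFracs R leq"
      using fl[OF r s, of n] r s unfolding BdFracs_def Fracs_def Loc_eq by auto
  qed
qed

section \<open>Bounded fractions and their quotient operators\<close>

abbreviation "Bd \<equiv> BdFracs R leq"

lemma BdD: "(r, s) \<in> Bd \<Longrightarrow> r \<in> H" "(r, s) \<in> Bd \<Longrightarrow> s \<in> S" "(r, s) \<in> Bd \<Longrightarrow> s \<in> H"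
  by (simp_all add: BdFracs_iff)

lemma BdI: "r \<in> H \<Longrightarrow> s \<in> S \<Longrightarrow> (\<And>\<phi>. \<phi> \<in> D \<Longrightarrow> norm (r \<phi>) \<le> C * norm (s \<phi>)) \<Longrightarrow> (r, s) \<in> Bd"
  by (auto simp: BdFracs_iff)

lemma Bd_bound:
  assumes "(r, s) \<in> Bd"
  obtains C where "C \<ge> 0" "\<And>\<phi>. \<phi> \<in> D \<Longrightarrow> norm (r \<phi>) \<le> C * norm (s \<phi>)"
proof -
  obtain C where C: "\<And>\<phi>. \<phi> \<in> D \<Longrightarrow> norm (r \<phi>) \<le> C * norm (s \<phi>)" using assms by (auto simp: BdFracs_iff)
  show ?thesis
  proof (rule that[of "\<bar>C\<bar>"])
    show "norm (r \<phi>) \<le> \<bar>C\<bar> * norm (s \<phi>)" if "\<phi> \<in> D" for \<phi>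
      by (rule order_trans[OF C[OF that]]) (auto intro: mult_right_mono)
  qed simp
qed

lemma frac_mul_pair: "frac_mul R (r, s) (r', s') = (lcomp D r r', lcomp D s s')"
  by (simp add: frac_mul_def)

lemma frac_add_pair: "frac_add R (r, s) (r', s') = (ladd (lcomp D r s') (lcomp D r' s), lcomp D s s')"
  by (simp add: frac_add_def)

lemma frac_mul_Bd:
  assumes "(r, s) \<in> Bd" "(r', s') \<in> Bd"
  shows "(lcomp D r r', lcomp D s s') \<in> Bd"
proof -
  obtain C where C: "C \<ge> 0" "\<And>\<phi>. \<phi> \<in> D \<Longrightarrow> norm (r \<phi>) \<le> C * norm (s \<phi>)" using Bd_bound[OF assms(1)] by metis
  obtain C' where C': "C' \<ge> 0" "\<And>\<phi>. \<phi> \<in> D \<Longrightarrow> norm (r' \<phi>) \<le> C' * norm (s' \<phi>)" using Bd_bound[OF assms(2)] by metis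
  note m = BdD[OF assms(1)] BdD[OF assms(2)]
  show ?thesis
  proof (rule BdI)
    fix \<phi> assume \<phi>: "\<phi> \<in> D"
    have "norm (r (r' \<phi>)) \<le> C * norm (s (r' \<phi>))" using C m \<phi> by (simp add: H_in_D)
    also have "s (r' \<phi>) = r' (s \<phi>)" using m \<phi> by (simp add: H_comm)
    also have "C * norm (r' (s \<phi>)) \<le> C * (C' * norm (s' (s \<phi>)))" using C C' m \<phi> by (simp add: H_in_D mult_left_mono)
    also have "s' (s \<phi>) = s (s' \<phi>)" using m \<phi> by (intro H_comm) auto
    finally show "norm (lcomp D r r' \<phi>) \<le> (C * C') * norm (lcomp D s s' \<phi>)" using \<phi> by (simp add: mult.assoc)
  qed (use m S_mult in auto)
qed

lemma frac_add_Bd: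
  assumes "(r, s) \<in> Bd" "(r', s') \<in> Bd"
  shows "(ladd (lcomp D r s') (lcomp D r' s), lcomp D s s') \<in> Bd"
proof -
  obtain C where C: "C \<ge> 0" "\<And>\<phi>. \<phi> \<in> D \<Longrightarrow> norm (r \<phi>) \<le> C * norm (s \<phi>)" using Bd_bound[OF assms(1)] by metis
  obtain C' where C': "C' \<ge> 0" "\<And>\<phi>. \<phi> \<in> D \<Longrightarrow> norm (r' \<phi>) \<le> C' * norm (s' \<phi>)" using Bd_bound[OF assms(2)] by metis
  note m = BdD[OF assms(1)] BdD[OF assms(2)]
  show ?thesis
  proof (rule BdI)
    fix \<phi> assume \<phi>: "\<phi> \<in> D"
    have "norm (r (s' \<phi>) + r' (s \<phi>)) \<le> norm (r (s' \<phi>)) + norm (r' (s \<phi>))" by (rule norm_triangle_ineq)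
    also have "\<dots> \<le> C * norm (s (s' \<phi>)) + C' * norm (s' (s \<phi>))"
      using C C' m \<phi> by (intro add_mono) (simp_all add: H_in_D)
    also have "s' (s \<phi>) = s (s' \<phi>)" using m \<phi> by (intro H_comm) auto
    finally show "norm (ladd (lcomp D r s') (lcomp D r' s) \<phi>) \<le> (C + C') * norm (lcomp D s s' \<phi>)"
      using \<phi> by (simp add: distrib_right)
  qed (use m S_mult in auto)
qed

text \<open>The fraction \<open>r/s\<close> as a bounded operator, the continuous extension of \<open>s \<phi> \<mapsto> r \<phi>\<close>.\<close>

definition quot :: "('h \<Rightarrow> 'h) \<times> ('h \<Rightarrow> 'h) \<Rightarrow> 'h \<Rightarrow>\<^sub>L 'h" where
  "quot x = (SOME F. \<forall>\<phi>\<in>D. blinfun_apply F (snd x \<phi>) = fst x \<phi>)"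

lemma quot_apply:
  assumes "(r, s) \<in> Bd" "\<phi> \<in> D" shows "quot (r, s) (s \<phi>) = r \<phi>"
proof -
  obtain C where "\<And>\<phi>. \<phi> \<in> D \<Longrightarrow> norm (r \<phi>) \<le> C * norm (s \<phi>)" using Bd_bound[OF assms(1)] by metis
  from quotient_exists[OF BdD(1,2)[OF assms(1)] this]
  have "\<exists>F :: 'h \<Rightarrow>\<^sub>L 'h. \<forall>\<phi>\<in>D. F (s \<phi>) = r \<phi>" .
  then have "\<forall>\<phi>\<in>D. quot (r, s) (s \<phi>) = r \<phi>" unfolding quot_def fst_conv snd_conv by (rule someI_ex)
  then show ?thesis using assms(2) by blast
qed

text \<open>The factor \<open>t\<close> makes room for a second denominator: agreement is tested on
  the range of s t, which is still dense.\<close>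

lemma quot_eqI:
  fixes F :: "'h \<Rightarrow>\<^sub>L 'h"
  assumes "(r, s) \<in> Bd" "t \<in> S" "\<And>\<phi>. \<phi> \<in> D \<Longrightarrow> F (s (t \<phi>)) = r (t \<phi>)"
  shows "quot (r, s) = F"
proof (rule eq_on_dense)
  show "closure (lcomp D s t ` D) = UNIV" by (rule S_dense_range[OF S_mult[OF BdD(2)[OF assms(1)] assms(2)]])
  fix x assume "x \<in> lcomp D s t ` D"
  then obtain \<phi> where \<phi>: "\<phi> \<in> D" "x = s (t \<phi>)" by auto
  then show "quot (r, s) x = F x" using quot_apply[OF assms(1), of "t \<phi>"] assms by (simp add: H_in_D)
qed

lemma quot_frac_eq:
  assumes "(r, s) \<in> Bd" "(r', s') \<in> Bd" "lcomp D r s' = lcomp D r' s"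
  shows "quot (r, s) = quot (r', s')"
proof (rule quot_eqI[OF assms(1) BdD(2)[OF assms(2)]])
  note m = BdD[OF assms(1)] BdD[OF assms(2)]
  fix \<phi> assume \<phi>: "\<phi> \<in> D"
  have "s (s' \<phi>) = s' (s \<phi>)" using m \<phi> by (intro H_comm) auto
  moreover have "r (s' \<phi>) = r' (s \<phi>)" using fun_cong[OF assms(3), of \<phi>] \<phi> by simp
  ultimately show "quot (r', s') (s (s' \<phi>)) = r (s' \<phi>)"
    using quot_apply[OF assms(2), of "s \<phi>"] m \<phi> by (simp add: H_in_D)
qed

lemma quot_mul:
  assumes "(r, s) \<in> Bd" "(r', s') \<in> Bd"
  shows "quot (lcomp D r r', lcomp D s s') = quot (r, s) o\<^sub>L quot (r', s')"
proof (rule quot_eqI[OF frac_mul_Bd[OF assms] lunit_S])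
  note m = BdD[OF assms(1)] BdD[OF assms(2)]
  fix \<phi> assume \<phi>: "\<phi> \<in> D"
  have "s (s' \<phi>) = s' (s \<phi>)" "r' (s \<phi>) = s (r' \<phi>)" using m \<phi> by (intro H_comm; auto)+
  then show "(quot (r, s) o\<^sub>L quot (r', s')) (lcomp D s s' (lunit D \<phi>)) = lcomp D r r' (lunit D \<phi>)"
    using quot_apply[OF assms(2), of "s \<phi>"] quot_apply[OF assms(1), of "r' \<phi>"] m \<phi> by (simp add: H_in_D)
qed

lemma quot_add:
  assumes "(r, s) \<in> Bd" "(r', s') \<in> Bd"
  shows "quot (ladd (lcomp D r s') (lcomp D r' s), lcomp D s s') = quot (r, s) + quot (r', s')"
proof (rule quot_eqI[OF frac_add_Bd[OF assms] lunit_S])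
  note m = BdD[OF assms(1)] BdD[OF assms(2)]
  fix \<phi> assume \<phi>: "\<phi> \<in> D"
  have "s (s' \<phi>) = s' (s \<phi>)" using m \<phi> by (intro H_comm) auto
  then show "(quot (r, s) + quot (r', s')) (lcomp D s s' (lunit D \<phi>))
      = ladd (lcomp D r s') (lcomp D r' s) (lunit D \<phi>)"
    using quot_apply[OF assms(2), of "s \<phi>"] quot_apply[OF assms(1), of "s' \<phi>"] m \<phi>
    by (simp add: H_in_D blinfun.add_left)
qed

lemma sc_Bd:
  assumes "(r, s) \<in> Bd" shows "(sc c r, s) \<in> Bd"
proof -
  obtain C where C: "C \<ge> 0" "\<And>\<phi>. \<phi> \<in> D \<Longrightarrow> norm (r \<phi>) \<le> C * norm (s \<phi>)" using Bd_bound[OF assms] by metis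
  show ?thesis
    by (rule BdI[where C="\<bar>c\<bar> * C"]) (use C BdD[OF assms] in \<open>auto simp: mult.assoc intro: mult_left_mono\<close>)
qed

lemma quot_scale:
  assumes "(r, s) \<in> Bd" shows "quot (sc c r, s) = c *\<^sub>R quot (r, s)"
  by (rule quot_eqI[OF sc_Bd[OF assms] lunit_S])
    (use quot_apply[OF assms] in \<open>simp add: blinfun.scaleR_left\<close>)

lemma one_div_Bd: "s \<in> S \<Longrightarrow> (lunit D, s) \<in> Bd"
  by (rule BdI[where C=1]) (auto simp: S_norm)

lemma quot_one: "quot (lunit D, lunit D) = id_blinfun"
  by (rule quot_eqI[OF one_div_Bd[OF lunit_S] lunit_S]) simp

text \<open>On a vector s \<phi> the form of r/s is the form of r s at \<phi>;
  \<open>pos_mult\<close> and \<open>pos_cancel\<close> pass between r and r s.\<close>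

lemma quot_nonneg_iff:
  assumes "(r, s) \<in> Bd" shows "(\<forall>x. 0 \<le> rip x (quot (r, s) x)) \<longleftrightarrow> pos r"
proof
  note m = BdD[OF assms]
  have eq: "rip (s \<phi>) (quot (r, s) (s \<phi>)) = rip \<phi> (lcomp D r s \<phi>)" if "\<phi> \<in> D" for \<phi>
    using m that by (simp add: quot_apply[OF assms] H_sym H_in_D H_comm[of r s])
  show "pos r" if "\<forall>x. 0 \<le> rip x (quot (r, s) x)"
    by (rule pos_cancel[OF m(1,2)]) (use that in \<open>simp add: pos_def eq[symmetric] del: lcomp_apply\<close>)
  show "\<forall>x. 0 \<le> rip x (quot (r, s) x)" if "pos r"
  proof
    fix x
    have p: "pos (lcomp D r s)" using pos_mult[OF m(1) that m(3) S_pos[OF m(2)]] .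
    have "0 \<le> rip (id_blinfun x) (quot (r, s) x)"
      by (rule nonneg_form_on_dense[OF S_dense_range[OF m(2)]]) (use eq posD[OF p] in \<open>auto simp del: lcomp_apply\<close>)
    then show "0 \<le> rip x (quot (r, s) x)" by simp
  qed
qed

lemma quot_algebra:
  "ordered_unital_algebra (o\<^sub>L) id_blinfun (quot ` Bd) {X \<in> quot ` Bd. \<forall>x. 0 \<le> rip x (X x)}"
proof -
  let ?B = "quot ` Bd" and ?P = "{X \<in> quot ` Bd. \<forall>x. 0 \<le> rip x (X x)}"
  have ex: "\<exists>r s. (r, s) \<in> Bd \<and> X = quot (r, s)" if "X \<in> ?B" for X using that by auto
  have zeroBd: "((\<lambda>x. 0), lunit D) \<in> Bd" by (rule BdI[where C=0]) (auto simp: lunit_S)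
  have "quot ((\<lambda>x. 0), lunit D) = 0" by (rule quot_eqI[OF zeroBd lunit_S]) simp
  then have zero: "0 \<in> ?B" using zeroBd by (metis imageI)
  have one: "id_blinfun \<in> ?B" using quot_one one_div_Bd[OF lunit_S] by (metis imageI)
  have add: "X + Y \<in> ?B" if X: "X \<in> ?B" and Y: "Y \<in> ?B" for X Y
  proof -
    obtain r s r' s' where "(r, s) \<in> Bd" "X = quot (r, s)" "(r', s') \<in> Bd" "Y = quot (r', s')"
      using ex[OF X] ex[OF Y] by metis
    then show ?thesis using quot_add frac_add_Bd by (metis imageI)
  qed
  have scale: "c *\<^sub>R X \<in> ?B" if X: "X \<in> ?B" for X c
  proof -
    obtain r s where "(r, s) \<in> Bd" "X = quot (r, s)" using ex[OF X] by metis
    then show ?thesis using quot_scale sc_Bd by (metis imageI)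
  qed
  have mult: "X o\<^sub>L Y \<in> ?B \<and> X o\<^sub>L Y = Y o\<^sub>L X \<and>
      ((\<forall>x. 0 \<le> rip x (X x)) \<longrightarrow> (\<forall>x. 0 \<le> rip x (Y x)) \<longrightarrow> (\<forall>x. 0 \<le> rip x ((X o\<^sub>L Y) x)))"
    if X: "X \<in> ?B" and Y: "Y \<in> ?B" for X Y
  proof -
    obtain r s r' s' where 1: "(r, s) \<in> Bd" "X = quot (r, s)" and 2: "(r', s') \<in> Bd" "Y = quot (r', s')"
      using ex[OF X] ex[OF Y] by metis
    note m = BdD[OF 1(1)] BdD[OF 2(1)]
    have eq: "X o\<^sub>L Y = quot (lcomp D r r', lcomp D s s')" using quot_mul[OF 1(1) 2(1)] 1 2 by simp
    have "X o\<^sub>L Y = Y o\<^sub>L X"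
      using eq quot_mul[OF 2(1) 1(1)] 1 2 lcomp_comm[OF m(1) m(4)] lcomp_comm[OF m(3) m(6)] by simp
    moreover have "X o\<^sub>L Y \<in> ?B" unfolding eq by (rule imageI[OF frac_mul_Bd[OF 1(1) 2(1)]])
    moreover have "\<forall>x. 0 \<le> rip x ((X o\<^sub>L Y) x)"
      if "\<forall>x. 0 \<le> rip x (X x)" "\<forall>x. 0 \<le> rip x (Y x)"
    proof -
      have "pos r" "pos r'"
        using quot_nonneg_iff[OF 1(1)] quot_nonneg_iff[OF 2(1)] that 1(2) 2(2) by simp_all
      then have "pos (lcomp D r r')" using pos_mult m by simp
      then show ?thesis unfolding eq using quot_nonneg_iff[OF frac_mul_Bd[OF 1(1) 2(1)]] by simp
    qed
    ultimately show ?thesis by blast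
  qed
  show ?thesis
  proof
    show "subspace ?B" using zero add scale by (auto simp: subspace_def)
    show "id_blinfun \<in> ?B" by (rule one)
    show "X o\<^sub>L Y \<in> ?B" if "X \<in> ?B" "Y \<in> ?B" for X Y using mult[OF that] by blast
    show "X o\<^sub>L Y = Y o\<^sub>L X" if "X \<in> ?B" "Y \<in> ?B" for X Y using mult[OF that] by blast
    show "X o\<^sub>L Y o\<^sub>L Z = X o\<^sub>L (Y o\<^sub>L Z)" for X Y Z :: "'h \<Rightarrow>\<^sub>L 'h" by (rule blinfun_eqI) simp
    show "X o\<^sub>L (Y + Z) = (X o\<^sub>L Y) + (X o\<^sub>L Z)" for X Y Z :: "'h \<Rightarrow>\<^sub>L 'h"
      by (rule blinfun_eqI) (simp add: blinfun.add_left blinfun.add_right)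
    show "X o\<^sub>L (c *\<^sub>R Y) = c *\<^sub>R (X o\<^sub>L Y)" for X Y :: "'h \<Rightarrow>\<^sub>L 'h" and c
      by (rule blinfun_eqI) (simp add: blinfun.scaleR_left blinfun.scaleR_right)
    show "X o\<^sub>L id_blinfun = X" for X :: "'h \<Rightarrow>\<^sub>L 'h" by (rule blinfun_eqI) simp
    show "?P \<subseteq> ?B" by blast
    show "X + Y \<in> ?P" if "X \<in> ?P" "Y \<in> ?P" for X Y
      using that add[of X Y] by (simp add: blinfun.add_left rip_simps)
    show "X o\<^sub>L Y \<in> ?P" if "X \<in> ?P" "Y \<in> ?P" for X Y
      using that mult[of X Y] by blast
    show "c *\<^sub>R X \<in> ?P" if "X \<in> ?P" "0 \<le> c" for X c
      using that scale[of X c] by (simp add: blinfun.scaleR_left rip_simps)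
    show "id_blinfun \<in> ?P" using one by (simp add: rip_self)
    show "\<exists>n. n *\<^sub>R id_blinfun - X \<in> ?P" if X: "X \<in> ?B" for X
    proof (intro exI[of _ "norm X"] CollectI conjI allI)
      have "norm X *\<^sub>R id_blinfun + (-1) *\<^sub>R X \<in> ?B" by (intro add scale X one)
      then show "norm X *\<^sub>R id_blinfun - X \<in> ?B" by simp
      fix x
      have "rip x (X x) \<le> norm x * norm (X x)" by (rule rip_le_norm)
      also have "\<dots> \<le> norm x * (norm X * norm x)" by (intro mult_left_mono norm_blinfun) simp
      finally show "0 \<le> rip x ((norm X *\<^sub>R id_blinfun - X) x)"
        by (simp add: blinfun.diff_left blinfun.scaleR_left rip_simps rip_self power2_eq_square algebra_simps)
    qed
    show "X \<in> ?P" if X: "X \<in> ?B" and le: "\<And>\<epsilon>. \<epsilon> > 0 \<Longrightarrow> X + \<epsilon> *\<^sub>R id_blinfun \<in> ?P" for X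
    proof (intro CollectI conjI allI X)
      fix x
      show "0 \<le> rip x (X x)"
      proof (rule field_le_epsilon)
        fix \<delta> :: real assume \<delta>: "\<delta> > 0"
        \<comment> \<open>Dividing \<delta> by the squared norm plus 1 keeps the error below
          \<delta>; the added 1 covers x = 0.\<close>
        have p: "(norm x)\<^sup>2 + 1 > 0" by (simp add: add_nonneg_pos)
        have "0 \<le> rip x ((X + (\<delta> / ((norm x)\<^sup>2 + 1)) *\<^sub>R id_blinfun) x)"
          using le[of "\<delta> / ((norm x)\<^sup>2 + 1)"] \<delta> p by simp
        also have "\<dots> = rip x (X x) + \<delta> / ((norm x)\<^sup>2 + 1) * (norm x)\<^sup>2"
          by (simp add: blinfun.add_left blinfun.scaleR_left rip_simps rip_self)
        also have "\<dots> \<le> rip x (X x) + \<delta>" using \<delta> p by (simp add: field_simps)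
        finally show "0 \<le> rip x (X x) + \<delta>" .
      qed
    qed
  qed
qed

text \<open>A character of the operator algebra is pulled back along \<open>quot\<close> and set to
  0 off the bounded fractions, as \<open>Kchar\<close> demands. The sign of r/s is that of its
  numerator, so the denominator may be chosen freely when this is applied.\<close>

lemma Kchar_separating:
  assumes rs: "(r, s) \<in> Bd" and np: "\<not> pos r"
  shows "\<exists>\<phi>\<in>Kchar R leq. \<phi> (r, s) < 0"
proof -
  interpret Q: ordered_unital_algebra "(o\<^sub>L)" id_blinfun "quot ` Bd" "{X \<in> quot ` Bd. \<forall>x. 0 \<le> rip x (X x)}"
    by (rule quot_algebra)
  have "quot (r, s) \<notin> {X \<in> quot ` Bd. \<forall>x. 0 \<le> rip x (X x)}" using quot_nonneg_iff[OF rs] np by blast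
  from Q.character_exists[OF imageI[OF rs] this] obtain ch :: "('h \<Rightarrow>\<^sub>L 'h) \<Rightarrow> real" where
    ch: "\<forall>X\<in>quot ` Bd. \<forall>Y\<in>quot ` Bd. ch (X + Y) = ch X + ch Y \<and> ch (X o\<^sub>L Y) = ch X * ch Y"
    and ch1: "ch id_blinfun = 1" and chP: "\<forall>X\<in>{X \<in> quot ` Bd. \<forall>x. 0 \<le> rip x (X x)}. 0 \<le> ch X"
    and neg: "ch (quot (r, s)) < 0"
    by (elim exE conjE)
  have hom: "ch (quot x + quot y) = ch (quot x) + ch (quot y)"
    "ch (quot x o\<^sub>L quot y) = ch (quot x) * ch (quot y)" if "x \<in> Bd" "y \<in> Bd" for x y
    using ch that by simp_all
  have chpos: "0 \<le> ch (quot x)" if "x \<in> Bd" "\<forall>z. 0 \<le> rip z (quot x z)" for x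
    using chP that by simp
  define \<phi> where "\<phi> x = (if x \<in> Bd then ch (quot x) else 0)" for x
  have "\<phi> \<in> Kchar R leq"
    unfolding Kchar_def
  proof (intro CollectI conjI ballI allI impI)
    show "\<phi> x = 0" if "x \<notin> Bd" for x using that by (simp add: \<phi>_def)
    show "\<phi> x = \<phi> y" if x: "x \<in> Bd" and y: "y \<in> Bd" and "frac_eq R x y" for x y
    proof -
      obtain r s r' s' where xy: "x = (r, s)" "y = (r', s')" by (metis surj_pair)
      then show ?thesis using that quot_frac_eq[of r s r' s'] by (simp add: \<phi>_def frac_eq_def)
    qed
    show "\<phi> (frac_add R x y) = \<phi> x + \<phi> y" if x: "x \<in> Bd" and y: "y \<in> Bd" for x y
    proof -
      obtain r s r' s' where xy: "x = (r, s)" "y = (r', s')" by (metis surj_pair)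
      then show ?thesis using x y hom frac_add_Bd[of r s r' s'] quot_add[of r s r' s']
        by (simp add: \<phi>_def frac_add_pair)
    qed
    show "\<phi> (frac_mul R x y) = \<phi> x * \<phi> y" if x: "x \<in> Bd" and y: "y \<in> Bd" for x y
    proof -
      obtain r s r' s' where xy: "x = (r, s)" "y = (r', s')" by (metis surj_pair)
      then show ?thesis using x y hom frac_mul_Bd[of r s r' s'] quot_mul[of r s r' s']
        by (simp add: \<phi>_def frac_mul_pair)
    qed
    show "\<phi> (\<one>\<^bsub>R\<^esub>, \<one>\<^bsub>R\<^esub>) = 1" using one_div_Bd[OF lunit_S] by (simp add: \<phi>_def quot_one ch1)
    show "0 \<le> \<phi> x" if x: "x \<in> Bd" and le: "frac_le R leq (\<zero>\<^bsub>R\<^esub>, \<one>\<^bsub>R\<^esub>) x" for x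
    proof -
      obtain r s where xy: "x = (r, s)" by (metis surj_pair)
      then have rs: "(r, s) \<in> Bd" using x by simp
      then have "pos r" using le xy BdD[OF rs] by (simp add: frac_le_def)
      then show ?thesis using quot_nonneg_iff[OF rs] chpos rs xy by (simp add: \<phi>_def)
    qed
  qed
  moreover have "\<phi> (r, s) < 0" using rs neg by (simp add: \<phi>_def)
  ultimately show ?thesis by blast
qed

end

section \<open>The extended Gelfand transformation\<close>

lemma dense_open_iff:
  "dense_open X U \<longleftrightarrow> openin X U \<and> (\<forall>V. openin X V \<and> V \<noteq> {} \<longrightarrow> U \<inter> V \<noteq> {})"
  unfolding dense_open_def by (simp add: dense_intersects_open)

lemma dense_open_Int:
  assumes "dense_open X U" "dense_open X V" shows "dense_open X (U \<inter> V)"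
  unfolding dense_open_iff
proof (intro conjI allI impI)
  show "openin X (U \<inter> V)" using assms by (simp add: dense_open_def openin_Int)
  fix W assume W: "openin X W \<and> W \<noteq> {}"
  then have "openin X (V \<inter> W) \<and> V \<inter> W \<noteq> {}" using assms(2) unfolding dense_open_iff by (simp add: openin_Int)
  then show "U \<inter> V \<inter> W \<noteq> {}" using assms(1) unfolding dense_open_iff by (simp add: Int_assoc)
qed

context herm_alg
begin

abbreviation "K \<equiv> Kchar R leq"
abbreviation "T \<equiv> Ktop R leq"

lemma topspace_T [simp]: "topspace T = K"
  by (simp add: Ktop_def)

section \<open>Rules for evaluating characters\<close>

lemma K_one: "\<phi> \<in> K \<Longrightarrow> \<phi> (lunit D, lunit D) = 1"
  unfolding Kchar_def by simp

lemma K_mul: "\<phi> \<in> K \<Longrightarrow> (r, s) \<in> Bd \<Longrightarrow> (r', s') \<in> Bd \<Longrightarrow>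
    \<phi> (lcomp D r r', lcomp D s s') = \<phi> (r, s) * \<phi> (r', s')"
  unfolding Kchar_def frac_mul_pair[symmetric] by blast

lemma K_add: "\<phi> \<in> K \<Longrightarrow> (r, s) \<in> Bd \<Longrightarrow> (r', s') \<in> Bd \<Longrightarrow>
    \<phi> (ladd (lcomp D r s') (lcomp D r' s), lcomp D s s') = \<phi> (r, s) + \<phi> (r', s')"
  unfolding Kchar_def frac_add_pair[symmetric] by blast

lemma K_eq:
  assumes "\<phi> \<in> K" "(r, s) \<in> Bd" "(r', s') \<in> Bd" "lcomp D r s' = lcomp D r' s"
  shows "\<phi> (r, s) = \<phi> (r', s')"
proof -
  have "frac_eq R (r, s) (r', s')" using assms(4) by (simp add: frac_eq_def)
  then show ?thesis using assms(1-3) unfolding Kchar_def by blast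
qed

lemma K_off: "\<phi> \<in> K \<Longrightarrow> x \<notin> Bd \<Longrightarrow> \<phi> x = 0"
  unfolding Kchar_def by blast

lemma K_pos:
  assumes "\<phi> \<in> K" "(r, s) \<in> Bd" "pos r" shows "0 \<le> \<phi> (r, s)"
proof -
  have "frac_le R leq (\<zero>\<^bsub>R\<^esub>, \<one>\<^bsub>R\<^esub>) (r, s)"
    using assms(3) BdD[OF assms(2)] by (simp add: frac_le_def)
  then show ?thesis using assms(1,2) unfolding Kchar_def by blast
qed

lemma K_recip_nonneg: "\<phi> \<in> K \<Longrightarrow> s \<in> S \<Longrightarrow> 0 \<le> \<phi> (lunit D, s)"
  by (rule K_pos) (auto simp: one_div_Bd S_pos lunit_S)

lemma div_mult_Bd:
  assumes "(r, s) \<in> Bd" "t \<in> S" shows "(r, lcomp D s t) \<in> Bd"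
  using frac_mul_Bd[OF assms(1) one_div_Bd[OF assms(2)]] BdD[OF assms(1)] by simp

lemma K_div_mult:
  assumes "\<phi> \<in> K" "(r, s) \<in> Bd" "t \<in> S"
  shows "\<phi> (r, lcomp D s t) = \<phi> (r, s) * \<phi> (lunit D, t)"
  using K_mul[OF assms(1,2) one_div_Bd[OF assms(3)]] BdD[OF assms(2)] by simp

text \<open>Both sides are the value at r/(s s'). This is what makes the transform independent of
  the denominator.\<close>

lemma K_cross:
  assumes "\<phi> \<in> K" "(r, s) \<in> Bd" "(r, s') \<in> Bd"
  shows "\<phi> (r, s) * \<phi> (lunit D, s') = \<phi> (r, s') * \<phi> (lunit D, s)"
  using K_div_mult[OF assms(1,2) BdD(2)[OF assms(3)]] K_div_mult[OF assms(1,3) BdD(2)[OF assms(2)]]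
    lcomp_comm[OF BdD(3)[OF assms(2)] BdD(3)[OF assms(3)]] by simp

lemma ladd_Bd:
  assumes "(r, s) \<in> Bd" "(r', s) \<in> Bd" shows "(ladd r r', s) \<in> Bd"
proof -
  obtain C where C: "C \<ge> 0" "\<And>\<phi>. \<phi> \<in> D \<Longrightarrow> norm (r \<phi>) \<le> C * norm (s \<phi>)" using Bd_bound[OF assms(1)] by metis
  obtain C' where C': "C' \<ge> 0" "\<And>\<phi>. \<phi> \<in> D \<Longrightarrow> norm (r' \<phi>) \<le> C' * norm (s \<phi>)" using Bd_bound[OF assms(2)] by metis
  show ?thesis
  proof (rule BdI)
    fix \<phi> assume "\<phi> \<in> D"
    then show "norm (ladd r r' \<phi>) \<le> (C + C') * norm (s \<phi>)"
      using norm_triangle_ineq[of "r \<phi>" "r' \<phi>"] C(2)[of \<phi>] C'(2)[of \<phi>] by (simp add: distrib_right)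
  qed (use BdD[OF assms(1)] BdD[OF assms(2)] in auto)
qed

text \<open>\<open>frac_add\<close> produces the denominator s^2; the common factor s is removed
  through \<open>K_eq\<close>.\<close>

lemma K_ladd:
  assumes "\<phi> \<in> K" "(r, s) \<in> Bd" "(r', s) \<in> Bd"
  shows "\<phi> (ladd r r', s) = \<phi> (r, s) + \<phi> (r', s)"
proof -
  note m = BdD[OF assms(2)] BdD[OF assms(3)]
  have "lcomp D (ladd r r') (lcomp D s s) = lcomp D (ladd (lcomp D r s) (lcomp D r' s)) s"
    by (rule H_eqI) (use m in \<open>simp_all add: H_in_D\<close>)
  then have "\<phi> (ladd r r', s) = \<phi> (ladd (lcomp D r s) (lcomp D r' s), lcomp D s s)"
    by (intro K_eq assms ladd_Bd frac_add_Bd)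
  then show ?thesis using K_add[OF assms] by simp
qed

lemma K_minus_one:
  assumes "\<phi> \<in> K" shows "\<phi> (sc (-1) (lunit D), lunit D) = -1"
proof -
  have z: "((\<lambda>x. 0), lunit D) \<in> Bd" by (rule BdI[where C=0]) (auto simp: lunit_S)
  note o = one_div_Bd[OF lunit_S]
  have "ladd (\<lambda>x. 0) (\<lambda>x. 0 :: 'h) = (\<lambda>x. 0)" by (simp add: fun_eq_iff)
  then have "\<phi> ((\<lambda>x. 0), lunit D) = 0" using K_ladd[OF assms z z] by simp
  moreover have "ladd (sc (-1) (lunit D)) (lunit D) = (\<lambda>x. 0)" by (simp add: fun_eq_iff)
  ultimately show ?thesis using K_ladd[OF assms sc_Bd[OF o, of "-1"] o] K_one[OF assms] by simp
qed

text \<open>Lets functions on \<open>K\<close> be assembled from evaluations by polynomial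
  expressions with integer coefficients, without writing out the underlying fraction.\<close>

definition represented :: "((('h \<Rightarrow> 'h) \<times> ('h \<Rightarrow> 'h) \<Rightarrow> real) \<Rightarrow> real) \<Rightarrow> bool" where
  "represented g \<longleftrightarrow> (\<exists>x\<in>Bd. \<forall>\<phi>\<in>K. g \<phi> = \<phi> x)"

lemma represented_eval: "x \<in> Bd \<Longrightarrow> represented (\<lambda>\<phi>. \<phi> x)"
  unfolding represented_def by blast

lemma represented_add:
  assumes "represented f" "represented g" shows "represented (\<lambda>\<phi>. f \<phi> + g \<phi>)"
proof -
  obtain r s where 1: "(r, s) \<in> Bd" "\<forall>\<phi>\<in>K. f \<phi> = \<phi> (r, s)" using assms(1) unfolding represented_def by auto
  obtain r' s' where 2: "(r', s') \<in> Bd" "\<forall>\<phi>\<in>K. g \<phi> = \<phi> (r', s')" using assms(2) unfolding represented_def by auto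
  show ?thesis unfolding represented_def
    by (rule bexI[OF _ frac_add_Bd[OF 1(1) 2(1)]]) (use 1 2 K_add in simp)
qed

lemma represented_mult:
  assumes "represented f" "represented g" shows "represented (\<lambda>\<phi>. f \<phi> * g \<phi>)"
proof -
  obtain r s where 1: "(r, s) \<in> Bd" "\<forall>\<phi>\<in>K. f \<phi> = \<phi> (r, s)" using assms(1) unfolding represented_def by auto
  obtain r' s' where 2: "(r', s') \<in> Bd" "\<forall>\<phi>\<in>K. g \<phi> = \<phi> (r', s')" using assms(2) unfolding represented_def by auto
  show ?thesis unfolding represented_def
    by (rule bexI[OF _ frac_mul_Bd[OF 1(1) 2(1)]]) (use 1 2 K_mul in simp)
qed

lemma represented_one: "represented (\<lambda>\<phi>. 1)"
  unfolding represented_def by (rule bexI[OF _ one_div_Bd[OF lunit_S]]) (simp add: K_one)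

lemma represented_minus_one: "represented (\<lambda>\<phi>. -1)"
  unfolding represented_def
  by (rule bexI[OF _ sc_Bd[OF one_div_Bd[OF lunit_S], of "-1"]]) (simp add: K_minus_one)

lemma represented_nat: "represented (\<lambda>\<phi>. real n)"
proof (induction n)
  case 0 show ?case using represented_add[OF represented_one represented_minus_one] by simp
next
  case (Suc n) show ?case using represented_add[OF represented_one Suc] by simp
qed

lemma represented_int: "represented (\<lambda>\<phi>. of_int k)"
proof (cases "k \<ge> 0")
  case True then show ?thesis using represented_nat[of "nat k"] by simp
next
  case False then show ?thesis
    using represented_mult[OF represented_minus_one represented_nat[of "nat (- k)"]] by simp
qed

lemma represented_sum:
  assumes "finite I" "\<And>i. i \<in> I \<Longrightarrow> represented (f i)" shows "represented (\<lambda>\<phi>. \<Sum>i\<in>I. f i \<phi>)"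
  using assms
proof (induction I rule: finite_induct)
  case empty show ?case using represented_nat[of 0] by simp
next
  case (insert i I) then show ?case using represented_add[of "f i"] by simp
qed

section \<open>The topology of the character space\<close>

lemma continuous_map_eval: "continuous_map T euclideanreal (\<lambda>\<phi>. \<phi> x)"
  unfolding Ktop_def by (intro continuous_map_from_subtopology continuous_map_product_projection) simp

text \<open>Coordinates outside the bounded fractions are 0 on all of \<open>K\<close>, so a basic
  open set of the product topology constrains only finitely many bounded fractions; a finite minimum
  gives a common radius.\<close>

lemma T_basic_neighbourhood:
  assumes "openin T U" "\<phi>0 \<in> U"
  obtains I \<epsilon> where "finite I" "I \<subseteq> Bd" "\<epsilon> > 0"
    "\<And>\<phi>. \<phi> \<in> K \<Longrightarrow> (\<And>x. x \<in> I \<Longrightarrow> \<bar>\<phi> x - \<phi>0 x\<bar> < \<epsilon>) \<Longrightarrow> \<phi> \<in> U"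
proof -
  obtain V where V: "openin (powertop_real UNIV) V" "U = V \<inter> K"
    using assms(1) unfolding Ktop_def openin_subtopology by blast
  have \<phi>0: "\<phi>0 \<in> V" "\<phi>0 \<in> K" using assms(2) V(2) by auto
  from bspec[OF iffD1[OF openin_product_topology_alt V(1)] \<phi>0(1)] obtain W where
    fin: "finite {i \<in> UNIV. W i \<noteq> topspace euclideanreal}" and opn: "\<forall>i\<in>UNIV. openin euclideanreal (W i)"
    and W: "\<phi>0 \<in> Pi\<^sub>E UNIV W" "Pi\<^sub>E UNIV W \<subseteq> V"
    by (elim exE conjE)
  let ?I = "{i. W i \<noteq> UNIV}"
  have finI: "finite ?I" using fin by simp
  have "\<forall>i. \<exists>e>0. \<forall>y. \<bar>y - \<phi>0 i\<bar> < e \<longrightarrow> y \<in> W i"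
  proof
    fix i
    have "\<phi>0 i \<in> W i" using W(1) by auto
    then show "\<exists>e>0. \<forall>y. \<bar>y - \<phi>0 i\<bar> < e \<longrightarrow> y \<in> W i"
      using bspec[OF opn UNIV_I, of i] by (simp add: open_dist dist_real_def)
  qed
  then obtain e where e: "\<And>i. e i > (0::real)" "\<And>i y. \<bar>y - \<phi>0 i\<bar> < e i \<Longrightarrow> y \<in> W i" by metis
  \<comment> \<open>The 1 keeps the set nonempty when no coordinate is constrained.\<close>
  define \<epsilon> where "\<epsilon> = Min (insert 1 (e ` ?I))"
  have \<epsilon>0: "\<epsilon> > 0" unfolding \<epsilon>_def using finI e(1) by (subst Min_gr_iff) auto
  have \<epsilon>le: "\<epsilon> \<le> e i" if "i \<in> ?I" for i unfolding \<epsilon>_def using finI that by (intro Min_le) auto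
  show ?thesis
  proof (rule that[of "?I \<inter> Bd" \<epsilon>])
    show "finite (?I \<inter> Bd)" using finI by blast
    show "?I \<inter> Bd \<subseteq> Bd" by blast
    show "\<epsilon> > 0" by (rule \<epsilon>0)
    fix \<phi> assume \<phi>: "\<phi> \<in> K" and near: "\<And>x. x \<in> ?I \<inter> Bd \<Longrightarrow> \<bar>\<phi> x - \<phi>0 x\<bar> < \<epsilon>"
    have "\<phi> i \<in> W i" for i
    proof (cases "i \<in> ?I")
      case True
      have "\<bar>\<phi> i - \<phi>0 i\<bar> < \<epsilon>"
        using near[of i] True K_off[OF \<phi>, of i] K_off[OF \<phi>0(2), of i] \<epsilon>0 by (cases "i \<in> Bd") auto
      then show ?thesis using \<epsilon>le[OF True] by (intro e(2)) simp
    qed auto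
    then have "\<phi> \<in> V" using W(2) by auto
    then show "\<phi> \<in> U" using V(2) \<phi> by simp
  qed
qed

text \<open>If \<open>1/s\<close> vanished on a neighbourhood of \<open>\<phi>0\<close>, take a function \<open>g\<close> represented by a fraction
  \<open>r/t\<close> that is negative at \<open>\<phi>0\<close> and nonnegative off that neighbourhood. Then \<open>g/s\<close> is
  nonnegative everywhere, so \<open>r \<ge> 0\<close> because characters separate; but \<open>g \<phi>0 < 0\<close>.\<close>

lemma Ofin_dense_open:
  assumes s: "s \<in> S" shows "dense_open T (Ofin R leq s)"
  unfolding dense_open_iff
proof (intro conjI allI impI)
  have "openin T {\<phi> \<in> topspace T. \<phi> (lunit D, s) \<in> {0<..}}"
    by (rule openin_continuous_map_preimage[OF continuous_map_eval]) simp
  moreover have "{\<phi> \<in> topspace T. \<phi> (lunit D, s) \<in> {0<..}} = Ofin R leq s" by (auto simp: Ofin_def)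
  ultimately show "openin T (Ofin R leq s)" by simp
  fix U assume U: "openin T U \<and> U \<noteq> {}"
  then obtain \<phi>0 where \<phi>0: "\<phi>0 \<in> U" by auto
  then have \<phi>0K: "\<phi>0 \<in> K" using U openin_subset by fastforce
  obtain I \<epsilon> where I: "finite I" "I \<subseteq> Bd" "\<epsilon> > 0"
    and near: "\<And>\<phi>. \<phi> \<in> K \<Longrightarrow> (\<And>x. x \<in> I \<Longrightarrow> \<bar>\<phi> x - \<phi>0 x\<bar> < \<epsilon>) \<Longrightarrow> \<phi> \<in> U"
    using T_basic_neighbourhood[of U \<phi>0] U \<phi>0 by metis
  define N where "N = card I"
  \<comment> \<open>The scaled coordinates will deviate from the integers \<open>k x\<close> by at
    most 1 at \<phi>0 and by less than N + 1 at \<phi>; \<open>M\<close> is chosen so that the total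
    N + 2 stays below M \<epsilon>.\<close>
  obtain M :: nat where "(real N + 2) / \<epsilon> < real M" using reals_Archimedean2 by blast
  then have M: "real N + 2 < M * \<epsilon>" using I(3) by (simp add: field_simps)
  then have M0: "real M > 0" using I(3) by (cases "M = 0") auto
  \<comment> \<open>\<open>represented\<close> is built up with integer constants, so the values at
    \<phi>0 are scaled by \<open>M\<close> and rounded. At \<phi>0 each square in \<open>g\<close>
    is at most 1, so subtracting N + 1 makes \<open>g\<close> negative there; conversely g \<phi> <
    0 keeps every square below N + 1.\<close>
  define k where "k x = \<lfloor>M * \<phi>0 x\<rfloor>" for x
  define g where "g \<phi> = (\<Sum>x\<in>I. (M * \<phi> x + of_int (- k x)) * (M * \<phi> x + of_int (- k x))) + of_int (- int (N + 1))"
    for \<phi> :: "('h \<Rightarrow> 'h) \<times> ('h \<Rightarrow> 'h) \<Rightarrow> real"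
  have "represented g"
    unfolding g_def using I(2)
    by (intro represented_add represented_sum represented_mult represented_int represented_nat represented_eval I(1)) auto
  then obtain r t where rt: "(r, t) \<in> Bd" and gr: "\<And>\<phi>. \<phi> \<in> K \<Longrightarrow> g \<phi> = \<phi> (r, t)" unfolding represented_def by auto
  have "(M * \<phi>0 x + of_int (- k x)) * (M * \<phi>0 x + of_int (- k x)) \<le> 1" for x
    unfolding k_def by (rule mult_le_one) (auto; linarith)+
  then have "(\<Sum>x\<in>I. (M * \<phi>0 x + of_int (- k x)) * (M * \<phi>0 x + of_int (- k x))) \<le> (\<Sum>x\<in>I. 1)"
    by (intro sum_mono)
  then have "g \<phi>0 < 0" unfolding g_def N_def by simp
  then have "\<not> pos r" using K_pos[OF \<phi>0K rt] gr[OF \<phi>0K] by linarith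
  \<comment> \<open>This character is itself a point of the intersection: as \<phi>(1/s) \<ge> 0, a
    negative product forces both \<phi>(1/s) > 0 and g \<phi> < 0, and the latter places \<phi> in
    \<open>U\<close>.\<close>
  then obtain \<phi> where \<phi>: "\<phi> \<in> K" "\<phi> (r, lcomp D t s) < 0"
    using Kchar_separating[OF div_mult_Bd[OF rt s]] by blast
  then have neg: "g \<phi> * \<phi> (lunit D, s) < 0" using K_div_mult[OF \<phi>(1) rt s] gr by simp
  then have pos: "\<phi> (lunit D, s) > 0" and gneg: "g \<phi> < 0"
    using K_recip_nonneg[OF \<phi>(1) s] by (auto simp: mult_less_0_iff)
  have "\<bar>\<phi> x - \<phi>0 x\<bar> < \<epsilon>" if x: "x \<in> I" for x
  proof -
    let ?d = "M * \<phi> x + of_int (- k x)"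
    have "?d * ?d \<le> (\<Sum>x\<in>I. (M * \<phi> x + of_int (- k x)) * (M * \<phi> x + of_int (- k x)))"
      by (rule member_le_sum[OF x _ I(1)]) simp
    also have "\<dots> < real N + 1" using gneg unfolding g_def by simp
    also have "\<dots> \<le> (real N + 1) * (real N + 1)" by simp
    finally have "\<bar>?d\<bar>\<^sup>2 < (real N + 1)\<^sup>2" unfolding power2_abs by (simp only: power2_eq_square)
    then have "\<bar>?d\<bar> < real N + 1" by (rule power2_less_imp_less) simp
    moreover have "\<bar>M * \<phi>0 x + of_int (- k x)\<bar> \<le> 1" unfolding k_def by (auto simp: abs_le_iff; linarith)
    ultimately have "\<bar>M * \<phi> x - M * \<phi>0 x\<bar> < M * \<epsilon>" using M by linarith
    then have "M * \<bar>\<phi> x - \<phi>0 x\<bar> < M * \<epsilon>" by (simp add: abs_mult flip: right_diff_distrib)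
    then show ?thesis using M0 by simp
  qed
  then have "\<phi> \<in> U" using near[OF \<phi>(1)] by blast
  moreover have "\<phi> \<in> Ofin R leq s" using \<phi>(1) pos by (simp add: Ofin_def)
  ultimately show "Ofin R leq s \<inter> U \<noteq> {}" by blast
qed

section \<open>Algebraic and order properties of the transform\<close>

lemma OfinD: "\<phi> \<in> Ofin R leq s \<Longrightarrow> \<phi> \<in> K" "\<phi> \<in> Ofin R leq s \<Longrightarrow> \<phi> (lunit D, s) > 0"
  by (simp_all add: Ofin_def)

lemma gelfand_rep_R: "gelfand_rep R leq r s = (Ofin R leq s, \<lambda>\<phi>. inverse (\<phi> (lunit D, s)) * \<phi> (r, s))"
  by (simp add: gelfand_rep_def)

lemma cae_rep_gelfand_rep:
  assumes "(r, s) \<in> Bd" shows "cae_rep T (gelfand_rep R leq r s)"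
  unfolding cae_rep_def gelfand_rep_R fst_conv snd_conv
proof
  show "dense_open T (Ofin R leq s)" by (rule Ofin_dense_open[OF BdD(2)[OF assms]])
  show "continuous_map (subtopology T (Ofin R leq s)) euclideanreal (\<lambda>\<phi>. inverse (\<phi> (lunit D, s)) * \<phi> (r, s))"
    by (intro continuous_map_real_mult continuous_map_real_inverse continuous_map_from_subtopology
        continuous_map_eval) (auto dest: OfinD(2))
qed

text \<open>The choice inside \<open>gelfand\<close> is legitimate because 1 + r^2 dominates r in
  norm and so is always an admissible denominator.\<close>

lemma gelfand_obtain:
  assumes "r \<in> H"
  obtains s where "s \<in> S" "(r, s) \<in> Bd" "gelfand R leq r = gelfand_rep R leq r s"
proof -
  have "(r, one_plus_sq r) \<in> Bd"
    by (rule BdI[where C=1]) (use one_plus_sq_norm[OF assms] S_one_plus_sq[OF assms] assms in auto)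
  then have "\<exists>s. s \<in> Loc R leq \<and> (r, s) \<in> Bd" using BdD Loc_eq by blast
  from someI_ex[OF this] show ?thesis using that unfolding gelfand_def Loc_eq by blast
qed

lemma gelfand_rep_indep:
  assumes "(r, s) \<in> Bd" "(r, s') \<in> Bd"
  shows "cae_eq T (gelfand_rep R leq r s) (gelfand_rep R leq r s')"
  unfolding cae_eq_def gelfand_rep_R fst_conv snd_conv
proof (intro exI[of _ "Ofin R leq s \<inter> Ofin R leq s'"] conjI ballI)
  show "dense_open T (Ofin R leq s \<inter> Ofin R leq s')"
    by (intro dense_open_Int Ofin_dense_open BdD(2)[OF assms(1)] BdD(2)[OF assms(2)])
  fix \<phi> assume "\<phi> \<in> Ofin R leq s \<inter> Ofin R leq s'"
  then have \<phi>: "\<phi> \<in> K" "\<phi> (lunit D, s) > 0" "\<phi> (lunit D, s') > 0" by (auto dest: OfinD)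
  show "inverse (\<phi> (lunit D, s)) * \<phi> (r, s) = inverse (\<phi> (lunit D, s')) * \<phi> (r, s')"
    using K_cross[OF \<phi>(1) assms] \<phi>(2,3) by (simp add: field_simps)
qed simp

text \<open>The denominators \<open>s\<close>, \<open>s'\<close> and \<open>u\<close> chosen for the
  three transforms are unrelated. On the dense open set where all three reciprocals are positive,
  \<open>K_cross\<close> compares \<open>u\<close> with the common denominator s s'. Products are
  treated in the same way.\<close>

lemma gelfand_add:
  assumes r: "r \<in> H" and r': "r' \<in> H"
  shows "cae_eq T (gelfand R leq (ladd r r')) (cae_add (gelfand R leq r) (gelfand R leq r'))"
proof -
  obtain s where s: "s \<in> S" "(r, s) \<in> Bd" "gelfand R leq r = gelfand_rep R leq r s" using gelfand_obtain[OF r] .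
  obtain s' where s': "s' \<in> S" "(r', s') \<in> Bd" "gelfand R leq r' = gelfand_rep R leq r' s'" using gelfand_obtain[OF r'] .
  obtain u where u: "u \<in> S" "(ladd r r', u) \<in> Bd" "gelfand R leq (ladd r r') = gelfand_rep R leq (ladd r r') u"
    using gelfand_obtain[of "ladd r r'"] r r' by auto
  show ?thesis
    unfolding cae_eq_def cae_add_def s(3) s'(3) u(3) gelfand_rep_R fst_conv snd_conv
  proof (intro exI[of _ "Ofin R leq u \<inter> (Ofin R leq s \<inter> Ofin R leq s')"] conjI ballI)
    show "dense_open T (Ofin R leq u \<inter> (Ofin R leq s \<inter> Ofin R leq s'))"
      by (intro dense_open_Int Ofin_dense_open s s' u)
    fix \<phi> assume "\<phi> \<in> Ofin R leq u \<inter> (Ofin R leq s \<inter> Ofin R leq s')"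
    then have \<phi>: "\<phi> \<in> K" "\<phi> (lunit D, u) > 0" "\<phi> (lunit D, s) > 0" "\<phi> (lunit D, s') > 0" by (auto dest: OfinD)
    have ss': "lcomp D s' s = lcomp D s s'" using s(1) s'(1) by (intro lcomp_comm) auto
    note b1 = div_mult_Bd[OF s(2) s'(1)] and b2 = div_mult_Bd[OF s'(2) s(1), unfolded ss']
    have "\<phi> (ladd r r', u) * \<phi> (lunit D, lcomp D s s') = \<phi> (ladd r r', lcomp D s s') * \<phi> (lunit D, u)"
      by (rule K_cross[OF \<phi>(1) u(2) ladd_Bd[OF b1 b2]])
    moreover have "\<phi> (lunit D, lcomp D s s') = \<phi> (lunit D, s) * \<phi> (lunit D, s')"
      by (rule K_div_mult[OF \<phi>(1) one_div_Bd[OF s(1)] s'(1)])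
    moreover have "\<phi> (ladd r r', lcomp D s s') = \<phi> (r, s) * \<phi> (lunit D, s') + \<phi> (r', s') * \<phi> (lunit D, s)"
      using K_ladd[OF \<phi>(1) b1 b2] K_div_mult[OF \<phi>(1) s(2) s'(1)] K_div_mult[OF \<phi>(1) s'(2) s(1)] ss' by simp
    ultimately show "inverse (\<phi> (lunit D, u)) * \<phi> (ladd r r', u) =
        inverse (\<phi> (lunit D, s)) * \<phi> (r, s) + inverse (\<phi> (lunit D, s')) * \<phi> (r', s')"
      using \<phi>(2-4) by (simp add: field_simps)
  qed auto
qed

lemma gelfand_mult:
  assumes r: "r \<in> H" and r': "r' \<in> H"
  shows "cae_eq T (gelfand R leq (lcomp D r r')) (cae_mul (gelfand R leq r) (gelfand R leq r'))"
proof -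
  obtain s where s: "s \<in> S" "(r, s) \<in> Bd" "gelfand R leq r = gelfand_rep R leq r s" using gelfand_obtain[OF r] .
  obtain s' where s': "s' \<in> S" "(r', s') \<in> Bd" "gelfand R leq r' = gelfand_rep R leq r' s'" using gelfand_obtain[OF r'] .
  obtain u where u: "u \<in> S" "(lcomp D r r', u) \<in> Bd"
    "gelfand R leq (lcomp D r r') = gelfand_rep R leq (lcomp D r r') u"
    using gelfand_obtain[of "lcomp D r r'"] r r' by auto
  show ?thesis
    unfolding cae_eq_def cae_mul_def s(3) s'(3) u(3) gelfand_rep_R fst_conv snd_conv
  proof (intro exI[of _ "Ofin R leq u \<inter> (Ofin R leq s \<inter> Ofin R leq s')"] conjI ballI)
    show "dense_open T (Ofin R leq u \<inter> (Ofin R leq s \<inter> Ofin R leq s'))"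
      by (intro dense_open_Int Ofin_dense_open s s' u)
    fix \<phi> assume "\<phi> \<in> Ofin R leq u \<inter> (Ofin R leq s \<inter> Ofin R leq s')"
    then have \<phi>: "\<phi> \<in> K" "\<phi> (lunit D, u) > 0" "\<phi> (lunit D, s) > 0" "\<phi> (lunit D, s') > 0" by (auto dest: OfinD)
    have "\<phi> (lcomp D r r', u) * \<phi> (lunit D, lcomp D s s') = \<phi> (lcomp D r r', lcomp D s s') * \<phi> (lunit D, u)"
      by (rule K_cross[OF \<phi>(1) u(2) frac_mul_Bd[OF s(2) s'(2)]])
    moreover have "\<phi> (lunit D, lcomp D s s') = \<phi> (lunit D, s) * \<phi> (lunit D, s')"
      by (rule K_div_mult[OF \<phi>(1) one_div_Bd[OF s(1)] s'(1)])
    moreover have "\<phi> (lcomp D r r', lcomp D s s') = \<phi> (r, s) * \<phi> (r', s')"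
      by (rule K_mul[OF \<phi>(1) s(2) s'(2)])
    ultimately show "inverse (\<phi> (lunit D, u)) * \<phi> (lcomp D r r', u) =
        inverse (\<phi> (lunit D, s)) * \<phi> (r, s) * (inverse (\<phi> (lunit D, s')) * \<phi> (r', s'))"
      using \<phi>(2-4) by (simp add: field_simps)
  qed auto
qed

lemma gelfand_one: "cae_eq T (gelfand R leq (lunit D)) (cae_const T 1)"
proof -
  obtain s where s: "s \<in> S" "(lunit D, s) \<in> Bd" "gelfand R leq (lunit D) = gelfand_rep R leq (lunit D) s"
    using gelfand_obtain[OF lunit_H] .
  show ?thesis
    unfolding cae_eq_def cae_const_def s(3) gelfand_rep_R fst_conv snd_conv
    by (intro exI[of _ "Ofin R leq s"] conjI ballI Ofin_dense_open s) (auto dest: OfinD)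
qed

text \<open>A character that is negative at r/s may lie outside \<open>Ofin R leq s\<close>. But r/s
  stays negative on an open neighbourhood, which meets the dense set \<open>W\<close>, and there 1/s
  > 0 makes the transform negative as well.\<close>

lemma gelfand_pos_iff:
  assumes r: "r \<in> H" shows "cae_le T (cae_const T 0) (gelfand R leq r) \<longleftrightarrow> pos r"
proof -
  obtain s where s: "s \<in> S" "(r, s) \<in> Bd" "gelfand R leq r = gelfand_rep R leq r s" using gelfand_obtain[OF r] .
  show ?thesis
    unfolding cae_le_def cae_const_def s(3) gelfand_rep_R fst_conv snd_conv
  proof
    assume r0: "pos r"
    have "0 \<le> inverse (\<phi> (lunit D, s)) * \<phi> (r, s)" if "\<phi> \<in> Ofin R leq s" for \<phi>
      using OfinD(2)[OF that] K_pos[OF OfinD(1)[OF that] s(2) r0] by simp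
    then show "\<exists>W. dense_open T W \<and> W \<subseteq> topspace T \<inter> Ofin R leq s \<and>
        (\<forall>\<phi>\<in>W. 0 \<le> inverse (\<phi> (lunit D, s)) * \<phi> (r, s))"
      using Ofin_dense_open[OF s(1)] OfinD(1) by (intro exI[of _ "Ofin R leq s"]) auto
  next
    assume "\<exists>W. dense_open T W \<and> W \<subseteq> topspace T \<inter> Ofin R leq s \<and>
        (\<forall>\<phi>\<in>W. 0 \<le> inverse (\<phi> (lunit D, s)) * \<phi> (r, s))"
    then obtain W where W: "dense_open T W" "W \<subseteq> Ofin R leq s"
      "\<And>\<phi>. \<phi> \<in> W \<Longrightarrow> 0 \<le> inverse (\<phi> (lunit D, s)) * \<phi> (r, s)" by auto
    show "pos r"
    proof (rule ccontr)
      assume "\<not> pos r"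
      then obtain \<phi> where "\<phi> \<in> K" "\<phi> (r, s) < 0" using Kchar_separating[OF s(2)] by blast
      moreover have "openin T {\<phi> \<in> topspace T. \<phi> (r, s) \<in> {..<0}}"
        by (rule openin_continuous_map_preimage[OF continuous_map_eval]) simp
      ultimately have "W \<inter> {\<phi> \<in> topspace T. \<phi> (r, s) \<in> {..<0}} \<noteq> {}"
        using W(1) unfolding dense_open_iff by auto
      then obtain \<psi> where \<psi>: "\<psi> \<in> W" "\<psi> (r, s) < 0" by auto
      then have "\<psi> (lunit D, s) > 0" using W(2) OfinD(2) by blast
      then show False using W(3)[OF \<psi>(1)] \<psi>(2) by (simp add: zero_le_mult_iff)
    qed
  qed
qed

end

theorem theorem40:
  fixes J :: "'h::banach \<Rightarrow> 'h" and ip :: "'h \<Rightarrow> 'h \<Rightarrow> complex"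
    and D :: "'h set" and A :: "('h \<Rightarrow> 'h) set"
  defines "R \<equiv> herm_ring D ip A" and "leq \<equiv> op_le D ip"
  assumes "hilbert_ip J ip"
    and "dense_subspace J D"
    and "comm_star_subalg J D ip A"
    and "\<forall>a\<in>carrier R. leq \<zero>\<^bsub>R\<^esub> a \<longrightarrow> ess_selfadjoint ip D (\<one>\<^bsub>R\<^esub> \<oplus>\<^bsub>R\<^esub> a)"
  shows "po_cring R leq \<and> archimedean_ring R leq \<and> localizable R leq \<and>
    (\<forall>r\<in>carrier R. \<forall>s\<in>Loc R leq. (r, s) \<in> BdFracs R leq \<longrightarrow>
        cae_rep (Ktop R leq) (gelfand_rep R leq r s) \<and>
        (\<forall>s'\<in>Loc R leq. (r, s') \<in> BdFracs R leq \<longrightarrow>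
           cae_eq (Ktop R leq) (gelfand_rep R leq r s) (gelfand_rep R leq r s'))) \<and>
    (\<forall>r\<in>carrier R. \<forall>r'\<in>carrier R.
        cae_eq (Ktop R leq) (gelfand R leq (r \<oplus>\<^bsub>R\<^esub> r')) (cae_add (gelfand R leq r) (gelfand R leq r')) \<and>
        cae_eq (Ktop R leq) (gelfand R leq (r \<otimes>\<^bsub>R\<^esub> r')) (cae_mul (gelfand R leq r) (gelfand R leq r'))) \<and>
    cae_eq (Ktop R leq) (gelfand R leq \<one>\<^bsub>R\<^esub>) (cae_const (Ktop R leq) 1) \<and>
    (\<forall>r\<in>carrier R. leq \<zero>\<^bsub>R\<^esub> r \<longrightarrow> cae_le (Ktop R leq) (cae_const (Ktop R leq) 0) (gelfand R leq r)) \<and>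
    (\<forall>r\<in>carrier R. cae_le (Ktop R leq) (cae_const (Ktop R leq) 0) (gelfand R leq r) \<longrightarrow> leq \<zero>\<^bsub>R\<^esub> r)"
proof -
  interpret M: herm_alg J ip D A
    by standard (use assms(3-6) in \<open>simp_all add: R_def leq_def\<close>)
  have po: "po_cring R leq" "archimedean_ring R leq" "localizable R leq"
    unfolding R_def leq_def by (rule M.po_cring_R M.archimedean_R M.localizable_R)+
  have rep: "cae_rep (Ktop R leq) (gelfand_rep R leq r s)" if "(r, s) \<in> BdFracs R leq" for r s
    using that unfolding R_def leq_def by (rule M.cae_rep_gelfand_rep)
  have indep: "cae_eq (Ktop R leq) (gelfand_rep R leq r s) (gelfand_rep R leq r s')"
    if "(r, s) \<in> BdFracs R leq" "(r, s') \<in> BdFracs R leq" for r s s'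
    using that unfolding R_def leq_def by (rule M.gelfand_rep_indep)
  have hom: "cae_eq (Ktop R leq) (gelfand R leq (r \<oplus>\<^bsub>R\<^esub> r')) (cae_add (gelfand R leq r) (gelfand R leq r'))"
    "cae_eq (Ktop R leq) (gelfand R leq (r \<otimes>\<^bsub>R\<^esub> r')) (cae_mul (gelfand R leq r) (gelfand R leq r'))"
    if "r \<in> carrier R" "r' \<in> carrier R" for r r'
    using that M.gelfand_add M.gelfand_mult unfolding R_def leq_def by simp_all
  have one: "cae_eq (Ktop R leq) (gelfand R leq \<one>\<^bsub>R\<^esub>) (cae_const (Ktop R leq) 1)"
    using M.gelfand_one unfolding R_def leq_def by simp
  have pos: "cae_le (Ktop R leq) (cae_const (Ktop R leq) 0) (gelfand R leq r) \<longleftrightarrow> leq \<zero>\<^bsub>R\<^esub> r"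
    if "r \<in> carrier R" for r
    using that M.gelfand_pos_iff unfolding R_def leq_def by simp
  show ?thesis using po rep indep hom one pos by blast
qed

end
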